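(* Let $\mathbf{h}=(h_0,\dots,h_d)\in\mathbb{N}^{d+1}$ with $h_0=1$. Assume there exists $k\in\{1,\dots,d-1\}$ such that $h_j=0$ for $j>k$ and $h_j>0$ for $1\le j\le k$. Define $\mathbf{h'}=(h'_0,\dots,h'_d)=(1,h_1-1,h_2-1,\dots,h_k-1,0,\dots,0)$ and $\partial h'_j=\sum_{i=0}^j(h'_i-h'_{d-i})$. Suppose that either (a) $\partial h'_j>0$ for all $0\le j\le\lfloor(d-1)/2\rfloor$; or (b) $\partial h'_j\ge0$ for all $0\le j\le\lfloor(d-1)/2\rfloor$, and, with $n$ the smallest number in $0<n\le\lfloor(d-1)/2\rfloor$ such that $\partial h'_n=0$, the sum $\sum_{i=0}^d h'_i$ is even and $\partial h'_l\le\sum_{i=0}^{n-1}h'_{l-i}$ for $n+1\le l\le d-(n+1)$. Then there exists a simplicial poset $P$ such that $|\Gamma(P)|$ is a $(d-1)$-ball and $h(P)=\mathbf{h}$.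
   Context: A simplicial poset is a finite poset $P$ with a minimum element $\hat 0$ such that for every $p\in P$ the closed interval $[\hat 0,p]$ is a Boolean algebra. There is a regular CW-complex $\Gamma(P)$ whose face poset is $P$ ($\hat 0$ corresponding to the empty face). Its closed faces are simplices, but distinct faces may have the same vertex set. An element $p$ with $[\hat0,p]$ Boolean of rank $i+1$ is an $i$-dimensional face. $f_i(P)$ is the number of $i$-dimensional faces ($f_{-1}=1$), and $P$ has dimension $d-1$ if $d-1$ is the largest $i$ with $f_i\neq 0$. For a $(d-1)$-dimensional simplicial poset the $h$-vector $h(P)=(h_0,\dots,h_d)$ is defined by $\sum_{i=0}^d h_ix^i=\sum_{i=0}^d f_{i-1}x^i(1-x)^{d-i}$. $|\Gamma(P)|$ denotes the geometric realization. *)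

theory Defs
  imports "HOL-Analysis.Analysis"
begin

definition finite_poset :: "'a set \<Rightarrow> ('a \<Rightarrow> 'a \<Rightarrow> bool) \<Rightarrow> bool" where
  "finite_poset P le \<longleftrightarrow> finite P \<and>
     (\<forall>x\<in>P. le x x) \<and>
     (\<forall>x\<in>P. \<forall>y\<in>P. le x y \<and> le y x \<longrightarrow> x = y) \<and>
     (\<forall>x\<in>P. \<forall>y\<in>P. \<forall>z\<in>P. le x y \<and> le y z \<longrightarrow> le x z)"

definition is_min_elem :: "'a set \<Rightarrow> ('a \<Rightarrow> 'a \<Rightarrow> bool) \<Rightarrow> 'a \<Rightarrow> bool" where
  "is_min_elem P le z \<longleftrightarrow> z \<in> P \<and> (\<forall>x\<in>P. le z x)"

definition interval :: "'a set \<Rightarrow> ('a \<Rightarrow> 'a \<Rightarrow> bool) \<Rightarrow> 'a \<Rightarrow> 'a \<Rightarrow> 'a set" where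
  "interval P le z p = {q\<in>P. le z q \<and> le q p}"

definition boolean_of_rank :: "'a set \<Rightarrow> ('a \<Rightarrow> 'a \<Rightarrow> bool) \<Rightarrow> 'a \<Rightarrow> 'a \<Rightarrow> nat \<Rightarrow> bool" where
  "boolean_of_rank P le z p r \<longleftrightarrow>
     (\<exists>(S::nat set) f. finite S \<and> card S = r \<and>
        bij_betw f (interval P le z p) (Pow S) \<and>
        (\<forall>x\<in>interval P le z p. \<forall>y\<in>interval P le z p. le x y \<longleftrightarrow> f x \<subseteq> f y))"

definition simplicial_poset :: "'a set \<Rightarrow> ('a \<Rightarrow> 'a \<Rightarrow> bool) \<Rightarrow> 'a \<Rightarrow> bool" where
  "simplicial_poset P le z \<longleftrightarrow> finite_poset P le \<and> is_min_elem P le z \<and>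
     (\<forall>p\<in>P. \<exists>r. boolean_of_rank P le z p r)"

(* f_i(P) for i \<ge> -1 : number of elements p whose interval [z,p] is Boolean of rank i+1.
   We index by the rank r = i+1, so  fvec P le z r = f_{r-1}(P). *)
definition fvec :: "'a set \<Rightarrow> ('a \<Rightarrow> 'a \<Rightarrow> bool) \<Rightarrow> 'a \<Rightarrow> nat \<Rightarrow> nat" where
  "fvec P le z r = card {p\<in>P. boolean_of_rank P le z p r}"

(* P has dimension d-1 *)
definition has_dim :: "'a set \<Rightarrow> ('a \<Rightarrow> 'a \<Rightarrow> bool) \<Rightarrow> 'a \<Rightarrow> nat \<Rightarrow> bool" where
  "has_dim P le z d \<longleftrightarrow> fvec P le z d \<noteq> 0 \<and> (\<forall>r>d. fvec P le z r = 0)"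

definition has_hvec :: "'a set \<Rightarrow> ('a \<Rightarrow> 'a \<Rightarrow> bool) \<Rightarrow> 'a \<Rightarrow> nat \<Rightarrow> (nat \<Rightarrow> nat) \<Rightarrow> bool" where
  "has_hvec P le z d h \<longleftrightarrow>
     (\<forall>x::real. (\<Sum>i\<le>d. real (h i) * x ^ i) =
                (\<Sum>i\<le>d. real (fvec P le z i) * x ^ i * (1 - x) ^ (d - i)))"

(* Geometric realization |Gamma(P)|: for the regular CW complex Gamma(P) with face poset P,
   |Gamma(P)| is homeomorphic to the order complex of the proper part P - {z};
   we realize that order complex in the function space 'a \<Rightarrow> real (product topology). *)
definition is_chain :: "('a \<Rightarrow> 'a \<Rightarrow> bool) \<Rightarrow> 'a set \<Rightarrow> bool" where
  "is_chain le C \<longleftrightarrow> (\<forall>x\<in>C. \<forall>y\<in>C. le x y \<or> le y x)"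

definition realization_set :: "'a set \<Rightarrow> ('a \<Rightarrow> 'a \<Rightarrow> bool) \<Rightarrow> 'a \<Rightarrow> ('a \<Rightarrow> real) set" where
  "realization_set P le z =
     {x. (\<forall>v. 0 \<le> x v) \<and> {v. x v \<noteq> 0} \<subseteq> P - {z} \<and>
         is_chain le {v. x v \<noteq> 0} \<and> (\<Sum>v\<in>P - {z}. x v) = 1}"

definition realization :: "'a set \<Rightarrow> ('a \<Rightarrow> 'a \<Rightarrow> bool) \<Rightarrow> 'a \<Rightarrow> ('a \<Rightarrow> real) topology" where
  "realization P le z = subtopology (powertop_real UNIV) (realization_set P le z)"

definition nball :: "nat \<Rightarrow> (nat \<Rightarrow> real) topology" where
  "nball m = subtopology (Euclidean_space m) {x. (\<Sum>i<m. x i ^ 2) \<le> 1}"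

definition hprime :: "(nat \<Rightarrow> nat) \<Rightarrow> nat \<Rightarrow> nat \<Rightarrow> int" where
  "hprime h k j = (if j = 0 then 1 else if j \<le> k then int (h j) - 1 else 0)"

definition dhprime :: "(nat \<Rightarrow> nat) \<Rightarrow> nat \<Rightarrow> nat \<Rightarrow> nat \<Rightarrow> int" where
  "dhprime h k d j = (\<Sum>i\<le>j. hprime h k i - hprime h k (d - i))"

end

theory Submission
  imports Defs
begin

text \<open>
  The ball is glued from simplices on the colours \<open>0, \<dots>, d - 1\<close>. Attaching a simplex along \<open>j\<close> of its
  facets adds \<open>1\<close> to \<open>h\<^sub>j\<close>; this is possible whenever the boundary sphere contains a spot: an embedded
  copy of \<open>\<tau> * \<partial>F\<close> that is the full star of \<open>\<tau>\<close>, where \<open>F\<close> is the complement of \<open>\<tau>\<close> and \<open>|F| \<ge> j\<close>. (Faces may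
  share vertex sets, so no face has to be missing.) The new simplex is a pinched cylinder over the
  attaching region, hence the result is again a ball.

  After a simplex of type \<open>j\<close> there is a spot with \<open>|F| = d - j\<close>, so a sequence of types in which
  consecutive ones add up to at most \<open>d\<close> is attainable. If all \<open>\<partial>h\<^sub>j\<close> are positive, such a sequence is
  obtained by placing the largest and the smallest type last and recursing on the others. This
  covers condition (a), and also condition (b) if \<open>k < d - 1\<close>.

  If \<open>k = d - 1\<close> and \<open>\<partial>h\<^sub>n = 0\<close>, start from the boundary of a \<open>d\<close>-simplex without one facet, which
  accounts for one simplex of each type \<open>0, \<dots>, d - 1\<close>, and fix a spot with \<open>|F| = d - n\<close>. Two successive
  simplices of types \<open>i\<close> and \<open>j\<close> with \<open>d - n \<le> i + j \<le> d\<close> can be attached such that the star of \<open>\<tau>\<close>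
  is replaced by an isomorphic one. The remaining types, except for one \<open>d - n\<close>, are matched
  smallest with largest; the inequalities of (b) say precisely that these pairs satisfy the
  condition. A last simplex of type \<open>d - n\<close> uses up the spot.
\<close>

section \<open>Attaching a pinched cylinder to a ball\<close>

text \<open>For \<open>k = d - 1\<close> and l < d the value \<open>dhprime h k d l\<close> is the
  number of types at most l, type 0 included, minus the number of types at least d - l. The
  hypotheses are therefore matching conditions: a type j may stand next to types up to d - j only,
  so large types have to be separated by small ones. If \<open>k < d - 1\<close>, then h_1 has been
  lowered by 1 while h_{d-1} has not; this surplus of one turns \<partial>h' \<ge> 0 into what a
  sequence requires.

  The obstacle is \<partial>h'_n = 0 with \<open>k = d - 1\<close>. There are then exactly as many
  types up to n as from d - n on. A sequence starting with type 0 would have to alternate between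
  the two kinds, with no place for a type strictly between n and d - n. Keeping one spot alive and
  attaching in pairs avoids this: the constraint then concerns only the two members of a pair.
  Parity enters because h' has sum 2 plus the number of paired types, the 2 standing for h'_0 and
  for the type d - n that comes last.\<close>

definition unit_ball :: "nat \<Rightarrow> (nat \<Rightarrow> real) set" where
  "unit_ball m = {x. (\<forall>i\<ge>m. x i = 0) \<and> L2_set x {..<m} \<le> 1}"

definition unit_sphere :: "nat \<Rightarrow> (nat \<Rightarrow> real) set" where
  "unit_sphere m = {x. (\<forall>i\<ge>m. x i = 0) \<and> L2_set x {..<m} = 1}"

text \<open>The boundary sphere is carried along because attachments take place on it. Compactness
  of \<open>B\<close> makes the continuous bijection a homeomorphism.\<close>

definition ball_pair :: "nat \<Rightarrow> ('a::t2_space) set \<Rightarrow> 'a set \<Rightarrow> bool" where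
  "ball_pair m B S \<longleftrightarrow> compact B \<and> S \<subseteq> B \<and>
     (\<exists>f. continuous_on B f \<and> inj_on f B \<and> f ` B = unit_ball m \<and> f ` S = unit_sphere m)"

lemma nball_eq: "nball m = top_of_set (unit_ball m)"
proof -
  have "L2_set x {..<m} \<le> 1 \<longleftrightarrow> (\<Sum>i<m. (x i)\<^sup>2) \<le> 1" for x :: "nat \<Rightarrow> real"
    by (simp add: L2_set_def)
  then show ?thesis
    by (simp add: nball_def Euclidean_space_def euclidean_product_topology subtopology_subtopology
        unit_ball_def Int_def)
qed

lemma ball_pair_homeomorphic:
  assumes "ball_pair m B S"
  shows "top_of_set B homeomorphic_space nball m"
proof -
  obtain f where f: "compact B" "continuous_on B f" "inj_on f B" "f ` B = unit_ball m"
    using assms by (auto simp: ball_pair_def)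
  have g: "continuous_on (unit_ball m) (inv_into B f)"
    using continuous_on_inv[OF f(2,1), of "inv_into B f"] f by simp
  have "homeomorphic_maps (top_of_set B) (top_of_set (unit_ball m)) f (inv_into B f)"
    unfolding homeomorphic_maps_def using f g
    by (auto simp: f_inv_into_f inv_into_into)
  then show ?thesis
    by (metis homeomorphic_maps_imp_homeomorphic_space nball_eq)
qed

section \<open>Radial maps in the function space\<close>

lemma continuous_on_coordinate: "continuous_on D (\<lambda>x. x i)"
  by (rule continuous_on_subset[OF continuous_on_product_coordinates]) simp

lemma continuous_on_L2_set: "continuous_on D (\<lambda>x::nat \<Rightarrow> real. L2_set x {..<m})"
  unfolding L2_set_def by (intro continuous_intros continuous_on_coordinate)

lemma L2_set_smult: "L2_set (\<lambda>i. c * x i) A = \<bar>c\<bar> * L2_set x A"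
  by (simp add: L2_set_def power_mult_distrib real_sqrt_mult flip: sum_distrib_left)

lemma L2_set_eq_0D: "L2_set x {..<m::nat} = 0 \<Longrightarrow> \<forall>i\<ge>m. x i = 0 \<Longrightarrow> x = (\<lambda>_. 0)"
  using L2_set_eq_0_iff[of "{..<m}" x] by (intro ext) (metis finite_lessThan lessThan_iff not_le)

text \<open>At the origin \<open>c\<close> may jump, but a bounded factor times a coordinate tends
  to 0 there. Both radial rescalings below, of the enlarged ball and of the simplex, have factors
  that depend on the direction and so need this.\<close>

lemma continuous_on_radial:
  fixes c :: "(nat \<Rightarrow> real) \<Rightarrow> real"
  assumes "continuous_on (D - {\<lambda>_. 0}) c" and "\<And>x. x \<in> D \<Longrightarrow> \<bar>c x\<bar> \<le> K"
  shows "continuous_on D (\<lambda>x i. c x * x i)"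
proof (rule continuous_on_coordinatewise_then_product)
  fix i
  show "continuous_on D (\<lambda>x. c x * x i)"
    unfolding continuous_on_eq_continuous_within
  proof
    fix x assume x: "x \<in> D"
    show "continuous (at x within D) (\<lambda>x. c x * x i)"
    proof (cases "x = (\<lambda>_. 0)")
      case True
      have "((\<lambda>y. K * \<bar>y i\<bar>) \<longlongrightarrow> K * \<bar>x i\<bar>) (at x within D)"
        using continuous_on_coordinate[of D i] x
        unfolding continuous_on_def by (intro tendsto_intros) blast
      then have *: "((\<lambda>y. K * \<bar>y i\<bar>) \<longlongrightarrow> 0) (at x within D)"
        by (simp add: True)
      have "((\<lambda>x. c x * x i) \<longlongrightarrow> 0) (at x within D)"
        by (rule Lim_null_comparison[OF _ *])
          (auto simp: eventually_at_filter abs_mult intro!: always_eventually mult_right_mono assms)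
      then show ?thesis by (simp add: continuous_within True)
    next
      case False
      have "continuous_on (D - {\<lambda>_. 0}) (\<lambda>x. c x * x i)"
        by (intro continuous_intros assms continuous_on_coordinate)
      then have "continuous (at x within (D - {\<lambda>_. 0})) (\<lambda>x. c x * x i)"
        using x False by (simp add: continuous_on_eq_continuous_within)
      moreover have "at x within (D - {\<lambda>_. 0}) = at x within D"
        using False by (intro at_within_nhd[of _ "- {\<lambda>_. 0}"]) auto
      ultimately show ?thesis by (simp add: continuous_within)
    qed
  qed
qed

text \<open>The added part \<^term>\<open>T\<close> is a pinched cylinder \<open>{(s,r). s \<in> A, 0 \<le> r \<le> \<phi> s}\<close>
  over a piece of the boundary sphere; \<open>B \<union> T\<close> is the star-shaped body over the sphere with radius
  \<open>1 + \<phi>\<close>, which is rescaled radially.\<close>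
lemma ball_pair_attach:
  fixes B T :: "('a::t2_space) set"
  assumes B: "ball_pair m B S" and T: "compact T" and BT: "B \<inter> T = A" and AS: "A \<subseteq> S"
    and a: "continuous_on T a" "\<And>p. p \<in> T \<Longrightarrow> a p \<in> A"
    and t: "continuous_on T t" "\<And>p. p \<in> T \<Longrightarrow> 0 \<le> t p \<and> t p \<le> \<phi> (a p)"
    and A: "\<And>p. p \<in> A \<Longrightarrow> a p = p \<and> t p = 0"
    and inj: "\<And>p q. p \<in> T \<Longrightarrow> q \<in> T \<Longrightarrow> a p = a q \<Longrightarrow> t p = t q \<Longrightarrow> p = q"
    and surj: "\<And>s r. s \<in> A \<Longrightarrow> 0 \<le> r \<Longrightarrow> r \<le> \<phi> s \<Longrightarrow> \<exists>p\<in>T. a p = s \<and> t p = r"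
    and phi: "continuous_on S \<phi>" "\<And>s. s \<in> S \<Longrightarrow> 0 \<le> \<phi> s" "\<And>s. s \<in> S - A \<Longrightarrow> \<phi> s = (0::real)"
  shows "ball_pair m (B \<union> T) ((S - A) \<union> {p\<in>T. t p = \<phi> (a p)})"
proof -
  obtain f where f: "compact B" "S \<subseteq> B" "continuous_on B f" "inj_on f B" "f ` B = unit_ball m"
      "f ` S = unit_sphere m"
    using B by (auto simp: ball_pair_def)
  define N where "N = (\<lambda>x::nat \<Rightarrow> real. L2_set x {..<m})"
  define g where "g = inv_into B f"
  have contN: "continuous_on D N" for D
    unfolding N_def by (rule continuous_on_L2_set)
  have gc: "continuous_on (unit_ball m) g"
    using continuous_on_inv[OF f(3,1), of g] f by (simp add: g_def)
  have gf: "g (f x) = x" if "x \<in> B" for x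
    using that f(4) by (simp add: g_def)
  have fg: "f (g y) = y" "g y \<in> B" if "y \<in> unit_ball m" for y
    using that f(5) by (auto simp: g_def f_inv_into_f inv_into_into)
  have sb: "unit_sphere m \<subseteq> unit_ball m"
    by (auto simp: unit_ball_def unit_sphere_def)
  have gS: "g y \<in> S" if "y \<in> unit_sphere m" for y
    by (metis that f(2,6) gf imageE subsetD)
  have fS: "f s \<in> unit_sphere m" if "s \<in> S" for s using f(6) that by blast
  have fB: "f s \<in> unit_ball m" if "s \<in> B" for s using f(5) that by blast
  define dir where "dir = (\<lambda>x::nat \<Rightarrow> real. \<lambda>i. x i / N x)"
  have N0: "N x > 0" if "x \<in> unit_ball m" "x \<noteq> (\<lambda>_. 0)" for x
    using that L2_set_eq_0D[of x m] L2_set_nonneg[of x "{..<m}"]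
    by (force simp: unit_ball_def N_def less_le)
  have N00: "N (\<lambda>_. 0) = 0" by (simp add: N_def L2_set_eq_0_iff)
  have Nnn: "N x \<ge> 0" for x by (simp add: N_def)
  have Nsm: "N (\<lambda>i. c * x i) = \<bar>c\<bar> * N x" for c x
    by (simp add: N_def L2_set_smult)
  have dirS: "dir x \<in> unit_sphere m" if "x \<in> unit_ball m" "x \<noteq> (\<lambda>_. 0)" for x
    using N0[OF that] that Nsm[of "1 / N x" x]
    by (auto simp: dir_def unit_sphere_def unit_ball_def N_def)
  have dirx: "x i = N x * dir x i" if "x \<in> unit_ball m" for x i
    using N0[OF that] by (cases "x = (\<lambda>_. 0)") (auto simp: dir_def N00)
  have dircont: "continuous_on (unit_ball m - {\<lambda>_. 0}) dir"
    unfolding dir_def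
    by (intro continuous_on_coordinatewise_then_product continuous_on_divide contN
        continuous_on_coordinate) (use N0 in force)
  have dirsm: "dir (\<lambda>i. c * x i) = dir x" if "c > 0" for c x
    using that Nsm[of c x] by (auto simp: dir_def)
  have dir1: "dir x = x" if "x \<in> unit_sphere m" for x
    using that by (auto simp: dir_def N_def unit_sphere_def)
  \<comment> \<open>The radial excess of the enlarged body in the direction of \<open>x\<close>. The
    origin has no direction; the value 0 is a convention, harmless because \<open>F\<close>
    multiplies by \<open>x\<close>.\<close>
  define \<rho> where "\<rho> = (\<lambda>x. if x = (\<lambda>_. 0) then 0 else \<phi> (g (dir x)))"
  have rho0: "\<rho> x \<ge> 0" if "x \<in> unit_ball m" for x
    using that by (auto simp: \<rho>_def intro!: phi gS dirS)
  have ccont: "continuous_on (unit_ball m - {\<lambda>_. 0}) (\<lambda>x. 1 / (1 + \<rho> x))"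
  proof -
    have "continuous_on (unit_ball m - {\<lambda>_. 0}) (\<lambda>x. \<phi> (g (dir x)))"
      by (intro continuous_on_compose2[OF phi(1)] continuous_on_compose2[OF gc] dircont)
        (use dirS gS sb in auto)
    then have "continuous_on (unit_ball m - {\<lambda>_. 0}) \<rho>"
      by (rule continuous_on_eq) (auto simp: \<rho>_def)
    then show ?thesis
      by (intro continuous_intros) (use rho0 in force)+
  qed
  define F where "F = (\<lambda>x i. (1 / (1 + \<rho> x)) * x i)"
  have "\<bar>1 / (1 + \<rho> x)\<bar> \<le> 1" if "x \<in> unit_ball m" for x
    using rho0[OF that] by simp
  then have Fcont: "continuous_on (unit_ball m) F"
    unfolding F_def by (rule continuous_on_radial[OF ccont, of 1])
  \<comment> \<open>Foot and height are extended to \<open>B\<close> by the identity and by 0. The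
    pieces are closed and agree on the overlap \<open>A\<close>, so the extensions are
    continuous.\<close>
  define a' where "a' = (\<lambda>p. if p \<in> B then p else a p)"
  define t' where "t' = (\<lambda>p. if p \<in> B then 0 else t p)"
  have cl: "closed B" "closed T"
    using f(1) T compact_imp_closed by auto
  have a'c: "continuous_on (B \<union> T) a'" unfolding a'_def
    by (rule continuous_on_cases) (use cl a A BT in auto)
  have t'c: "continuous_on (B \<union> T) t'" unfolding t'_def
    by (rule continuous_on_cases) (use cl t A BT in auto)
  have a'B: "a' p \<in> B" if "p \<in> B \<union> T" for p
    using that a AS f(2) by (auto simp: a'_def)
  have a'T: "a' p = a p" "t' p = t p" if "p \<in> T" for p
    using that A BT by (auto simp: a'_def t'_def)
  have t'0: "t' p \<ge> 0" if "p \<in> B \<union> T" for p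
    using that t by (auto simp: t'_def)
  define \<Psi> where "\<Psi> = (\<lambda>p i. (1 + t' p) * F (f (a' p)) i)"
  have "continuous_on (B \<union> T) (\<lambda>p. F (f (a' p)))"
    by (intro continuous_on_compose2[OF Fcont] continuous_on_compose2[OF f(3)] a'c)
      (use a'B fB in auto)
  then have Pc: "continuous_on (B \<union> T) \<Psi>"
    unfolding \<Psi>_def
    by (intro continuous_on_coordinatewise_then_product continuous_on_mult continuous_on_add
        continuous_on_const t'c) (auto dest: continuous_on_product_then_coordinatewise)
  \<comment> \<open>The radius of \<open>p\<close> in the star-shaped body: the norm on
    \<open>B\<close>, and \<open>1 + t p\<close> on \<open>T\<close>. The map \<open>\<Psi>\<close>
    keeps the direction and divides this radius by its maximum \<open>1 + \<rho>\<close>.\<close>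
  define R where "R = (\<lambda>p. (1 + t' p) * N (f (a' p)))"
  have Peq: "\<Psi> p = (\<lambda>i. (1 + t' p) / (1 + \<rho> (f (a' p))) * f (a' p) i)" for p
    by (auto simp: \<Psi>_def F_def)
  have pos: "(1 + t' p) / (1 + \<rho> (f (a' p))) > 0" if "p \<in> B \<union> T" for p
    using t'0[OF that] rho0[OF fB[OF a'B[OF that]]] by (simp add: divide_pos_pos)
  have PN: "N (\<Psi> p) = R p / (1 + \<rho> (f (a' p)))" if "p \<in> B \<union> T" for p
    unfolding Peq Nsm using abs_of_pos[OF pos[OF that]] by (simp add: R_def)
  have Pdir: "dir (\<Psi> p) = dir (f (a' p))" if "p \<in> B \<union> T" for p
    unfolding Peq using pos[OF that] by (rule dirsm)
  have P0: "\<Psi> p = (\<lambda>_. 0) \<longleftrightarrow> f (a' p) = (\<lambda>_. 0)" if "p \<in> B \<union> T" for p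
    unfolding Peq using pos[OF that] by (auto simp: fun_eq_iff)
  have Prho: "\<rho> (\<Psi> p) = \<rho> (f (a' p))" if "p \<in> B \<union> T" for p
    using P0[OF that] Pdir[OF that] by (simp add: \<rho>_def)
  have NT: "N (f (a' p)) = 1" "f (a' p) \<in> unit_sphere m" "\<rho> (f (a' p)) = \<phi> (a p)" if "p \<in> T" for p
  proof -
    show s: "f (a' p) \<in> unit_sphere m"
      using a'T[OF that] a[OF ] that AS fS by auto
    then show "N (f (a' p)) = 1" by (simp add: N_def unit_sphere_def)
    then have "f (a' p) \<noteq> (\<lambda>_. 0)" using N00 by auto
    then show "\<rho> (f (a' p)) = \<phi> (a p)"
      using s a'T[OF that] a(2)[OF that] AS f(2) by (simp add: \<rho>_def dir1 gf subset_iff)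
  qed
  have RT: "R p = 1 + t p" if "p \<in> T" for p
    using NT[OF that] a'T[OF that] by (simp add: R_def)
  have RB: "R p = N (f p)" "R p \<le> 1" if "p \<in> B" for p
    using that fB[OF that] by (auto simp: R_def a'_def t'_def N_def unit_ball_def)
  have Rrho: "R p \<le> 1 + \<rho> (f (a' p))" if "p \<in> B \<union> T" for p
    using that RB RT NT(3) t rho0[OF fB[OF a'B[OF that]]] by fastforce
  \<comment> \<open>A point of \<open>T\<close> with radius at most 1 has height 0 and therefore
    coincides with its foot in \<open>A\<close>.\<close>
  have inB: "p \<in> B" if "p \<in> B \<union> T" "R p \<le> 1" for p
  proof (rule ccontr)
    assume "p \<notin> B"
    then have pT: "p \<in> T" and "t p = 0" using that RT[of p] t(2)[of p] by auto
    then have "a p \<in> A" "a (a p) = a p" "t (a p) = t p" "a p \<in> T" using a A BT by auto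
    then have "p = a p" using inj pT by metis
    with \<open>a p \<in> A\<close> BT \<open>p \<notin> B\<close> show False by auto
  qed
  have injP: "p = q" if p: "p \<in> B \<union> T" "q \<in> B \<union> T" and eq: "\<Psi> p = \<Psi> q" for p q
  proof -
    have ra: "\<rho> (f (a' p)) = \<rho> (f (a' q))" using Prho p eq by metis
    have "1 + \<rho> (f (a' p)) > 0" using rho0[OF fB[OF a'B[OF p(1)]]] by linarith
    then have R: "R p = R q" using PN[OF p(1)] PN[OF p(2)] eq ra by auto
    have d: "dir (f (a' p)) = dir (f (a' q))" using Pdir p eq by metis
    show ?thesis
    proof (cases "R p \<le> 1")
      case True
      then have B: "p \<in> B" "q \<in> B" using inB[OF p(1)] inB[OF p(2)] R by auto
      then have "f p = f q"
        using dirx[OF fB[OF B(1)]] dirx[OF fB[OF B(2)]] R d RB(1)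
        by (auto simp: fun_eq_iff a'_def)
      then show ?thesis using f(4) B by (auto dest: inj_onD)
    next
      case False
      then have T': "p \<in> T" "q \<in> T" using RB(2) R p by force+
      then have "t p = t q" using R RT by simp
      moreover have "f (a p) = f (a q)"
        using d dir1 NT(2) T' a'T by metis
      then have "a p = a q" using f(4) a(2) T' AS f(2) by (auto dest!: inj_onD)
      ultimately show ?thesis using inj T' by blast
    qed
  qed
  have inball: "\<Psi> p \<in> unit_ball m" if "p \<in> B \<union> T" for p
  proof -
    have "N (\<Psi> p) \<le> 1" unfolding PN[OF that]
      using Rrho[OF that] rho0[OF fB[OF a'B[OF that]]] by simp
    moreover have "\<forall>i\<ge>m. \<Psi> p i = 0"
      using fB[OF a'B[OF that]] by (auto simp: Peq unit_ball_def)
    ultimately show ?thesis by (auto simp: unit_ball_def N_def)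
  qed
  have surP: "\<exists>p\<in>B \<union> T. \<Psi> p = y" if y: "y \<in> unit_ball m" for y
  proof (cases "y = (\<lambda>_. 0)")
    case True
    then show ?thesis using fg[OF y] P0[of "g y"] by (auto simp: a'_def)
  next
    case y0: False
    define s where "s = g (dir y)"
    have s: "s \<in> S" "f s = dir y" using gS dirS[OF y y0] fg sb by (auto simp: s_def)
    have Ny: "N y > 0" "N y \<le> 1" using N0[OF y y0] y by (auto simp: unit_ball_def N_def)
    \<comment> \<open>The radius that \<open>y\<close> has before rescaling. Up to 1 a preimage is
      found in \<open>B\<close>, beyond 1 in the cylinder above \<open>s\<close>.\<close>
    define r where "r = N y * (1 + \<phi> s)"
    have ps: "\<phi> s \<ge> 0" using phi(2) s by auto
    show ?thesis
    proof (cases "r \<le> 1")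
      case True
      define x where "x = (\<lambda>i. r * dir y i)"
      have rpos: "r > 0" using Ny ps by (simp add: r_def)
      have Nx: "N x = r" using dirS[OF y y0] rpos Nsm[of r "dir y"]
        by (simp add: x_def unit_sphere_def N_def)
      have xb: "x \<in> unit_ball m" using Nx True dirS[OF y y0]
        by (auto simp: unit_ball_def N_def x_def unit_sphere_def)
      have x0: "x \<noteq> (\<lambda>_. 0)" using Nx rpos N00 by auto
      have dx: "dir x = dir y" unfolding x_def using dirsm[OF rpos] dir1 dirS[OF y y0] by auto
      define p where "p = g x"
      have p: "p \<in> B" "f p = x" using fg xb by (auto simp: p_def)
      have "\<rho> (f (a' p)) = \<phi> s" using p x0 dx by (simp add: a'_def \<rho>_def s_def)
      then have "\<Psi> p = (\<lambda>i. 1 / (1 + \<phi> s) * x i)" unfolding Peq using p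
        by (simp add: a'_def t'_def)
      also have "\<dots> = y" using dirx[OF y] ps by (auto simp: fun_eq_iff x_def r_def)
      finally have "\<Psi> p = y" .
      then show ?thesis using p by blast
    next
      case False
      have sA: "s \<in> A"
      proof (rule ccontr)
        assume "s \<notin> A"
        then have "\<phi> s = 0" using phi(3) s by auto
        then show False using False Ny by (simp add: r_def)
      qed
      have "r \<le> 1 + \<phi> s"
        using mult_right_mono[OF Ny(2) add_nonneg_nonneg[OF zero_le_one ps]]
        unfolding r_def by (metis mult_1)
      then have "0 \<le> r - 1" "r - 1 \<le> \<phi> s" using False by auto
      then obtain p where p: "p \<in> T" "a p = s" "t p = r - 1" using surj[OF sA] by blast
      then have "\<Psi> p = (\<lambda>i. r / (1 + \<phi> s) * dir y i)"
        unfolding Peq using NT(3)[OF p(1)] a'T[OF p(1)] s by simp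
      also have "\<dots> = y" using dirx[OF y] ps by (auto simp: fun_eq_iff r_def)
      finally show ?thesis using p by blast
    qed
  qed
  have im: "\<Psi> ` (B \<union> T) = unit_ball m" using inball surP by blast
  let ?S = "(S - A) \<union> {p\<in>T. t p = \<phi> (a p)}"
  have sub: "?S \<subseteq> B \<union> T" using f(2) by auto
  have sph: "p \<in> ?S \<longleftrightarrow> \<Psi> p \<in> unit_sphere m" if p: "p \<in> B \<union> T" for p
  proof -
    have "\<Psi> p \<in> unit_sphere m \<longleftrightarrow> N (\<Psi> p) = 1"
      using inball[OF p] by (auto simp: unit_ball_def unit_sphere_def N_def)
    also have "\<dots> \<longleftrightarrow> R p = 1 + \<rho> (f (a' p))"
      unfolding PN[OF p] using rho0[OF fB[OF a'B[OF p]]] by (auto simp: field_simps)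
    finally have *: "\<Psi> p \<in> unit_sphere m \<longleftrightarrow> R p = 1 + \<rho> (f (a' p))" .
    show ?thesis
    proof (cases "p \<in> T")
      case True
      then have "p \<in> S - A \<longleftrightarrow> False" using BT f(2) by auto
      then show ?thesis unfolding * using True RT NT(3) by auto
    next
      case False
      then have pB: "p \<in> B" "p \<notin> A" using p BT by auto
      then have a'p: "a' p = p" by (simp add: a'_def)
      show ?thesis
      proof
        assume "p \<in> ?S"
        then have "p \<in> S - A" using False by auto
        then have "f p \<in> unit_sphere m" "\<phi> p = 0" using fS phi(3) by auto
        moreover have "f p \<noteq> (\<lambda>_. 0)" using calculation(1) N00 by (auto simp: unit_sphere_def N_def)
        ultimately show "\<Psi> p \<in> unit_sphere m" unfolding *
          using RB(1)[OF pB(1)] a'p gf[OF pB(1)]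
          by (simp add: \<rho>_def dir1) (simp add: N_def unit_sphere_def)
      next
        assume "\<Psi> p \<in> unit_sphere m"
        then have "N (f p) = 1 + \<rho> (f p)" using * RB(1)[OF pB(1)] a'p by simp
        then have "N (f p) = 1" using RB[OF pB(1)] rho0[OF fB[OF pB(1)]] by simp
        then have "f p \<in> unit_sphere m" using fB[OF pB(1)]
          by (auto simp: N_def unit_ball_def unit_sphere_def)
        then show "p \<in> ?S" using gS gf[OF pB(1)] pB by force
      qed
    qed
  qed
  have "\<Psi> ` ?S = unit_sphere m"
  proof
    show "\<Psi> ` ?S \<subseteq> unit_sphere m" using sph sub by blast
    show "unit_sphere m \<subseteq> \<Psi> ` ?S"
    proof
      fix y assume y: "y \<in> unit_sphere m"
      then obtain p where "p \<in> B \<union> T" "\<Psi> p = y" using surP sb by blast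
      then show "y \<in> \<Psi> ` ?S" using sph[of p] y by blast
    qed
  qed
  moreover have "inj_on \<Psi> (B \<union> T)" by (intro inj_onI injP)
  ultimately show ?thesis
    unfolding ball_pair_def using Pc im sub compact_Un[OF f(1) T] by blast
qed

section \<open>Barycentric coordinates\<close>

text \<open>Up to scaling, a point in the order complex of the nonempty faces of \<open>V\<close>.
  The function \<open>weight_at\<close> adds up the indicator functions of the faces with these
  weights.\<close>

definition chain_weight :: "'v set \<Rightarrow> ('v set \<Rightarrow> real) \<Rightarrow> bool" where
  "chain_weight V w \<longleftrightarrow> (\<forall>S. 0 \<le> w S) \<and> (\<forall>S. w S \<noteq> 0 \<longrightarrow> S \<subseteq> V \<and> S \<noteq> {}) \<and>
     (\<forall>S S'. w S \<noteq> 0 \<longrightarrow> w S' \<noteq> 0 \<longrightarrow> S \<subseteq> S' \<or> S' \<subseteq> S)"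

definition weight_at :: "'v set \<Rightarrow> ('v set \<Rightarrow> real) \<Rightarrow> 'v \<Rightarrow> real" where
  "weight_at V w v = (\<Sum>S\<in>Pow V. if v \<in> S then w S else 0)"

lemma weight_at_ge:
  assumes "finite V" "chain_weight V w" "v \<in> S" "S \<subseteq> V"
  shows "w S \<le> weight_at V w v"
proof -
  have "w S = (if v \<in> S then w S else 0)" using assms by simp
  also have "\<dots> \<le> weight_at V w v" unfolding weight_at_def
    by (rule member_le_sum) (use assms in \<open>auto simp: chain_weight_def\<close>)
  finally show ?thesis .
qed

lemma weight_at_nonneg: "chain_weight V w \<Longrightarrow> 0 \<le> weight_at V w v"
  unfolding weight_at_def chain_weight_def by (intro sum_nonneg) auto

lemma weight_at_support:
  assumes "finite V" "chain_weight V w"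
  shows "{v. weight_at V w v \<noteq> 0} = \<Union>{S. w S \<noteq> 0}"
proof (intro set_eqI iffI)
  fix v assume "v \<in> {v. weight_at V w v \<noteq> 0}"
  then have "\<exists>S\<in>Pow V. (if v \<in> S then w S else 0) \<noteq> 0"
    using sum.neutral[of "Pow V" "\<lambda>S. if v \<in> S then w S else 0"]
    unfolding weight_at_def by blast
  then show "v \<in> \<Union>{S. w S \<noteq> 0}" by (auto split: if_splits)
next
  fix v assume "v \<in> \<Union>{S. w S \<noteq> 0}"
  then obtain S where S: "w S \<noteq> 0" "v \<in> S" by auto
  then have "S \<subseteq> V" "0 < w S" using assms(2) by (auto simp: chain_weight_def less_le)
  then show "v \<in> {v. weight_at V w v \<noteq> 0}" using weight_at_ge[OF assms S(2)] by auto
qed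

text \<open>The chain has a largest member, and this is the support \<open>c\<close>. The other
  members also have a largest one, so some vertex of \<open>c\<close> lies in \<open>c\<close>
  alone; its coordinate is the weight of \<open>c\<close> and the least of all. Hence the top of the
  chain can be read off from the coordinates.\<close>

lemma chain_weight_max:
  assumes V: "finite V" and w: "chain_weight V w" and ne: "w S0 \<noteq> 0"
  defines "c \<equiv> {v. weight_at V w v \<noteq> 0}"
  shows "w c \<noteq> 0" and "Min (weight_at V w ` c) = w c"
proof -
  let ?B = "{S. w S \<noteq> 0}"
  have sub: "?B \<subseteq> Pow V" using w by (auto simp: chain_weight_def)
  then have fin: "finite ?B" using V finite_subset by blast
  have ch: "subset.chain UNIV A" if "A \<subseteq> ?B" for A
    unfolding subset_chain_def
  proof (intro conjI ballI)
    fix S S' assume "S \<in> A" "S' \<in> A"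
    then have "w S \<noteq> 0" "w S' \<noteq> 0" using that by auto
    then show "S \<subseteq> S' \<or> S' \<subseteq> S" using w unfolding chain_weight_def by blast
  qed simp
  have c: "c = \<Union>?B" unfolding c_def by (rule weight_at_support[OF V w])
  show wc: "w c \<noteq> 0"
    using Union_in_chain[OF fin _ ch] ne c by force
  then have cV: "c \<subseteq> V" "c \<noteq> {}" using w by (auto simp: chain_weight_def)
  have "\<exists>v\<in>c. v \<notin> \<Union>(?B - {c})"
  proof (cases "?B - {c} = {}")
    case True then show ?thesis using cV by auto
  next
    case False
    then have "\<Union>(?B - {c}) \<in> ?B - {c}"
      by (intro Union_in_chain[OF _ _ ch]) (use fin in auto)
    then show ?thesis using c by blast
  qed
  then obtain v where v: "v \<in> c" "v \<notin> \<Union>(?B - {c})" by blast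
  have "weight_at V w v = (\<Sum>S\<in>Pow V. if S = c then w S else 0)"
    unfolding weight_at_def using v by (intro sum.cong) auto
  also have "\<dots> = w c" using V cV by (simp add: sum.delta)
  finally have "weight_at V w v = w c" .
  moreover have "w c \<le> weight_at V w u" if "u \<in> c" for u
    using weight_at_ge[OF V w that cV(1)] .
  moreover have "weight_at V w v \<in> weight_at V w ` c" using v(1) by simp
  ultimately show "Min (weight_at V w ` c) = w c"
    using finite_subset[OF cV(1) V] by (intro Min_eqI) auto
qed

lemma chain_weight_zero: "chain_weight V w \<Longrightarrow> chain_weight V (w(c := 0))"
  by (auto simp: chain_weight_def)

lemma weight_at_upd:
  assumes "finite V" "c \<subseteq> V"
  shows "weight_at V (w(c := b)) v = weight_at V w v + (if v \<in> c then b - w c else 0)"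
proof -
  have "weight_at V (w(c := b)) v = (\<Sum>S\<in>Pow V. (if v \<in> S then w S else 0) +
      (if S = c then (if v \<in> c then b - w c else 0) else 0))"
    unfolding weight_at_def by (intro sum.cong) auto
  then show ?thesis using assms by (simp add: sum.distrib weight_at_def)
qed

text \<open>Peeling: by \<open>chain_weight_max\<close> the coordinates determine the top set and
  its weight. Deleting this weight makes a vertex with least coordinate drop out of the
  support.\<close>

lemma chain_weight_unique:
  assumes V: "finite V" and "chain_weight V w" "chain_weight V w'" "weight_at V w = weight_at V w'"
  shows "w = w'"
  using assms(2-)
proof (induction "card {v. weight_at V w v \<noteq> 0}" arbitrary: w w' rule: less_induct)
  case less
  let ?l = "weight_at V w"
  let ?c = "{v. ?l v \<noteq> 0}"
  show ?case
  proof (cases "?c = {}")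
    case True
    then have "\<Union>{S. w S \<noteq> 0} = {}" "\<Union>{S. w' S \<noteq> 0} = {}"
      using weight_at_support[OF V less.prems(1)] weight_at_support[OF V less.prems(2)]
        less.prems(3) by auto
    moreover have "w {} = 0" "w' {} = 0" using less.prems by (auto simp: chain_weight_def)
    ultimately have "w S = 0" "w' S = 0" for S by (cases "S = {}"; blast)+
    then show ?thesis by auto
  next
    case False
    then obtain S S' where S: "w S \<noteq> 0" and S': "w' S' \<noteq> 0"
      using weight_at_support[OF V less.prems(1)] weight_at_support[OF V less.prems(2)]
        less.prems(3) by fastforce
    note m = chain_weight_max[OF V less.prems(1) S]
    note m' = chain_weight_max[OF V less.prems(2) S', folded less.prems(3)]
    have cV: "?c \<subseteq> V" using m(1) less.prems(1) by (auto simp: chain_weight_def)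
    have wc: "w' ?c = w ?c" using m m' by simp
    let ?u = "w(?c := 0)" and ?u' = "w'(?c := 0)"
    have eq: "weight_at V ?u = weight_at V ?u'"
      using weight_at_upd[OF V cV] wc less.prems(3) by (intro ext) simp
    have fc: "finite ?c" using cV V finite_subset by blast
    have "Min (?l ` ?c) \<in> ?l ` ?c" using False fc by (intro Min_in) auto
    then obtain v where v: "v \<in> ?c" "?l v = w ?c" using m(2) by force
    have "{u. weight_at V ?u u \<noteq> 0} \<subseteq> ?c - {v}"
      using v weight_at_upd[OF V cV, of w 0] by auto
    then have "card {u. weight_at V ?u u \<noteq> 0} < card ?c"
      using fc v(1) by (intro psubset_card_mono) auto
    then have "?u = ?u'"
      using less.hyps[of ?u ?u'] chain_weight_zero less.prems eq by blast
    then have "w S = w' S" for S using wc by (cases "S = ?c") (auto simp: fun_eq_iff split: if_splits)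
    then show ?thesis by auto
  qed
qed

text \<open>Layer by layer: the support receives the least positive coordinate as its weight, and
  what remains has smaller support.\<close>

lemma chain_weight_exists:
  assumes V: "finite V" and "\<And>v. 0 \<le> l v" "\<And>v. v \<notin> V \<Longrightarrow> l v = 0"
  shows "\<exists>w. chain_weight V w \<and> weight_at V w = l"
  using assms(2-)
proof (induction "card {v. l v \<noteq> 0}" arbitrary: l rule: less_induct)
  case less
  let ?c = "{v. l v \<noteq> 0}"
  have cV: "?c \<subseteq> V" using less.prems by auto
  then have fc: "finite ?c" using V finite_subset by blast
  show ?case
  proof (cases "?c = {}")
    case True
    then have "chain_weight V (\<lambda>_. 0) \<and> weight_at V (\<lambda>_. 0) = l"
      by (auto simp: chain_weight_def weight_at_def fun_eq_iff)
    then show ?thesis by blast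
  next
    case False
    define m where "m = Min (l ` ?c)"
    have "m \<in> l ` ?c" unfolding m_def using False fc by (intro Min_in) auto
    then obtain v where v: "v \<in> ?c" "l v = m" by force
    have m0: "m > 0" using v less.prems(1)[of v] by auto
    have mle: "m \<le> l u" if "u \<in> ?c" for u
      unfolding m_def using that fc by (intro Min_le) auto
    define l' where "l' = (\<lambda>u. if u \<in> ?c then l u - m else l u)"
    have sub: "{u. l' u \<noteq> 0} \<subseteq> ?c - {v}" using v by (auto simp: l'_def)
    then have "card {u. l' u \<noteq> 0} < card ?c"
      using fc v(1) by (intro psubset_card_mono) auto
    moreover have "0 \<le> l' u" for u
      using mle[of u] less.prems(1)[of u] by (simp add: l'_def)
    moreover have "l' u = 0" if "u \<notin> V" for u using less.prems(2)[OF that] by (simp add: l'_def)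
    ultimately obtain w where w: "chain_weight V w" "weight_at V w = l'"
      using less.hyps by blast
    have sup: "\<Union>{S. w S \<noteq> 0} \<subseteq> ?c - {v}"
      using weight_at_support[OF V w(1)] w(2) sub by simp
    then have "w ?c = 0" using v(1) by blast
    have supp: "S \<subseteq> ?c \<and> (S = ?c \<or> w S \<noteq> 0)" if "(w(?c := m)) S \<noteq> 0" for S
      using that sup by (cases "S = ?c") auto
    have "chain_weight V (w(?c := m))"
      unfolding chain_weight_def
    proof (intro conjI allI impI)
      show "0 \<le> (w(?c := m)) S" for S using w(1) m0 by (simp add: chain_weight_def)
    next
      fix S assume "(w(?c := m)) S \<noteq> 0"
      from supp[OF this] show "S \<subseteq> V" "S \<noteq> {}"
        using cV False w(1) by (auto simp: chain_weight_def)
    next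
      fix S S' assume "(w(?c := m)) S \<noteq> 0" "(w(?c := m)) S' \<noteq> 0"
      from supp[OF this(1)] supp[OF this(2)] show "S \<subseteq> S' \<or> S' \<subseteq> S"
        using w(1) unfolding chain_weight_def by blast
    qed
    moreover have "weight_at V (w(?c := m)) = l"
      using weight_at_upd[OF V cV, of w m] w(2) \<open>w ?c = 0\<close> by (auto simp: fun_eq_iff l'_def)
    ultimately show ?thesis by blast
  qed
qed

section \<open>The order complex of a Boolean interval as a simplex\<close>

definition std_simplex :: "'v set \<Rightarrow> ('v \<Rightarrow> real) set" where
  "std_simplex V = {l. (\<forall>v. 0 \<le> l v) \<and> (\<forall>v. v \<notin> V \<longrightarrow> l v = 0) \<and> (\<Sum>v\<in>V. l v) = 1}"

lemma compact_realization_set: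
  fixes P :: "'a::countable set"
  assumes "finite P"
  shows "compact (realization_set P le z)"
proof -
  let ?K = "\<lambda>v. if v \<in> P - {z} then {0..1::real} else {0}"
  let ?D = "{x::'a \<Rightarrow> real. (\<Sum>v\<in>P - {z}. x v) = 1}"
  \<comment> \<open>The chain condition in closed form: of two incomparable elements at least one
    has coordinate 0.\<close>
  let ?E = "\<Inter>u. \<Inter>v. {x::'a \<Rightarrow> real. le u v \<or> le v u \<or> x u * x v = 0}"
  have "compactin (powertop_real UNIV) (PiE UNIV ?K)"
    by (subst compactin_PiE) auto
  then have cpt: "compact (PiE UNIV ?K)" by (simp add: euclidean_product_topology)
  have "closed {x::'a \<Rightarrow> real. x u * x v = 0}" for u v
    by (intro closed_Collect_eq continuous_intros continuous_on_coordinate)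
  then have "closed {x::'a \<Rightarrow> real. le u v \<or> le v u \<or> x u * x v = 0}" for u v
    by (cases "le u v \<or> le v u") auto
  then have "closed ?E" by (intro closed_INT ballI)
  moreover have "closed ?D"
    by (intro closed_Collect_eq continuous_intros continuous_on_coordinate)
  moreover have "realization_set P le z = PiE UNIV ?K \<inter> (?D \<inter> ?E)"
  proof (intro set_eqI iffI)
    fix x assume x: "x \<in> realization_set P le z"
    have "x v \<le> 1" for v
    proof (cases "v \<in> P - {z}")
      case True
      then have "x v \<le> (\<Sum>v\<in>P - {z}. x v)"
        using x assms by (intro member_le_sum) (auto simp: realization_set_def)
      then show ?thesis using x by (simp add: realization_set_def)
    next
      case False
      then have "x v = 0" using x by (auto simp: realization_set_def)
      then show ?thesis by simp
    qed
    then show "x \<in> PiE UNIV ?K \<inter> (?D \<inter> ?E)"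
      using x by (auto simp: realization_set_def is_chain_def)
  next
    fix x assume x: "x \<in> PiE UNIV ?K \<inter> (?D \<inter> ?E)"
    then have "x \<in> PiE UNIV ?K" by blast
    then have K: "x v \<in> ?K v" for v by (rule PiE_mem) simp
    have "0 \<le> x v \<and> (x v \<noteq> 0 \<longrightarrow> v \<in> P - {z})" for v
      using K[of v] by (cases "v \<in> P - {z}") auto
    then show "x \<in> realization_set P le z"
      using x by (auto simp: realization_set_def is_chain_def)
  qed
  ultimately show ?thesis using cpt by (auto intro: compact_Int_closed)
qed

lemma realization_eq: "realization P le z = top_of_set (realization_set P le z)"
  by (simp add: realization_def euclidean_product_topology)

text \<open>The affine map that sends the vertex \<open>t S\<close> of the order complex to the
  barycentre of the face \<open>S\<close>, in other words barycentric subdivision.\<close>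

definition barycentric :: "'v set \<Rightarrow> ('v set \<Rightarrow> 'a) \<Rightarrow> ('a \<Rightarrow> real) \<Rightarrow> 'v \<Rightarrow> real" where
  "barycentric V t x v = (\<Sum>S\<in>Pow V. if v \<in> S then x (t S) / card S else 0)"

abbreviation support :: "('v \<Rightarrow> real) \<Rightarrow> 'v set" where
  "support l \<equiv> {v. l v \<noteq> 0}"

text \<open>The order is constrained on the image of \<open>t\<close> only, so the locale applies to
  one simplex inside a larger poset as well as to a complex encoded in the natural numbers.\<close>

locale simplex_faces =
  fixes V :: "'v::countable set" and t :: "'v set \<Rightarrow> 'a::countable" and le :: "'a \<Rightarrow> 'a \<Rightarrow> bool"
  assumes finV: "finite V"
    and le_iff: "\<And>S S'. S \<subseteq> V \<Longrightarrow> S' \<subseteq> V \<Longrightarrow> le (t S) (t S') \<longleftrightarrow> S \<subseteq> S'"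
begin

abbreviation "cell \<equiv> realization_set (t ` Pow V) le (t {})"

definition wt :: "('a \<Rightarrow> real) \<Rightarrow> 'v set \<Rightarrow> real" where
  "wt x S = (if S \<subseteq> V \<and> S \<noteq> {} then x (t S) / card S else 0)"

lemma t_inj: "S \<subseteq> V \<Longrightarrow> S' \<subseteq> V \<Longrightarrow> t S = t S' \<longleftrightarrow> S = S'"
  using le_iff by (metis subset_antisym subset_refl)

lemma cell_sum: "(\<Sum>v\<in>t ` Pow V - {t {}}. x v) = (\<Sum>S\<in>Pow V - {{}}. x (t S))"
proof -
  have "t ` Pow V - {t {}} = t ` (Pow V - {{}})" using t_inj by auto
  moreover have "inj_on t (Pow V - {{}})" using t_inj by (auto simp: inj_on_def)
  ultimately show ?thesis by (simp add: sum.reindex)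
qed

lemma wt_barycentric: "weight_at V (wt x) = barycentric V t x"
  unfolding weight_at_def barycentric_def wt_def by (intro ext sum.cong) auto

lemma wt_nonzeroD: "wt x S \<noteq> 0 \<Longrightarrow> S \<subseteq> V \<and> S \<noteq> {} \<and> x (t S) \<noteq> 0"
  by (auto simp: wt_def split: if_splits)

lemma wt_chain:
  assumes "x \<in> cell"
  shows "chain_weight V (wt x)"
proof -
  have x: "0 \<le> x q" "x p \<noteq> 0 \<Longrightarrow> x q \<noteq> 0 \<Longrightarrow> le p q \<or> le q p" for p q
    using assms by (auto simp: realization_set_def is_chain_def)
  show ?thesis unfolding chain_weight_def
  proof (intro conjI allI impI)
    show "0 \<le> wt x S" for S using x by (simp add: wt_def)
    show "S \<subseteq> V" "S \<noteq> {}" if "wt x S \<noteq> 0" for S using wt_nonzeroD[OF that] by auto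
    show "S \<subseteq> S' \<or> S' \<subseteq> S" if "wt x S \<noteq> 0" "wt x S' \<noteq> 0" for S S'
      using wt_nonzeroD[OF that(1)] wt_nonzeroD[OF that(2)] x(2)[of "t S" "t S'"] le_iff by simp
  qed
qed

lemma sum_weight:
  fixes w :: "'v set \<Rightarrow> real"
  shows   "(\<Sum>v\<in>V. weight_at V w v) = (\<Sum>S\<in>Pow V - {{}}. card S * w S)"
proof -
  have "(\<Sum>v\<in>V. weight_at V w v) = (\<Sum>S\<in>Pow V. \<Sum>v\<in>V. if v \<in> S then w S else 0)"
    unfolding weight_at_def by (rule sum.swap)
  also have "\<dots> = (\<Sum>S\<in>Pow V. card S * w S)"
  proof (rule sum.cong)
    fix S assume "S \<in> Pow V"
    then show "(\<Sum>v\<in>V. if v \<in> S then w S else 0) = card S * w S"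
      using finV by (simp add: sum.If_cases Int_absorb1)
  qed simp
  also have "\<dots> = (\<Sum>S\<in>Pow V - {{}}. card S * w S)"
    using finV by (intro sum.mono_neutral_right) auto
  finally show ?thesis .
qed

lemma barycentric_in: "x \<in> cell \<Longrightarrow> barycentric V t x \<in> std_simplex V"
proof -
  assume x: "x \<in> cell"
  note c = wt_chain[OF x]
  have "barycentric V t x v = 0" if "v \<notin> V" for v
    unfolding barycentric_def using that by (intro sum.neutral) auto
  moreover have "(\<Sum>v\<in>V. barycentric V t x v) = (\<Sum>S\<in>Pow V - {{}}. x (t S))"
    unfolding wt_barycentric[symmetric] sum_weight wt_def
    using finV by (intro sum.cong) (auto simp: card_eq_0_iff finite_subset)
  moreover have "\<dots> = 1" using x cell_sum[of x] by (simp add: realization_set_def)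
  ultimately show ?thesis
    using weight_at_nonneg[OF c] by (simp add: std_simplex_def wt_barycentric)
qed

lemma barycentric_inj: "inj_on (barycentric V t) cell"
proof (rule inj_onI)
  fix x y assume x: "x \<in> cell" and y: "y \<in> cell" and eq: "barycentric V t x = barycentric V t y"
  then have "wt x = wt y"
    using chain_weight_unique[OF finV wt_chain[OF x] wt_chain[OF y]] by (simp add: wt_barycentric)
  then have *: "x (t S) = y (t S)" if "S \<subseteq> V" "S \<noteq> {}" for S
  proof -
    have "x (t S) / card S = y (t S) / card S"
      using fun_cong[OF \<open>wt x = wt y\<close>, of S] that unfolding wt_def by simp
    then show ?thesis using finite_subset[OF that(1) finV] that(2) by simp
  qed
  show "x = y"
  proof
    fix q
    show "x q = y q"
    proof (cases "q \<in> t ` (Pow V - {{}})")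
      case True then show ?thesis using * by auto
    next
      case False
      then have "q \<notin> t ` Pow V - {t {}}" by auto
      then have "x q = 0" "y q = 0" using x y by (auto simp: realization_set_def)
      then show ?thesis by simp
    qed
  qed
qed

lemma barycentric_surj:
  assumes l: "l \<in> std_simplex V"
  shows "\<exists>x\<in>cell. barycentric V t x = l"
proof -
  obtain w where w: "chain_weight V w" "weight_at V w = l"
    using chain_weight_exists[OF finV, of l] l by (auto simp: std_simplex_def)
  define x where "x = (\<lambda>q. if q \<in> t ` (Pow V - {{}})
    then card (the_inv_into (Pow V) t q) * w (the_inv_into (Pow V) t q) else 0)"
  have it: "inj_on t (Pow V)" using t_inj by (auto simp: inj_on_def)
  have xt: "x (t S) = card S * w S" if "S \<subseteq> V" "S \<noteq> {}" for S
    using that the_inv_into_f_f[OF it, of S] by (auto simp: x_def)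
  have x0: "x q = 0" if "q \<notin> t ` (Pow V - {{}})" for q using that by (simp add: x_def)
  have w0: "w {} = 0" using w(1) by (auto simp: chain_weight_def)
  have wx: "wt x = w"
    using w(1) finV unfolding wt_def
    by (intro ext) (auto simp: xt chain_weight_def card_eq_0_iff finite_subset)
  have "x \<in> cell" unfolding realization_set_def
  proof (intro CollectI conjI allI)
    show "0 \<le> x v" for v
      using w(1) by (simp add: x_def chain_weight_def)
    show "support x \<subseteq> t ` Pow V - {t {}}"
    proof
      fix q assume "q \<in> support x"
      then have "q \<in> t ` (Pow V - {{}})" using x0 by auto
      then show "q \<in> t ` Pow V - {t {}}" using t_inj by auto
    qed
    show "is_chain le (support x)" unfolding is_chain_def
    proof (intro ballI)
      fix p q assume "p \<in> support x" "q \<in> support x"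
      then have pq: "x p \<noteq> 0" "x q \<noteq> 0" by auto
      then have "p \<in> t ` (Pow V - {{}})" "q \<in> t ` (Pow V - {{}})" using x0 by blast+
      then obtain S S' where S: "p = t S" "q = t S'" "S \<subseteq> V" "S \<noteq> {}" "S' \<subseteq> V" "S' \<noteq> {}"
        by blast
      then have "w S \<noteq> 0" "w S' \<noteq> 0" using xt pq by auto
      then have "S \<subseteq> S' \<or> S' \<subseteq> S" using w(1) by (auto simp: chain_weight_def)
      then show "le p q \<or> le q p" using le_iff S by auto
    qed
    have "(\<Sum>v\<in>t ` Pow V - {t {}}. x v) = (\<Sum>S\<in>Pow V - {{}}. card S * w S)"
      unfolding cell_sum by (intro sum.cong) (auto simp: xt)
    also have "\<dots> = 1" using l w(2) sum_weight[of w] by (simp add: std_simplex_def)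
    finally show "(\<Sum>v\<in>t ` Pow V - {t {}}. x v) = 1" .
  qed
  moreover have "barycentric V t x = l" using wt_barycentric[of x] wx w(2) by simp
  ultimately show ?thesis by blast
qed

lemma barycentric_bij: "bij_betw (barycentric V t) cell (std_simplex V)"
  unfolding bij_betw_def using barycentric_inj barycentric_in barycentric_surj by blast

lemma barycentric_cont: "continuous_on D (barycentric V t)"
  unfolding barycentric_def
proof (intro continuous_on_coordinatewise_then_product continuous_on_sum)
  fix v S
  show "continuous_on D (\<lambda>x. if v \<in> S then x (t S) / real (card S) else 0)"
    by (cases "v \<in> S") (auto simp: divide_inverse intro!: continuous_intros continuous_on_coordinate)
qed

text \<open>The support of the coordinates is the top of the chain on which \<open>x\<close> lives,
  by \<open>chain_weight_max\<close>.\<close>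

lemma carrier:
  assumes x: "x \<in> cell"
  shows "x (t (support (barycentric V t x))) \<noteq> 0" "support (barycentric V t x) \<subseteq> V"
    "\<And>S. S \<subseteq> V \<Longrightarrow> S \<noteq> {} \<Longrightarrow> x (t S) \<noteq> 0 \<Longrightarrow> S \<subseteq> support (barycentric V t x)"
proof -
  note c = wt_chain[OF x]
  have *: "support (barycentric V t x) = \<Union>{S. wt x S \<noteq> 0}"
    using weight_at_support[OF finV c] by (simp add: wt_barycentric)
  have "(\<Sum>S\<in>Pow V - {{}}. x (t S)) = 1" using x cell_sum[of x] by (simp add: realization_set_def)
  then obtain S0 where "S0 \<in> Pow V - {{}}" "x (t S0) \<noteq> 0"
    by (metis (no_types, lifting) sum.neutral zero_neq_one)
  then have "wt x S0 \<noteq> 0" using finV by (auto simp: wt_def card_eq_0_iff finite_subset)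
  from chain_weight_max(1)[OF finV c this]
  have "wt x (support (barycentric V t x)) \<noteq> 0" by (simp only: wt_barycentric not_False_eq_True)
  from wt_nonzeroD[OF this] show "x (t (support (barycentric V t x))) \<noteq> 0" by blast
  show "support (barycentric V t x) \<subseteq> V"
    using barycentric_in[OF x] by (auto simp: std_simplex_def)
  show "S \<subseteq> support (barycentric V t x)" if "S \<subseteq> V" "S \<noteq> {}" "x (t S) \<noteq> 0" for S
  proof -
    have "wt x S \<noteq> 0" using that finV by (auto simp: wt_def card_eq_0_iff finite_subset)
    then show ?thesis using * by auto
  qed
qed

text \<open>For a family closed under subsets it suffices to test the largest face of the chain,
  which \<open>carrier\<close> identifies with the support.\<close>

lemma subcomplex_iff:
  assumes D: "D \<subseteq> Pow V" "{} \<in> D" "\<And>S S'. S \<in> D \<Longrightarrow> S' \<subseteq> S \<Longrightarrow> S' \<in> D"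
  shows "x \<in> realization_set (t ` D) le (t {}) \<longleftrightarrow>
    x \<in> cell \<and> support (barycentric V t x) \<in> D"
proof
  assume x: "x \<in> realization_set (t ` D) le (t {})"
  have "(\<Sum>v\<in>t ` Pow V - {t {}}. x v) = (\<Sum>v\<in>t ` D - {t {}}. x v)"
    using finV D x by (intro sum.mono_neutral_right) (auto simp: realization_set_def)
  moreover have "t ` D - {t {}} \<subseteq> t ` Pow V - {t {}}" using D(1) by blast
  moreover have "support x \<subseteq> t ` D - {t {}}" using x by (simp add: realization_set_def)
  ultimately have xc: "x \<in> cell" using x by (simp add: realization_set_def)
  then have "t (support (barycentric V t x)) \<in> t ` D"
    using carrier(1)[OF xc] x by (auto simp: realization_set_def)
  then obtain S where S: "S \<in> D" "t (support (barycentric V t x)) = t S" by blast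
  then have "S \<subseteq> V" using D(1) by blast
  then have "support (barycentric V t x) \<in> D" using t_inj carrier(2)[OF xc] S by simp
  with xc show "x \<in> cell \<and> support (barycentric V t x) \<in> D" by simp
next
  assume x: "x \<in> cell \<and> support (barycentric V t x) \<in> D"
  have sub: "support x \<subseteq> t ` D - {t {}}"
  proof
    fix q assume q: "q \<in> support x"
    then have "q \<in> t ` Pow V - {t {}}" using x by (auto simp: realization_set_def)
    then obtain S where S: "q = t S" "S \<subseteq> V" "S \<noteq> {}" by auto
    then have "S \<subseteq> support (barycentric V t x)" using carrier(3) x q by auto
    then have "S \<in> D" using D(3) x by auto
    then show "q \<in> t ` D - {t {}}" using S t_inj by auto
  qed
  have "(\<Sum>v\<in>t ` Pow V - {t {}}. x v) = (\<Sum>v\<in>t ` D - {t {}}. x v)"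
    using finV D(1) sub by (intro sum.mono_neutral_right) auto
  then show "x \<in> realization_set (t ` D) le (t {})"
    using x sub by (auto simp: realization_set_def)
qed

lemma compact_cell: "compact cell"
  using finV by (intro compact_realization_set) auto

definition point :: "('v \<Rightarrow> real) \<Rightarrow> 'a \<Rightarrow> real" where
  "point = inv_into cell (barycentric V t)"

lemma point_bary: "x \<in> cell \<Longrightarrow> point (barycentric V t x) = x"
  using barycentric_inj by (simp add: point_def)

lemma bary_point: "l \<in> std_simplex V \<Longrightarrow> barycentric V t (point l) = l"
  "l \<in> std_simplex V \<Longrightarrow> point l \<in> cell"
  using barycentric_surj[of l] point_bary by auto

lemma continuous_on_point: "continuous_on (std_simplex V) point"
  using continuous_on_inv[OF barycentric_cont compact_cell, of point] point_bary barycentric_bij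
  by (simp add: bij_betw_def)

end

section \<open>The simplex as a ball\<close>

lemma ball_pair_transport:
  assumes "ball_pair m B S" "compact B'" "S' \<subseteq> B'" "continuous_on B' h" "bij_betw h B' B" "h ` S' = S"
  shows "ball_pair m B' S'"
proof -
  obtain f where f: "continuous_on B f" "inj_on f B" "f ` B = unit_ball m" "f ` S = unit_sphere m"
    using assms(1) by (auto simp: ball_pair_def)
  have h: "h ` B' = B" "inj_on h B'" using assms(5) by (auto simp: bij_betw_def)
  have "continuous_on B' (f \<circ> h)" using assms(4) f(1) h by (intro continuous_on_compose) auto
  moreover have "inj_on (f \<circ> h) B'" using f(2) h by (intro comp_inj_on) auto
  moreover have "(f \<circ> h) ` B' = unit_ball m" "(f \<circ> h) ` S' = unit_sphere m"
    using f h assms(6) by (metis image_comp)+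
  ultimately show ?thesis using assms(2,3) unfolding ball_pair_def by blast
qed

section \<open>Least coordinates\<close>

lemma continuous_on_Min_coordinates:
  fixes D :: "('a \<Rightarrow> real) set"
  assumes "finite X" "X \<noteq> {}"
  shows "continuous_on D (\<lambda>x. Min (x ` X))"
  using assms
proof (induction rule: finite_ne_induct)
  case (singleton v) then show ?case by (simp add: continuous_on_coordinate)
next
  case (insert v F)
  have "continuous_on D (\<lambda>x. min (x v) (Min (x ` F)))"
    by (intro continuous_on_min continuous_on_coordinate insert.IH)
  moreover have "Min (x ` insert v F) = min (x v) (Min (x ` F))" for x :: "'a \<Rightarrow> real"
    using insert.hyps by simp
  ultimately show ?case by (simp only:)
qed

lemma Min_image_add:
  fixes l :: "'a \<Rightarrow> real"
  assumes "finite X" "X \<noteq> {}" "\<And>v. v \<in> X \<Longrightarrow> l' v = l v + b"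
  shows "Min (l' ` X) = Min (l ` X) + b"
proof -
  have "l' ` X = (\<lambda>v. l v + b) ` X" using assms(3) by auto
  then show ?thesis using Min_add_commute[OF assms(1,2), of l b] by simp
qed

lemma Min_image_scale:
  fixes l :: "'a \<Rightarrow> real"
  assumes "finite X" "X \<noteq> {}" "0 \<le> c"
  shows "Min ((\<lambda>v. c * l v) ` X) = c * Min (l ` X)"
proof -
  have "mono (\<lambda>x. c * x)" using assms(3) by (auto simp: mono_def mult_left_mono)
  from mono_Min_commute[OF this, of "l ` X"] show ?thesis
    using assms by (simp add: image_image)
qed

lemma Min_image_eq_0_iff:
  fixes l :: "'a \<Rightarrow> real"
  assumes "finite X" "X \<noteq> {}" "\<And>v. v \<in> X \<Longrightarrow> 0 \<le> l v"
  shows "Min (l ` X) = 0 \<longleftrightarrow> (\<exists>v\<in>X. l v = 0)"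
  using assms by (subst Min_eq_iff) auto

lemma Min_image_mem:
  fixes l :: "'a \<Rightarrow> real"
  assumes "finite X" "X \<noteq> {}"
  shows "\<exists>v\<in>X. l v = Min (l ` X)"
  using Min_in[of "l ` X"] assms by fastforce

definition face_bdry :: "'v set \<Rightarrow> ('v \<Rightarrow> real) set" where
  "face_bdry V = {l \<in> std_simplex V. \<exists>v\<in>V. l v = 0}"

text \<open>Compactness is inherited from a realization of the face lattice, via the barycentric
  map.\<close>

lemma compact_std_simplex: "finite V \<Longrightarrow> compact (std_simplex (V::nat set))"
proof -
  assume V: "finite V"
  interpret simplex_faces V set_encode "\<lambda>p q. set_decode p \<subseteq> set_decode q"
    using V by unfold_locales (auto simp: finite_subset set_encode_inverse)
  show ?thesis
    using compact_continuous_image[OF barycentric_cont compact_cell] barycentric_bij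
    by (simp add: bij_betw_def)
qed

text \<open>The simplex, centred at its barycentre and projected to its first \<open>d - 1\<close> coordinates, is a
  convex body with gauge \<open>g y = - d * (least coordinate of the sum-zero vector extending y)\<close>.\<close>
lemma std_simplex_ball:
  assumes d: "d \<ge> 1"
  shows "ball_pair (d - 1) (std_simplex {..<d}) (face_bdry {..<d})"
proof -
  define m where "m = d - 1"
  have dm: "{..<d} = insert m {..<m}" "d = Suc m" using d by (auto simp: m_def)
  have ne: "finite {..<d}" "{..<d} \<noteq> {}" using d by (auto simp: lessThan_empty_iff)
  define N where "N = (\<lambda>x::nat \<Rightarrow> real. L2_set x {..<m})"
  define ex where "ex = (\<lambda>(y::nat \<Rightarrow> real) i. if i < m then y i else - (\<Sum>j<m. y j))"
  \<comment> \<open>The factor \<open>d\<close> makes the gauge 1 on the boundary: there the least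
    coordinate is 0, hence \<open>- (1 / d)\<close> after centring.\<close>
  define g where "g = (\<lambda>y. - (d * Min (ex y ` {..<d})))"
  define dv where "dv = (\<lambda>(l::nat \<Rightarrow> real) i. if i < m then l i - 1 / d else 0)"
  define c where "c = (\<lambda>y. g y / N y)"
  have dvE: "\<forall>i\<ge>m. dv l i = 0" for l by (simp add: dv_def)
  have exsm: "ex (\<lambda>i. s * y i) = (\<lambda>i. s * ex y i)" for s y
    by (auto simp: ex_def sum_distrib_left)
  have gsm: "g (\<lambda>i. s * y i) = s * g y" if "s \<ge> 0" for s y
    using Min_image_scale[OF ne that, of "ex y"] by (simp add: g_def exsm)
  have Nsm: "N (\<lambda>i. s * y i) = \<bar>s\<bar> * N y" for s y by (simp add: N_def L2_set_smult)
  have N0: "N (\<lambda>_. 0) = 0" using Nsm[of 0 "\<lambda>_. 0"] by simp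
  have Nnn: "N y \<ge> 0" for y by (simp add: N_def)
  have Npos: "N y > 0" if "\<forall>i\<ge>m. y i = 0" "y \<noteq> (\<lambda>_. 0)" for y
    using L2_set_eq_0D[of y m] that Nnn[of y] by (auto simp: N_def less_le)
  have exsum: "(\<Sum>i<d. ex y i) = 0" for y by (simp add: dm ex_def)
  \<comment> \<open>A vector with sum 0 and no negative coordinate vanishes.\<close>
  have gpos: "g y > 0" if y: "\<forall>i\<ge>m. y i = 0" "y \<noteq> (\<lambda>_. 0)" for y
  proof (rule ccontr)
    assume "\<not> g y > 0"
    moreover have "0 \<le> M" if "\<not> - (real d * M) > 0" for M
      using that d by (auto simp: mult_less_0_iff)
    ultimately have "Min (ex y ` {..<d}) \<ge> 0" unfolding g_def by blast
    then have "ex y i \<ge> 0" if "i < d" for i using that ne by (simp add: Min_ge_iff)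
    then have "ex y i = 0" if "i < d" for i
      using exsum[of y] that sum_nonneg_eq_0_iff[of "{..<d}" "ex y"] by auto
    then have "y i = 0" if "i < m" for i using that dm(2) by (metis ex_def less_SucI)
    then show False using y by (metis not_le)
  qed
  have g0: "g (\<lambda>_. 0) = 0" using gsm[of 0 "\<lambda>_. 0"] by simp
  \<comment> \<open>Comparing the gauge with the norm bounds the factor \<open>c\<close>, as
    \<open>continuous_on_radial\<close> demands.\<close>
  have gbd: "\<bar>g y\<bar> \<le> d * (1 + m) * N y" for y
  proof -
    obtain i where i: "i < d" "ex y i = Min (ex y ` {..<d})" using Min_image_mem[OF ne] by blast
    have y: "\<bar>y j\<bar> \<le> N y" if "j < m" for j
      using member_le_L2_set[of "{..<m}" j "\<lambda>j. \<bar>y j\<bar>"] that by (simp add: N_def L2_set_def)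
    then have "(\<Sum>j<m. \<bar>y j\<bar>) \<le> m * N y" using sum_bounded_above[of "{..<m}" "\<lambda>j. \<bar>y j\<bar>"] by simp
    then have "\<bar>\<Sum>j<m. y j\<bar> \<le> m * N y" using sum_abs[of y "{..<m}"] by linarith
    then have "\<bar>ex y i\<bar> \<le> (1 + m) * N y"
      using y[of i] Nnn[of y] mult_nonneg_nonneg[of "real m" "N y"]
      by (auto simp: ex_def algebra_simps)
    then have "d * \<bar>ex y i\<bar> \<le> d * ((1 + m) * N y)" by (intro mult_left_mono) auto
    moreover have "\<bar>g y\<bar> = d * \<bar>ex y i\<bar>" unfolding g_def i(2) by (simp add: abs_mult)
    ultimately show ?thesis by (simp only: mult.assoc of_nat_mult of_nat_add of_nat_1)
  qed
  have contex: "continuous_on D (\<lambda>y. ex y i)" for D i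
    by (cases "i < m") (auto simp: ex_def intro!: continuous_intros continuous_on_coordinate)
  have contg: "continuous_on D g" for D
  proof -
    have "continuous_on D ex" by (intro continuous_on_coordinatewise_then_product contex)
    then have "continuous_on D (\<lambda>y. Min (ex y ` {..<d}))"
      using continuous_on_compose2[OF continuous_on_Min_coordinates[OF ne, of UNIV], of D ex] by simp
    then show ?thesis unfolding g_def by (intro continuous_intros)
  qed
  define E where "E = {y::nat \<Rightarrow> real. \<forall>i\<ge>m. y i = 0}"
  have "L2_set y {..<m} \<noteq> 0" if "y \<in> E - {\<lambda>_. 0}" for y
    using Npos[of y] that by (simp add: N_def E_def)
  then have "continuous_on (E - {\<lambda>_. 0}) c"
    unfolding c_def N_def by (intro continuous_on_divide contg continuous_on_L2_set ballI)
  moreover have "\<bar>c y\<bar> \<le> d * (1 + m)" for y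
  proof (cases "N y = 0")
    case False
    then have "N y > 0" using Nnn[of y] by linarith
    then show ?thesis using gbd[of y] by (simp add: c_def abs_divide divide_le_eq)
  qed (simp add: c_def)
  ultimately have contF: "continuous_on E (\<lambda>y i. c y * y i)"
    by (intro continuous_on_radial) auto
  define \<Psi> where "\<Psi> = (\<lambda>l i. c (dv l) * dv l i)"
  have "continuous_on (std_simplex {..<d}) dv"
    unfolding dv_def
  proof (rule continuous_on_coordinatewise_then_product)
    fix i show "continuous_on (std_simplex {..<d}) (\<lambda>l. if i < m then l i - 1 / real d else 0)"
      by (cases "i < m") (auto intro!: continuous_intros continuous_on_coordinate)
  qed
  then have cont: "continuous_on (std_simplex {..<d}) \<Psi>"
    using continuous_on_compose2[OF contF, of "std_simplex {..<d}" dv] dvE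
    by (auto simp: \<Psi>_def E_def)
  have NPsi: "N (\<Psi> l) = g (dv l)" for l
  proof (cases "dv l = (\<lambda>_. 0)")
    case True then show ?thesis by (simp add: \<Psi>_def g0 N0)
  next
    case False
    then have "N (dv l) > 0" "g (dv l) > 0" using Npos gpos dvE by auto
    then show ?thesis unfolding \<Psi>_def Nsm by (simp add: c_def)
  qed
  have exdv: "ex (dv l) i = l i - 1 / d" if "l \<in> std_simplex {..<d}" "i < d" for l i
  proof -
    have "(\<Sum>j<m. l j) + l m = 1" using that(1) by (simp add: std_simplex_def dm add.commute)
    moreover have "(\<Sum>j<m. dv l j) = (\<Sum>j<m. l j) - m / d" by (simp add: dv_def sum_subtractf)
    moreover have "1 - m / d = 1 / d" by (simp add: dm(2) field_simps)
    ultimately show ?thesis using that(2) dm(2) by (auto simp: ex_def dv_def less_Suc_eq)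
  qed
  have gdv: "g (dv l) = 1 - d * Min (l ` {..<d})" if "l \<in> std_simplex {..<d}" for l :: "nat \<Rightarrow> real"
  proof -
    have "Min (ex (dv l) ` {..<d}) = Min (l ` {..<d}) + - (1 / d)"
      by (rule Min_image_add[OF ne]) (use exdv[OF that] in auto)
    then show ?thesis using d unfolding g_def by (simp add: right_diff_distrib)
  qed
  have Mnn: "Min (l ` {..<d}) \<ge> 0" if "l \<in> std_simplex {..<d}" for l
    using that ne by (auto simp: std_simplex_def Min_ge_iff)
  have dvinj: "l = l'" if "l \<in> std_simplex {..<d}" "l' \<in> std_simplex {..<d}" "dv l = dv l'" for l l'
  proof
    fix i
    show "l i = l' i"
      using exdv[of l i] exdv[of l' i] that by (cases "i < d") (auto simp: std_simplex_def)
  qed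
  have inj: "l = l'" if l: "l \<in> std_simplex {..<d}" "l' \<in> std_simplex {..<d}" "\<Psi> l = \<Psi> l'" for l l'
  proof -
    have geq: "g (dv l) = g (dv l')" using NPsi l(3) by metis
    show ?thesis
    proof (cases "dv l = (\<lambda>_. 0)")
      case True
      then have "dv l' = (\<lambda>_. 0)" using geq g0 gpos dvE by (metis less_irrefl)
      then show ?thesis using True dvinj l by simp
    next
      case False
      then have "dv l' \<noteq> (\<lambda>_. 0)" using geq g0 gpos dvE by (metis less_irrefl)
      then have p: "c (dv l) > 0" "c (dv l') > 0" "g (dv l') > 0"
        using False gpos Npos dvE by (simp_all add: c_def)
      \<comment> \<open>The centred vectors are positive multiples of each other; having the same
        gauge they are equal.\<close>
      define s where "s = c (dv l') / c (dv l)"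
      have "dv l = (\<lambda>i. s * dv l' i)"
        using fun_cong[OF l(3)] p by (auto simp: \<Psi>_def s_def fun_eq_iff field_simps)
      moreover have "s > 0" using p by (simp add: s_def)
      ultimately have "s = 1" "dv l = (\<lambda>i. s * dv l' i)" using gsm[of s "dv l'"] geq p by auto
      then show ?thesis using dvinj l by simp
    qed
  qed
  have sur: "\<exists>l\<in>std_simplex {..<d}. \<Psi> l = u" if u: "u \<in> unit_ball m" for u
  proof (cases "u = (\<lambda>_. 0)")
    case True
    define l where "l = (\<lambda>i. if i < d then 1 / real d else 0)"
    have "l \<in> std_simplex {..<d}" using d by (simp add: l_def std_simplex_def)
    moreover have "dv l = (\<lambda>_. 0)" using dm(2) by (auto simp: dv_def l_def)
    then have "\<Psi> l = u" by (simp add: \<Psi>_def True)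
    ultimately show ?thesis by blast
  next
    case False
    have uE: "\<forall>i\<ge>m. u i = 0" "N u \<le> 1" using u by (auto simp: unit_ball_def N_def)
    have p: "N u > 0" "g u > 0" using Npos gpos uE False by auto
    \<comment> \<open>Chosen so that \<open>s * u\<close> has gauge \<open>N u\<close>, since
      \<open>\<Psi>\<close> turns gauge into norm.\<close>
    define s where "s = N u / g u"
    have s: "s > 0" using p by (simp add: s_def)
    define l where "l = (\<lambda>i. if i < d then 1 / d + s * ex u i else 0)"
    have "l i \<ge> 0" for i
    proof (cases "i < d")
      case True
      then have "Min (ex u ` {..<d}) \<le> ex u i" by simp
      then have "s * Min (ex u ` {..<d}) \<le> s * ex u i" using s by simp
      moreover have "b / - (real d * M) * M = - (b / d)" if "- (real d * M) > 0" for b M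
        using that d by (auto simp: field_simps)
      then have "s * Min (ex u ` {..<d}) = - (N u / d)"
        using p(2) unfolding s_def g_def by blast
      moreover have "N u / d \<le> 1 / d" using uE(2) by (simp add: divide_right_mono)
      ultimately show ?thesis using True by (simp add: l_def)
    qed (simp add: l_def)
    moreover have "(\<Sum>i<d. l i) = 1"
      using d exsum[of u] by (simp add: l_def sum.distrib flip: sum_distrib_left)
    ultimately have l: "l \<in> std_simplex {..<d}" by (simp add: std_simplex_def l_def)
    have dvl: "dv l = (\<lambda>i. s * u i)" using uE(1) dm(2) by (auto simp: dv_def l_def ex_def fun_eq_iff)
    have "c (dv l) * s = 1" unfolding dvl c_def using gsm[of s u] Nsm[of s u] s p by (simp add: s_def)
    then have "\<Psi> l = u" unfolding \<Psi>_def dvl by (simp add: fun_eq_iff flip: mult.assoc)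
    then show ?thesis using l by blast
  qed
  have in_ball: "\<Psi> l \<in> unit_ball m" if "l \<in> std_simplex {..<d}" for l
    using NPsi[of l] gdv[OF that] Mnn[OF that] dvE[of l]
    by (simp add: unit_ball_def N_def \<Psi>_def)
  have sph: "\<Psi> l \<in> unit_sphere m \<longleftrightarrow> l \<in> face_bdry {..<d}" if "l \<in> std_simplex {..<d}" for l
  proof -
    have "\<Psi> l \<in> unit_sphere m \<longleftrightarrow> Min (l ` {..<d}) = 0"
      using NPsi[of l] gdv[OF that] dvE[of l] d by (simp add: unit_sphere_def N_def \<Psi>_def)
    also have "\<dots> \<longleftrightarrow> l \<in> face_bdry {..<d}"
      using Min_image_eq_0_iff[OF ne, of l] that by (auto simp: face_bdry_def std_simplex_def)
    finally show ?thesis .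
  qed
  have im: "\<Psi> ` std_simplex {..<d} = unit_ball m" using in_ball sur by blast
  have fb: "face_bdry {..<d} \<subseteq> std_simplex {..<d}" by (auto simp: face_bdry_def)
  have sb: "unit_sphere m \<subseteq> unit_ball m" by (auto simp: unit_ball_def unit_sphere_def)
  have "\<Psi> ` face_bdry {..<d} = unit_sphere m"
  proof
    show "\<Psi> ` face_bdry {..<d} \<subseteq> unit_sphere m"
    proof
      fix y assume "y \<in> \<Psi> ` face_bdry {..<d}"
      then obtain l where l: "l \<in> face_bdry {..<d}" "y = \<Psi> l" by blast
      then show "y \<in> unit_sphere m" using sph[of l] fb by blast
    qed
    show "unit_sphere m \<subseteq> \<Psi> ` face_bdry {..<d}"
    proof
      fix y assume y: "y \<in> unit_sphere m"
      then obtain l where "l \<in> std_simplex {..<d}" "\<Psi> l = y" using sur sb by blast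
      then show "y \<in> \<Psi> ` face_bdry {..<d}" using sph[of l] y by blast
    qed
  qed
  moreover have "inj_on \<Psi> (std_simplex {..<d})" by (rule inj_onI) (rule inj)
  ultimately show ?thesis
    using compact_std_simplex[of "{..<d}"] cont im fb unfolding ball_pair_def m_def[symmetric]
    by blast
qed

section \<open>A simplex as a pinched cylinder\<close>

definition part_zero :: "'v set \<Rightarrow> 'v set \<Rightarrow> ('v \<Rightarrow> real) set" where
  "part_zero V X = {l \<in> std_simplex V. Min (l ` X) = 0}"

text \<open>The simplex is fibred over the part \<partial>X * (V - X) of its boundary, which is
  \<open>part_zero V X\<close>. The map \<open>flat\<close> moves mass evenly from \<open>X\<close>
  to \<open>V - X\<close> until a coordinate in \<open>X\<close> vanishes, \<open>depth\<close> is
  the amount taken from each vertex of \<open>X\<close>, and \<open>height\<close> is the largest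
  amount that can still be moved the other way. Fibres over points of height 0 degenerate to
  points.\<close>

locale pinch =
  fixes V X :: "'v set"
  assumes fin: "finite V" and XV: "X \<subseteq> V" "X \<noteq> {}" "X \<noteq> V"
begin

definition depth :: "('v \<Rightarrow> real) \<Rightarrow> real" where "depth l = Min (l ` X)"

definition flat :: "('v \<Rightarrow> real) \<Rightarrow> 'v \<Rightarrow> real" where
  "flat l v = (if v \<in> X then l v - depth l
     else if v \<in> V then l v + depth l * card X / card (V - X) else 0)"

text \<open>Giving \<open>r\<close> to each vertex of \<open>X\<close> costs each other vertex
  \<open>r * card X / card (V - X)\<close>; the quotient in front of the minimum is the inverse
  rate.\<close>

definition height :: "('v \<Rightarrow> real) \<Rightarrow> real" where
  "height l = card (V - X) / card X * Min (l ` (V - X))"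

lemma finX: "finite X" "finite (V - X)" "V - X \<noteq> {}" "real (card X) > 0" "real (card (V - X)) > 0"
proof -
  show f: "finite X" "finite (V - X)" using fin XV finite_subset by auto
  show "V - X \<noteq> {}" using XV by blast
  then show "real (card X) > 0" "real (card (V - X)) > 0"
    using XV f by (simp_all only: of_nat_0_less_iff card_gt_0_iff not_False_eq_True simp_thms)
qed

lemma split_sum: "(\<Sum>v\<in>V. f v) = (\<Sum>v\<in>X. f v) + (\<Sum>v\<in>V - X. f v :: real)"
  using sum.subset_diff[OF XV(1) fin, of f] by (simp add: add.commute)

lemma depth_nonneg: "l \<in> std_simplex V \<Longrightarrow> 0 \<le> depth l"
  using finX XV by (auto simp: depth_def std_simplex_def Min_ge_iff)

lemma depth_le: "v \<in> X \<Longrightarrow> depth l \<le> l v"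
  using finX by (simp add: depth_def)

lemma flat_simplex:
  assumes l: "l \<in> std_simplex V"
  shows "flat l \<in> part_zero V X"
proof -
  have "0 \<le> flat l v" for v
    using l depth_nonneg[OF l] depth_le[of v l] by (auto simp: flat_def std_simplex_def)
  moreover have "flat l v = 0" if "v \<notin> V" for v using that XV by (auto simp: flat_def)
  moreover have "(\<Sum>v\<in>V. flat l v) = 1"
  proof -
    have "(\<Sum>v\<in>X. flat l v) = (\<Sum>v\<in>X. l v) - card X * depth l"
      by (simp add: flat_def sum_subtractf)
    moreover have "(\<Sum>v\<in>V - X. flat l v) = (\<Sum>v\<in>V - X. l v) + card X * depth l"
      using finX by (simp add: flat_def sum.distrib)
    ultimately show ?thesis using l by (simp add: split_sum std_simplex_def)
  qed
  moreover have "Min (flat l ` X) = Min (l ` X) + - depth l"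
    by (rule Min_image_add) (use finX XV in \<open>auto simp: flat_def\<close>)
  ultimately show ?thesis by (simp add: part_zero_def std_simplex_def depth_def)
qed

text \<open>Height and depth add up to a constant along a fibre. Its far end is therefore the point
  of height 0, where a coordinate outside \<open>X\<close> vanishes.\<close>

lemma height_flat:
  "height (flat l) = height l + depth l"
proof -
  have "Min (flat l ` (V - X)) = Min (l ` (V - X)) + depth l * card X / card (V - X)"
    by (rule Min_image_add) (use finX XV in \<open>auto simp: flat_def\<close>)
  then show ?thesis using finX(4,5) unfolding height_def by (simp add: distrib_left)
qed

lemma height_nonneg: "l \<in> std_simplex V \<Longrightarrow> 0 \<le> height l"
  using finX by (auto simp: height_def std_simplex_def Min_ge_iff intro!: mult_nonneg_nonneg)

lemma height_eq_0_iff: "l \<in> std_simplex V \<Longrightarrow> height l = 0 \<longleftrightarrow> (\<exists>v\<in>V - X. l v = 0)"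
  using finX Min_image_eq_0_iff[of "V - X" l] by (auto simp: height_def std_simplex_def)

lemma flat_id:
  assumes "l \<in> part_zero V X"
  shows "flat l = l" "depth l = 0"
  using assms by (auto simp: part_zero_def flat_def depth_def std_simplex_def fun_eq_iff)

lemma flat_inj:
  assumes "l \<in> std_simplex V" "l' \<in> std_simplex V" "flat l = flat l'" "depth l = depth l'"
  shows "l = l'"
proof
  fix v
  show "l v = l' v"
  proof (cases "v \<in> V")
    case True
    have "flat l v = flat l' v" using assms(3) by simp
    then show ?thesis using True assms(4) by (simp add: flat_def split: if_splits)
  next
    case False then show ?thesis using assms(1,2) by (simp add: std_simplex_def)
  qed
qed

lemma flat_surj:
  assumes s: "s \<in> part_zero V X" and r: "0 \<le> r" "r \<le> height s"
  shows "\<exists>l\<in>std_simplex V. flat l = s \<and> depth l = r"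
proof -
  define l where "l = (\<lambda>v. if v \<in> X then s v + r
     else if v \<in> V then s v - r * card X / card (V - X) else 0)"
  have ss: "s \<in> std_simplex V" "Min (s ` X) = 0" using s by (auto simp: part_zero_def)
  have "Min (l ` X) = Min (s ` X) + r"
    by (rule Min_image_add) (use finX XV in \<open>auto simp: l_def\<close>)
  then have dl: "depth l = r" using ss by (simp add: depth_def)
  have "0 \<le> l v" for v
  proof -
    have "r * card X / card (V - X) \<le> s v" if "v \<in> V - X"
    proof -
      have "Min (s ` (V - X)) \<le> s v" using that finX by simp
      moreover have "r * card X / card (V - X) \<le> M" if "r \<le> card (V - X) / card X * M" for M
        using that finX(4,5) by (simp add: field_simps)
      then have "r * card X / card (V - X) \<le> Min (s ` (V - X))"
        using r(2) unfolding height_def by blast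
      ultimately show ?thesis by linarith
    qed
    then show ?thesis using ss r by (auto simp: l_def std_simplex_def)
  qed
  moreover have "(\<Sum>v\<in>V. l v) = 1"
  proof -
    have "(\<Sum>v\<in>X. l v) = (\<Sum>v\<in>X. s v) + card X * r"
      by (simp add: l_def sum.distrib)
    moreover have "(\<Sum>v\<in>V - X. l v) = (\<Sum>v\<in>V - X. s v) - card X * r"
      using finX by (simp add: l_def sum_subtractf)
    ultimately show ?thesis using ss by (simp add: split_sum std_simplex_def)
  qed
  ultimately have "l \<in> std_simplex V" using XV by (auto simp: std_simplex_def l_def)
  moreover have "flat l = s"
    using ss XV dl by (auto simp: flat_def l_def std_simplex_def fun_eq_iff)
  ultimately show ?thesis using dl by blast
qed

lemma continuous_on_depth: "continuous_on D depth"
  unfolding depth_def using finX XV by (intro continuous_on_Min_coordinates) auto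

lemma continuous_on_height: "continuous_on D height"
  unfolding height_def using finX
  by (intro continuous_intros continuous_on_Min_coordinates) auto

lemma continuous_on_flat: "continuous_on D flat"
proof (rule continuous_on_coordinatewise_then_product)
  fix v
  show "continuous_on D (\<lambda>l. flat l v)"
    unfolding flat_def
    by (cases "v \<in> X"; cases "v \<in> V")
      (auto intro!: continuous_intros continuous_on_coordinate continuous_on_depth simp: finX)
qed

end

text \<open>A cone with apex \<open>d\<close> over the boundary of \<open>X\<close>. Moving the apex
  to the barycentre of \<open>X\<close> flattens it onto the simplex \<open>X\<close>; the apex
  coordinate is recovered as \<open>d\<close> times the least coordinate of the image.\<close>

lemma cone_ball:
  fixes d :: nat
  assumes d: "d \<ge> 1"
  defines "V \<equiv> {..<Suc d}" and "X \<equiv> {..<d}"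
  shows "ball_pair (d - 1) (part_zero V X) {l \<in> part_zero V X. l d = 0}"
proof -
  have ne: "finite X" "X \<noteq> {}" using d by (auto simp: X_def lessThan_empty_iff)
  define h where "h = (\<lambda>(l::nat \<Rightarrow> real) v. if v \<in> X then l v + l d / d else 0)"
  have hM: "Min (h l ` X) = l d / d" if "l \<in> part_zero V X" for l
  proof -
    have "Min (h l ` X) = Min (l ` X) + l d / d"
      by (rule Min_image_add) (use ne in \<open>auto simp: h_def\<close>)
    then show ?thesis using that by (simp add: part_zero_def)
  qed
  have hs: "h l \<in> std_simplex X" if "l \<in> part_zero V X" for l
    using that d by (auto simp: h_def std_simplex_def part_zero_def V_def X_def sum.distrib)
  have hinj: "l = l'" if l: "l \<in> part_zero V X" "l' \<in> part_zero V X" "h l = h l'" for l l'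
  proof
    fix v
    have "l d / d = l' d / d" using hM[OF l(1)] hM[OF l(2)] l(3) by metis
    then have *: "l d = l' d" using d by simp
    show "l v = l' v"
    proof (cases "v \<in> X")
      case True then show ?thesis using fun_cong[OF l(3), of v] * unfolding h_def by simp
    next
      case False then show ?thesis using * l
        by (cases "v = d") (auto simp: X_def part_zero_def std_simplex_def V_def)
    qed
  qed
  have hsur: "\<exists>l\<in>part_zero V X. h l = k" if k: "k \<in> std_simplex X" for k
  proof -
    define r where "r = Min (k ` X)"
    define l where "l = (\<lambda>v. if v \<in> X then k v - r else if v = d then d * r else 0)"
    have r: "r \<le> k v" if "v \<in> X" for v using that ne by (simp add: r_def)
    have r0: "0 \<le> r" using k ne by (auto simp: r_def std_simplex_def Min_ge_iff)
    have "Min (l ` X) = Min (k ` X) + - r"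
      by (rule Min_image_add) (use ne in \<open>auto simp: l_def\<close>)
    moreover have "(\<Sum>v\<in>V. l v) = 1"
      using k by (simp add: V_def l_def X_def sum_subtractf std_simplex_def)
    ultimately have "l \<in> part_zero V X"
      using r r0 by (auto simp: part_zero_def std_simplex_def l_def V_def X_def r_def)
    moreover have "h l = k"
      using k d by (auto simp: h_def l_def X_def std_simplex_def fun_eq_iff)
    ultimately show ?thesis by blast
  qed
  have hb: "h l \<in> face_bdry X \<longleftrightarrow> l d = 0" if "l \<in> part_zero V X" for l
    using hM[OF that] hs[OF that] Min_image_eq_0_iff[OF ne, of "h l"] d
    by (auto simp: face_bdry_def std_simplex_def)
  have "closed {l::nat \<Rightarrow> real. Min (l ` X) = 0}"
    by (intro closed_Collect_eq continuous_on_Min_coordinates ne continuous_on_const)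
  then have cp: "compact (part_zero V X)"
    unfolding part_zero_def Collect_conj_eq Collect_mem_eq
    using compact_std_simplex[of V] by (auto simp: V_def intro: compact_Int_closed)
  show ?thesis
  proof (rule ball_pair_transport[OF std_simplex_ball[OF d] cp])
    show "continuous_on (part_zero V X) h"
      unfolding h_def
    proof (rule continuous_on_coordinatewise_then_product)
      fix v show "continuous_on (part_zero V X) (\<lambda>l. if v \<in> X then l v + l d / real d else 0)"
        using d by (cases "v \<in> X") (auto intro!: continuous_intros continuous_on_coordinate)
    qed
    show "bij_betw h (part_zero V X) (std_simplex {..<d})"
    proof -
      have "h ` part_zero V X = std_simplex X" using hs hsur by blast
      moreover have "inj_on h (part_zero V X)" by (rule inj_onI) (rule hinj)
      ultimately show ?thesis by (simp add: bij_betw_def X_def)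
    qed
    show "h ` {l \<in> part_zero V X. l d = 0} = face_bdry {..<d}"
      using hb hsur unfolding face_bdry_def X_def by blast
  qed auto
qed

section \<open>Attaching a simplex along a spot\<close>

text \<open>A copy of \<open>\<tau> * \<partial>F\<close> with \<open>\<tau> = V - F\<close> in the boundary \<open>Q\<close>. The last clause says that it contains the
  whole star of \<open>\<tau>\<close>.\<close>
definition spot :: "nat set \<Rightarrow> nat set \<Rightarrow> (nat \<Rightarrow> nat \<Rightarrow> bool) \<Rightarrow> nat set \<Rightarrow> nat set \<Rightarrow> (nat set \<Rightarrow> nat) \<Rightarrow> bool" where
  "spot V P le Q F e \<longleftrightarrow>
     (\<forall>S\<subseteq>V. \<not> F \<subseteq> S \<longrightarrow> e S \<in> Q) \<and>
     (\<forall>S\<subseteq>V. \<forall>S'\<subseteq>V. \<not> F \<subseteq> S \<longrightarrow> \<not> F \<subseteq> S' \<longrightarrow> (le (e S) (e S') \<longleftrightarrow> S \<subseteq> S')) \<and>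
     (\<forall>S\<subseteq>V. \<not> F \<subseteq> S \<longrightarrow> (\<forall>p\<in>P. le p (e S) \<longrightarrow> (\<exists>S'\<subseteq>S. p = e S'))) \<and>
     (\<forall>q\<in>Q. le (e (V - F)) q \<longrightarrow> (\<exists>S\<subseteq>V. \<not> F \<subseteq> S \<and> q = e S))"

text \<open>A smaller \<open>F'\<close> means a larger \<tau>, and its star lies inside the star of
  the old \<tau>. So the size of a spot is only an upper bound for the type of the next
  simplex.\<close>

lemma spot_mono:
  assumes s: "spot V P le Q F e" and F: "F' \<subseteq> F" "F' \<noteq> {}" "F \<subseteq> V"
    and P: "finite_poset P le" "Q \<subseteq> P"
  shows "spot V P le Q F' e"
proof -
  have sub: "\<not> F \<subseteq> S" if "\<not> F' \<subseteq> S" for S using that F by blast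
  note s' = s[unfolded spot_def]
  have 1: "\<forall>S\<subseteq>V. \<not> F \<subseteq> S \<longrightarrow> e S \<in> Q" using s' by (elim conjE)
  have 2: "\<forall>S\<subseteq>V. \<forall>S'\<subseteq>V. \<not> F \<subseteq> S \<longrightarrow> \<not> F \<subseteq> S' \<longrightarrow> (le (e S) (e S') \<longleftrightarrow> S \<subseteq> S')"
    using s' by (elim conjE)
  have 3: "\<forall>S\<subseteq>V. \<not> F \<subseteq> S \<longrightarrow> (\<forall>p\<in>P. le p (e S) \<longrightarrow> (\<exists>S'\<subseteq>S. p = e S'))"
    using s' by (elim conjE)
  have 4: "\<forall>q\<in>Q. le (e (V - F)) q \<longrightarrow> (\<exists>S\<subseteq>V. \<not> F \<subseteq> S \<and> q = e S)"
    using s' by (elim conjE)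
  have n: "\<not> F \<subseteq> V - F" "\<not> F \<subseteq> V - F'" "\<not> F' \<subseteq> V - F'" "V - F \<subseteq> V - F'" using F by auto
  have "\<exists>S\<subseteq>V. \<not> F' \<subseteq> S \<and> q = e S" if q: "q \<in> Q" "le (e (V - F')) q" for q
  proof -
    have "e (V - F) \<in> P" "e (V - F') \<in> P" using 1 n P(2) by (meson Diff_subset subsetD)+
    moreover have "le (e (V - F)) (e (V - F'))" using 2 n by simp
    ultimately have "le (e (V - F)) q" using q P unfolding finite_poset_def by blast
    then obtain S where S: "S \<subseteq> V" "\<not> F \<subseteq> S" "q = e S" using 4 q(1) by blast
    then have "V - F' \<subseteq> S" using 2 q(2) n by simp
    then have "\<not> F' \<subseteq> S" using S F by blast
    then show ?thesis using S by blast
  qed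
  then show ?thesis using 1 2 3 sub unfolding spot_def by simp
qed

section \<open>Subposets, their realizations and Boolean ranks\<close>

lemma realization_set_cong:
  assumes "\<And>p q. p \<in> P \<Longrightarrow> q \<in> P \<Longrightarrow> le p q = le' p q"
  shows "realization_set P le z = realization_set P le' z"
proof -
  have "is_chain le C = is_chain le' C" if "C \<subseteq> P - {z}" for C
    using that assms unfolding is_chain_def by blast
  then show ?thesis unfolding realization_set_def by blast
qed

lemma realization_set_sub_iff:
  assumes "finite P" "D \<subseteq> P"
  shows "x \<in> realization_set D le z \<longleftrightarrow> x \<in> realization_set P le z \<and> {v. x v \<noteq> 0} \<subseteq> D"
proof (cases "{v. x v \<noteq> 0} \<subseteq> D")
  case True
  then have "(\<Sum>v\<in>P - {z}. x v) = (\<Sum>v\<in>D - {z}. x v)"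
    using assms by (intro sum.mono_neutral_right) auto
  moreover have "{v. x v \<noteq> 0} \<subseteq> D - {z} \<longleftrightarrow> {v. x v \<noteq> 0} \<subseteq> P - {z}" using True assms(2) by blast
  ultimately show ?thesis using True by (simp add: realization_set_def)
next
  case False
  then show ?thesis by (auto simp: realization_set_def)
qed

lemma boolean_of_rank_card: "boolean_of_rank P le z p r \<Longrightarrow> card (interval P le z p) = 2 ^ r"
  unfolding boolean_of_rank_def by (metis bij_betw_same_card card_Pow)

lemma boolean_of_rank_unique:
  "boolean_of_rank P le z p r \<Longrightarrow> boolean_of_rank P le z p r' \<Longrightarrow> r = r'"
  using boolean_of_rank_card[of P le z p r] boolean_of_rank_card[of P le z p r'] by simp

lemma boolean_of_rank_cong:
  assumes "interval P le z p = interval P' le' z p"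
    "\<And>x y. x \<in> interval P' le' z p \<Longrightarrow> y \<in> interval P' le' z p \<Longrightarrow> le x y = le' x y"
  shows "boolean_of_rank P le z p r \<longleftrightarrow> boolean_of_rank P' le' z p r"
  unfolding boolean_of_rank_def assms(1) using assms(2) by (metis (no_types, lifting))

lemma boolean_of_rank_simplex:
  fixes t :: "nat set \<Rightarrow> 'a"
  assumes S: "finite S" and t: "\<And>A B. A \<subseteq> S \<Longrightarrow> B \<subseteq> S \<Longrightarrow> le (t A) (t B) \<longleftrightarrow> A \<subseteq> B"
    and I: "interval P le z (t S) = t ` Pow S"
  shows "boolean_of_rank P le z (t S) (card S)"
proof -
  have inj: "inj_on t (Pow S)" using t by (intro inj_onI) (metis Pow_iff subset_antisym subset_refl)
  have "bij_betw (the_inv_into (Pow S) t) (t ` Pow S) (Pow S)"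
    using bij_betw_the_inv_into[of t "Pow S" "t ` Pow S"] inj by (simp add: bij_betw_def)
  moreover have "le x y \<longleftrightarrow> the_inv_into (Pow S) t x \<subseteq> the_inv_into (Pow S) t y"
    if xy: "x \<in> t ` Pow S" "y \<in> t ` Pow S" for x y
  proof -
    obtain A B where "x = t A" "y = t B" "A \<subseteq> S" "B \<subseteq> S" using xy by blast
    then show ?thesis using the_inv_into_f_f[OF inj] t by simp
  qed
  ultimately show ?thesis unfolding boolean_of_rank_def I
    using S by (intro exI[of _ S] exI[of _ "the_inv_into (Pow S) t"]) simp
qed

text \<open>One attachment: a new simplex on the colours \<open>V\<close> is glued to the ball along
  the spot of \<open>X\<close>. The excluded case \<open>X = V\<close> would glue along the whole
  boundary and close the ball up to a sphere.\<close>

locale flip =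
  fixes m :: nat and V P le Q X e
  assumes finV: "finite V" and X: "X \<subseteq> V" "X \<noteq> {}" "X \<noteq> V"
    and sp: "simplicial_poset P le (0::nat)" and QP: "Q \<subseteq> P"
    and ball: "ball_pair m (realization_set P le 0) (realization_set Q le 0)"
    and sX: "spot V P le Q X e"
begin

text \<open>The shift beyond \<open>Max P\<close> separates new elements from old ones, and
  \<open>set_encode\<close> separates them from each other.\<close>

definition new :: "nat set \<Rightarrow> nat" where "new S = Suc (Max P) + set_encode S"

definition face :: "nat set \<Rightarrow> nat" where "face S = (if X \<subseteq> S then new S else e S)"

definition P' :: "nat set" where "P' = P \<union> new ` {S. X \<subseteq> S \<and> S \<subseteq> V}"

text \<open>Old elements keep their lower sets, so \<open>P\<close> stays a down-set and ranks in it
  do not change. Below a new face lie the faces of the new simplex, old and new alike.\<close>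

definition le' :: "nat \<Rightarrow> nat \<Rightarrow> bool" where
  "le' p q \<longleftrightarrow> (if q \<in> P then p \<in> P \<and> le p q
     else \<exists>S S'. S \<subseteq> S' \<and> X \<subseteq> S' \<and> S' \<subseteq> V \<and> p = face S \<and> q = new S')"

text \<open>The star of \<tau> = V - X inside the spot. These faces become interior; the other faces
  of the spot stay on the boundary.\<close>

definition covered :: "nat set" where "covered = e ` {S. V - X \<subseteq> S \<and> S \<subseteq> V \<and> \<not> X \<subseteq> S}"

definition Q' :: "nat set" where "Q' = (Q - covered) \<union> new ` {S. X \<subseteq> S \<and> S \<subset> V}"

lemma poset: "finite P" "\<And>x. x \<in> P \<Longrightarrow> le x x"
  "\<And>x y. x \<in> P \<Longrightarrow> y \<in> P \<Longrightarrow> le x y \<Longrightarrow> le y x \<Longrightarrow> x = y"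
  "\<And>x y z. x \<in> P \<Longrightarrow> y \<in> P \<Longrightarrow> z \<in> P \<Longrightarrow> le x y \<Longrightarrow> le y z \<Longrightarrow> le x z"
  "0 \<in> P" "\<And>x. x \<in> P \<Longrightarrow> le 0 x"
  using sp unfolding simplicial_poset_def finite_poset_def is_min_elem_def by blast+

lemma e_in: "S \<subseteq> V \<Longrightarrow> \<not> X \<subseteq> S \<Longrightarrow> e S \<in> Q"
  and e_le: "S \<subseteq> V \<Longrightarrow> \<not> X \<subseteq> S \<Longrightarrow> S' \<subseteq> V \<Longrightarrow> \<not> X \<subseteq> S' \<Longrightarrow> le (e S) (e S') \<longleftrightarrow> S \<subseteq> S'"
  and e_down: "S \<subseteq> V \<Longrightarrow> \<not> X \<subseteq> S \<Longrightarrow> p \<in> P \<Longrightarrow> le p (e S) \<Longrightarrow> \<exists>S'\<subseteq>S. p = e S'"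
  and e_star: "q \<in> Q \<Longrightarrow> le (e (V - X)) q \<Longrightarrow> \<exists>S\<subseteq>V. \<not> X \<subseteq> S \<and> q = e S"
  using sX unfolding spot_def by auto

lemma e_inP: "S \<subseteq> V \<Longrightarrow> \<not> X \<subseteq> S \<Longrightarrow> e S \<in> P" using e_in QP by blast

lemma e_inj: "S \<subseteq> V \<Longrightarrow> \<not> X \<subseteq> S \<Longrightarrow> S' \<subseteq> V \<Longrightarrow> \<not> X \<subseteq> S' \<Longrightarrow> e S = e S' \<Longrightarrow> S = S'"
  using e_le by (metis subset_antisym subset_refl)

lemma new_notin: "new S \<notin> P" "new S \<notin> Q"
proof -
  show "new S \<notin> P" using Max_ge[OF poset(1), of "new S"] by (auto simp: new_def)
  then show "new S \<notin> Q" using QP by blast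
qed

lemma fin_sub: "S \<subseteq> V \<Longrightarrow> finite S" using finV finite_subset by blast

lemma new_inj: "S \<subseteq> V \<Longrightarrow> S' \<subseteq> V \<Longrightarrow> new S = new S' \<longleftrightarrow> S = S'"
  using fin_sub set_encode_eq by (simp add: new_def)

lemma face_in_P: "S \<subseteq> V \<Longrightarrow> face S \<in> P \<longleftrightarrow> \<not> X \<subseteq> S"
  using new_notin e_inP by (simp add: face_def)

lemma face_inj: "S \<subseteq> V \<Longrightarrow> S' \<subseteq> V \<Longrightarrow> face S = face S' \<Longrightarrow> S = S'"
  using new_inj e_inj face_in_P by (metis face_def)

lemma le'_P: "q \<in> P \<Longrightarrow> le' p q \<longleftrightarrow> p \<in> P \<and> le p q"
  by (simp add: le'_def)

lemma le'_new: "X \<subseteq> S' \<Longrightarrow> S' \<subseteq> V \<Longrightarrow> le' p (new S') \<longleftrightarrow> (\<exists>S\<subseteq>S'. p = face S)"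
proof -
  assume S': "X \<subseteq> S'" "S' \<subseteq> V"
  have "le' p (new S') \<longleftrightarrow> (\<exists>S S1. S \<subseteq> S1 \<and> X \<subseteq> S1 \<and> S1 \<subseteq> V \<and> p = face S \<and> new S' = new S1)"
    by (simp add: le'_def new_notin)
  also have "\<dots> \<longleftrightarrow> (\<exists>S\<subseteq>S'. p = face S)" using new_inj[OF S'(2)] S' by blast
  finally show ?thesis .
qed

lemma face_down: "S \<subseteq> V \<Longrightarrow> le' p (face S) \<Longrightarrow> \<exists>S'\<subseteq>S. p = face S'"
proof (cases "X \<subseteq> S")
  case True
  assume "S \<subseteq> V" "le' p (face S)"
  then show ?thesis using True le'_new by (simp add: face_def)
next
  case False
  assume S: "S \<subseteq> V" "le' p (face S)"
  then have "p \<in> P" "le p (e S)" using False le'_P e_inP by (simp_all add: face_def)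
  then obtain S' where "S' \<subseteq> S" "p = e S'" using e_down S False by blast
  then show ?thesis using False by (auto simp: face_def)
qed

lemma face_le: "S \<subseteq> V \<Longrightarrow> S' \<subseteq> V \<Longrightarrow> le' (face S) (face S') \<longleftrightarrow> S \<subseteq> S'"
proof
  assume S: "S \<subseteq> V" "S' \<subseteq> V" "le' (face S) (face S')"
  then obtain S1 where "S1 \<subseteq> S'" "face S = face S1" using face_down by blast
  then show "S \<subseteq> S'" using face_inj S by blast
next
  assume S: "S \<subseteq> V" "S' \<subseteq> V" "S \<subseteq> S'"
  show "le' (face S) (face S')"
  proof (cases "X \<subseteq> S'")
    case True
    then have "face S' = new S'" by (simp add: face_def)
    then show ?thesis using le'_new[OF True S(2)] S(3) by auto
  next
    case False
    then have "\<not> X \<subseteq> S" using S by blast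
    then show ?thesis using False S e_le le'_P e_inP by (simp add: face_def)
  qed
qed

sublocale T: simplex_faces V face le'
  by unfold_locales (use finV face_le in auto)

lemma face_empty: "face {} = 0"
proof -
  have x: "\<not> X \<subseteq> {}" using X by blast
  then have "le 0 (e {})" using poset(6) e_inP by simp
  then have "0 = e {}" using e_down[OF _ x poset(5)] by auto
  then show ?thesis using x by (simp add: face_def)
qed

lemma P'_cases: "p \<in> P' \<Longrightarrow> p \<in> P \<or> (\<exists>S. X \<subseteq> S \<and> S \<subseteq> V \<and> p = face S \<and> p = new S)"
  by (auto simp: P'_def face_def)

lemma face_in_P': "S \<subseteq> V \<Longrightarrow> face S \<in> P'"
  using e_inP by (auto simp: face_def P'_def)

lemma finite_P': "finite P'"
  using poset(1) finV by (auto simp: P'_def intro: finite_subset[of _ "Pow V"])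

lemma finite_poset_P': "finite_poset P' le'"
  unfolding finite_poset_def
proof (intro conjI ballI impI)
  show "finite P'" by (rule finite_P')
  show "le' x x" if "x \<in> P'" for x
    using P'_cases[OF that]
  proof
    assume "x \<in> P" then show ?thesis using poset(2) le'_P by blast
  next
    assume "\<exists>S. X \<subseteq> S \<and> S \<subseteq> V \<and> x = face S \<and> x = new S"
    then show ?thesis using face_le by blast
  qed
next
  fix x y assume x: "x \<in> P'" and y: "y \<in> P'" and xy: "le' x y \<and> le' y x"
  show "x = y"
  proof (cases "y \<in> P")
    case True
    then have "x \<in> P" "le x y" using xy le'_P by auto
    then show ?thesis using True xy le'_P poset(3) by auto
  next
    case False
    then obtain S where S: "S \<subseteq> V" "y = face S" using P'_cases y by blast
    then obtain S' where S': "S' \<subseteq> S" "x = face S'" using face_down xy by blast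
    then have "S \<subseteq> S'" using S xy face_le by auto
    then show ?thesis using S S' by auto
  qed
next
  fix x y z assume x: "x \<in> P'" and y: "y \<in> P'" and z: "z \<in> P'" and xyz: "le' x y \<and> le' y z"
  show "le' x z"
  proof (cases "z \<in> P")
    case True
    then have "y \<in> P" using xyz le'_P by auto
    then have "x \<in> P" using xyz le'_P by auto
    then show ?thesis using xyz True \<open>y \<in> P\<close> le'_P poset(4) by blast
  next
    case False
    then obtain S where S: "S \<subseteq> V" "z = face S" using P'_cases z by blast
    then obtain S1 where S1: "S1 \<subseteq> S" "y = face S1" using face_down xyz by blast
    then obtain S2 where "S2 \<subseteq> S1" "x = face S2" using face_down[of S1 x] xyz S by auto
    then show ?thesis using S S1 face_le by auto
  qed
qed

lemma boolean_old: "p \<in> P \<Longrightarrow> boolean_of_rank P' le' 0 p r \<longleftrightarrow> boolean_of_rank P le 0 p r"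
  by (rule boolean_of_rank_cong)
    (use poset(5) in \<open>auto simp: interval_def le'_P P'_def new_notin\<close>)

lemma boolean_top: "S \<subseteq> V \<Longrightarrow> boolean_of_rank P' le' 0 (face S) (card S)"
proof (rule boolean_of_rank_simplex)
  assume S: "S \<subseteq> V"
  show "finite S" using S by (rule fin_sub)
  show "le' (face A) (face B) \<longleftrightarrow> A \<subseteq> B" if "A \<subseteq> S" "B \<subseteq> S" for A B
    using that S face_le by simp
  have "le' 0 (face A)" if "A \<subseteq> V" for A
    using face_le[of "{}" A] that by (simp add: face_empty)
  then show "interval P' le' 0 (face S) = face ` Pow S"
    using face_down[OF S] S face_le face_in_P' unfolding interval_def by (fastforce intro: imageI)
qed

lemma simplicial_P': "simplicial_poset P' le' 0"
  unfolding simplicial_poset_def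
proof (intro conjI ballI)
  show "finite_poset P' le'" by (rule finite_poset_P')
  have "le' 0 q" if "q \<in> P'" for q
    using P'_cases[OF that] poset(5,6) le'_P face_le[of "{}"] face_empty by auto
  then show "is_min_elem P' le' 0"
    using poset(5) by (simp add: is_min_elem_def P'_def)
  fix p assume "p \<in> P'"
  then consider "p \<in> P" | S where "S \<subseteq> V" "p = face S" using P'_cases by blast
  then show "\<exists>r. boolean_of_rank P' le' 0 p r"
  proof cases
    case 1 then show ?thesis using boolean_old sp unfolding simplicial_poset_def by blast
  next
    case 2 then show ?thesis using boolean_top by blast
  qed
qed

text \<open>The new faces are the sets between \<open>X\<close> and \<open>V\<close>, hence
  correspond to the subsets of \<open>V - X\<close> with rank shifted by
  \<open>card X\<close>.\<close>

lemma fvec_P':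
  "fvec P' le' 0 r = fvec P le 0 r + (if card X \<le> r then (card V - card X) choose (r - card X) else 0)"
proof -
  let ?N = "{S. X \<subseteq> S \<and> S \<subseteq> V \<and> card S = r}"
  have bn: "boolean_of_rank P' le' 0 (new S) r \<longleftrightarrow> card S = r" if "X \<subseteq> S" "S \<subseteq> V" for S
    using boolean_top[OF that(2)] boolean_of_rank_unique that(1) by (auto simp: face_def)
  have "{p \<in> P'. boolean_of_rank P' le' 0 p r} = {p \<in> P. boolean_of_rank P le 0 p r} \<union> new ` ?N"
    using boolean_old bn by (auto simp: P'_def)
  moreover have "{p \<in> P. boolean_of_rank P le 0 p r} \<inter> new ` ?N = {}" using new_notin by auto
  moreover have finN: "finite ?N" using finV by (auto intro: finite_subset[of _ "Pow V"])
  ultimately have "fvec P' le' 0 r = fvec P le 0 r + card (new ` ?N)"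
    using poset(1) by (simp add: fvec_def card_Un_disjoint)
  also have "card (new ` ?N) = card ?N"
    by (intro card_image inj_onI) (use new_inj in auto)
  also have "card ?N = (if card X \<le> r then (card V - card X) choose (r - card X) else 0)"
  proof (cases "card X \<le> r")
    case True
    have fX: "finite X" using X fin_sub by blast
    have "bij_betw (\<lambda>S. S - X) ?N {K. K \<subseteq> V - X \<and> card K = r - card X}"
    proof (rule bij_betw_byWitness[where f' = "\<lambda>K. K \<union> X"])
      show "(\<lambda>S. S - X) ` ?N \<subseteq> {K. K \<subseteq> V - X \<and> card K = r - card X}"
        using fX by (auto simp: card_Diff_subset)
      have "card (K \<union> X) = r" if "K \<subseteq> V - X" "card K = r - card X" for K
        using that True fX finV by (subst card_Un_disjoint) (auto intro: finite_subset)
      then show "(\<lambda>K. K \<union> X) ` {K. K \<subseteq> V - X \<and> card K = r - card X} \<subseteq> ?N"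
        using X by auto
    qed auto
    then have "card ?N = card {K. K \<subseteq> V - X \<and> card K = r - card X}" by (rule bij_betw_same_card)
    also have "\<dots> = (card V - card X) choose (r - card X)"
      using n_subsets[of "V - X"] finV fX X by (simp add: card_Diff_subset)
    finally show ?thesis using True by simp
  next
    case False
    have "card X \<le> card S" if "X \<subseteq> S" "S \<subseteq> V" for S using that fin_sub card_mono by blast
    then have "?N = {}" using False by auto
    then show ?thesis using False by (simp only: card.empty if_False)
  qed
  finally show ?thesis .
qed

section \<open>The realization after the attachment\<close>

abbreviation "real_of D \<equiv> realization_set D le' 0"

lemma real_of_P: "D \<subseteq> P \<Longrightarrow> real_of D = realization_set D le 0"
  by (rule realization_set_cong) (use le'_P in blast)

lemma real_of_sub: "D \<subseteq> P' \<Longrightarrow> x \<in> real_of D \<longleftrightarrow> x \<in> real_of P' \<and> {v. x v \<noteq> 0} \<subseteq> D"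
  by (rule realization_set_sub_iff[OF finite_P'])

lemma real_of_mono: "D \<subseteq> D' \<Longrightarrow> D' \<subseteq> P' \<Longrightarrow> real_of D \<subseteq> real_of D'"
proof
  fix x assume D: "D \<subseteq> D'" "D' \<subseteq> P'" "x \<in> real_of D"
  then show "x \<in> real_of D'" using real_of_sub[of D x] real_of_sub[of D' x] by auto
qed

lemma real_of_transfer:
  "x \<in> real_of D \<Longrightarrow> {v. x v \<noteq> 0} \<subseteq> D' \<Longrightarrow> D \<subseteq> P' \<Longrightarrow> D' \<subseteq> P' \<Longrightarrow> x \<in> real_of D'"
  using real_of_sub by metis

lemma comparable:
  assumes "x \<in> real_of P'" "x p \<noteq> 0" "x q \<noteq> 0"
  shows "le' p q \<or> le' q p" "p \<in> P'"
  using assms unfolding realization_set_def is_chain_def by blast+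

lemma QP': "Q \<subseteq> P'" "P \<subseteq> P'" using QP by (auto simp: P'_def)

lemma face_sub_P': "D \<subseteq> Pow V \<Longrightarrow> face ` D \<subseteq> P'" using face_in_P' by blast

text \<open>Everything comparable with a new face is a face of the new simplex: what lies below by
  \<open>face_down\<close>, what lies above because it is new as well. Thus the realization splits
  into the old ball and one cell.\<close>

lemma new_chain:
  assumes x: "x \<in> real_of P'" and n: "x p \<noteq> 0" "p \<notin> P"
  shows "{v. x v \<noteq> 0} \<subseteq> face ` Pow V"
proof
  fix q assume "q \<in> {v. x v \<noteq> 0}"
  then have q: "le' p q \<or> le' q p" "q \<in> P'" using comparable[OF x] n by auto
  obtain S where S: "S \<subseteq> V" "p = face S" using P'_cases[OF comparable(2)[OF x n(1,1)]] n(2) by blast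
  show "q \<in> face ` Pow V"
  proof (cases "q \<in> P")
    case True
    then have "le' q p" using q n(2) le'_P by auto
    then show ?thesis using face_down S by blast
  next
    case False then show ?thesis using P'_cases[OF q(2)] by blast
  qed
qed

lemma real_of_P': "real_of P' = real_of P \<union> real_of (face ` Pow V)"
proof (intro set_eqI iffI)
  fix x assume x: "x \<in> real_of P'"
  show "x \<in> real_of P \<union> real_of (face ` Pow V)"
  proof (cases "{v. x v \<noteq> 0} \<subseteq> P")
    case True then show ?thesis using real_of_sub[OF QP'(2)] x by auto
  next
    case False
    then have "{v. x v \<noteq> 0} \<subseteq> face ` Pow V" using new_chain[OF x] by blast
    then show ?thesis using real_of_sub[OF face_sub_P'[OF subset_refl]] x by auto
  qed
next
  fix x assume "x \<in> real_of P \<union> real_of (face ` Pow V)"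
  then show "x \<in> real_of P'"
    using real_of_sub[OF QP'(2)] real_of_sub[OF face_sub_P'[OF subset_refl]] by blast
qed

text \<open>The two complementary parts of the boundary of the new simplex: \<open>DA\<close> is
  \<partial>X * (V - X) and gets glued, \<open>DB\<close> is X * \<partial>(V - X) and becomes
  free.\<close>

definition DA :: "nat set set" where "DA = {S. S \<subseteq> V \<and> \<not> X \<subseteq> S}"
definition DB :: "nat set set" where "DB = {S. S \<subseteq> V \<and> \<not> V - X \<subseteq> S}"

lemma DA: "DA \<subseteq> Pow V" "{} \<in> DA" "S \<in> DA \<Longrightarrow> S' \<subseteq> S \<Longrightarrow> S' \<in> DA"
  using X by (auto simp: DA_def)

lemma DB: "DB \<subseteq> Pow V" "{} \<in> DB" "S \<in> DB \<Longrightarrow> S' \<subseteq> S \<Longrightarrow> S' \<in> DB"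
  using X by (auto simp: DB_def)

lemma face_DA: "face ` DA = e ` DA" by (auto simp: DA_def face_def)

sublocale pinch V X by unfold_locales (use finV X in auto)

abbreviation "bary \<equiv> barycentric V face"

abbreviation "cell \<equiv> real_of (face ` Pow V)"

lemma bary_simplex: "x \<in> cell \<Longrightarrow> bary x \<in> std_simplex V"
  using T.barycentric_in by (simp add: face_empty)

lemma point_cell: "l \<in> std_simplex V \<Longrightarrow> T.point l \<in> cell \<and> bary (T.point l) = l"
  using T.bary_point by (simp add: face_empty)

lemma point_bary: "x \<in> cell \<Longrightarrow> T.point (bary x) = x"
  using T.point_bary by (simp add: face_empty)

lemma attach_set: "x \<in> real_of (face ` DA) \<longleftrightarrow> x \<in> cell \<and> bary x \<in> part_zero V X"
proof -
  have "support (bary x) \<in> DA \<longleftrightarrow> bary x \<in> part_zero V X" if "x \<in> cell"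
  proof -
    have l: "bary x \<in> std_simplex V" by (rule bary_simplex[OF that])
    then have "Min (bary x ` X) = 0 \<longleftrightarrow> (\<exists>v\<in>X. bary x v = 0)"
      using finX X by (intro Min_image_eq_0_iff) (auto simp: std_simplex_def)
    moreover have "support (bary x) \<subseteq> V" using l by (auto simp: std_simplex_def)
    ultimately show ?thesis using l by (auto simp: DA_def part_zero_def)
  qed
  then show ?thesis using T.subcomplex_iff[OF DA, where x = x] by (auto simp: face_empty)
qed

lemma free_set: "x \<in> real_of (face ` DB) \<longleftrightarrow> x \<in> cell \<and> height (bary x) = 0"
proof -
  have "support (bary x) \<in> DB \<longleftrightarrow> height (bary x) = 0" if "x \<in> cell"
  proof -
    have l: "bary x \<in> std_simplex V" by (rule bary_simplex[OF that])
    then have "support (bary x) \<subseteq> V" by (auto simp: std_simplex_def)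
    then show ?thesis using height_eq_0_iff[OF l] by (auto simp: DB_def)
  qed
  then show ?thesis using T.subcomplex_iff[OF DB, where x = x] by (auto simp: face_empty)
qed

lemma attach_inter: "real_of P \<inter> cell = real_of (face ` DA)"
proof -
  have "P \<inter> face ` Pow V = face ` DA" using face_in_P by (auto simp: DA_def)
  then have "{v. x v \<noteq> 0} \<subseteq> P \<and> {v. x v \<noteq> 0} \<subseteq> face ` Pow V \<longleftrightarrow> {v. x v \<noteq> 0} \<subseteq> face ` DA"
    for x :: "nat \<Rightarrow> real" by (metis le_inf_iff)
  then show ?thesis
    using real_of_sub[OF QP'(2)] real_of_sub[OF face_sub_P'[OF subset_refl]]
      real_of_sub[OF face_sub_P'[OF DA(1)]] by (intro set_eqI) (simp, blast)
qed

text \<open>The star clause of \<open>spot\<close> enters here: boundary faces above a covered one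
  belong to the star of \<tau>, faces below it to the spot. So no other part of the sphere meets the
  region that becomes interior.\<close>

lemma covered_chain:
  assumes x: "x \<in> real_of Q" and c: "x p \<noteq> 0" "p \<in> covered"
  shows "x \<in> real_of (face ` DA)"
proof -
  have x': "x \<in> real_of P'" "{v. x v \<noteq> 0} \<subseteq> Q" using x real_of_sub[OF QP'(1)] by auto
  obtain S where S: "V - X \<subseteq> S" "S \<subseteq> V" "\<not> X \<subseteq> S" "p = e S" using c by (auto simp: covered_def)
  have nX: "\<not> X \<subseteq> V - X" using X by blast
  have pP: "p \<in> P" using S e_inP by blast
  have "q \<in> e ` DA" if "x q \<noteq> 0" for q
  proof -
    have q: "q \<in> Q" "q \<in> P" using that x'(2) QP by auto
    have "le' p q \<or> le' q p" using comparable(1)[OF x'(1) c(1) that] .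
    then show ?thesis
    proof
      assume "le' p q"
      then have "le p q" using q le'_P by blast
      moreover have "le (e (V - X)) p" using e_le S nX by simp
      ultimately have "le (e (V - X)) q" using poset(4) e_inP nX q pP by blast
      then show ?thesis using e_star[OF q(1)] by (auto simp: DA_def)
    next
      assume "le' q p"
      then have "le q p" using pP le'_P by blast
      then obtain S' where "S' \<subseteq> S" "q = e S'" using e_down S q by blast
      then show ?thesis using S unfolding DA_def by blast
    qed
  qed
  then have "{v. x v \<noteq> 0} \<subseteq> face ` DA" using face_DA by blast
  then show ?thesis using real_of_sub[OF face_sub_P'[OF DA(1)]] x' by blast
qed

lemma Q'_sub: "Q' \<subseteq> P'" using QP by (auto simp: Q'_def P'_def)

lemma face_in_Q': "S \<subseteq> V \<Longrightarrow> face S \<in> Q' \<longleftrightarrow> \<not> V - X \<subseteq> S"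
proof (cases "X \<subseteq> S")
  case True
  assume S: "S \<subseteq> V"
  have "face S \<in> Q' \<longleftrightarrow> S \<noteq> V"
    using True S new_notin new_inj by (auto simp: face_def Q'_def)
  then show ?thesis using True S X by blast
next
  case False
  assume S: "S \<subseteq> V"
  have "face S = e S" "e S \<in> P" "e S \<in> Q" using False S e_in e_inP by (auto simp: face_def)
  moreover have "e S \<in> covered \<longleftrightarrow> V - X \<subseteq> S"
    using e_inj[OF S False] S False by (auto simp: covered_def)
  ultimately show ?thesis using new_notin by (auto simp: Q'_def)
qed

lemma face_Q': "face ` Pow V \<inter> Q' = face ` DB"
  using face_in_Q' by (auto simp: DB_def)

text \<open>Matches the combinatorial boundary \<open>Q'\<close> with the set delivered by
  \<open>ball_pair_attach\<close>. Points on the rim of the attaching region are counted through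
  \<open>DB\<close>.\<close>

lemma real_of_Q': "real_of Q' = (real_of Q - real_of (face ` DA)) \<union> real_of (face ` DB)"
proof (intro set_eqI iffI)
  fix x assume "x \<in> real_of Q'"
  then have x: "x \<in> real_of P'" "{v. x v \<noteq> 0} \<subseteq> Q'" using real_of_sub[OF Q'_sub] by auto
  have B: "x \<in> real_of (face ` DB)" if "{v. x v \<noteq> 0} \<subseteq> face ` Pow V"
    using that x face_Q' real_of_sub[OF face_sub_P'[OF DB(1)]] by blast
  show "x \<in> (real_of Q - real_of (face ` DA)) \<union> real_of (face ` DB)"
  proof (cases "{v. x v \<noteq> 0} \<subseteq> P")
    case False
    then show ?thesis using new_chain[OF x(1)] B by blast
  next
    case True
    moreover have "P \<inter> Q' \<subseteq> Q" using new_notin by (auto simp: Q'_def)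
    ultimately have "{v. x v \<noteq> 0} \<subseteq> Q" using x(2) by blast
    then have xQ: "x \<in> real_of Q" using x real_of_sub[OF QP'(1)] by blast
    show ?thesis
    proof (cases "x \<in> real_of (face ` DA)")
      case True
      then have "{v. x v \<noteq> 0} \<subseteq> face ` Pow V"
        using real_of_sub[OF face_sub_P'[OF DA(1)]] DA(1) by blast
      then show ?thesis using B by blast
    qed (use xQ in blast)
  qed
next
  fix x assume "x \<in> (real_of Q - real_of (face ` DA)) \<union> real_of (face ` DB)"
  then show "x \<in> real_of Q'"
  proof
    assume x: "x \<in> real_of Q - real_of (face ` DA)"
    then have "{v. x v \<noteq> 0} \<subseteq> Q - covered"
      using covered_chain[of x] real_of_sub[OF QP'(1), of x] by blast
    then show ?thesis using x real_of_sub[OF QP'(1)] real_of_sub[OF Q'_sub] by (auto simp: Q'_def)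
  next
    assume "x \<in> real_of (face ` DB)"
    moreover have "face ` DB \<subseteq> Q'" using face_Q' by blast
    ultimately show ?thesis using real_of_mono[OF _ Q'_sub] by blast
  qed
qed

text \<open>The foot of a point in the attaching region. Its companion \<open>room\<close> is the
  length of the fibre, continued by 0 over the rest of the sphere.\<close>

definition push :: "(nat \<Rightarrow> real) \<Rightarrow> nat \<Rightarrow> real" where "push x = T.point (flat (bary x))"

definition room :: "(nat \<Rightarrow> real) \<Rightarrow> real" where
  "room x = (if x \<in> real_of (face ` DA) then height (bary x) else 0)"

lemma part_zero_sub: "part_zero V X \<subseteq> std_simplex V" by (auto simp: part_zero_def)

lemma flat_in: "x \<in> cell \<Longrightarrow> flat (bary x) \<in> part_zero V X"
  using flat_simplex bary_simplex by blast

lemma push_in: "x \<in> cell \<Longrightarrow> push x \<in> real_of (face ` DA) \<and> bary (push x) = flat (bary x)"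
  using flat_in[of x] point_cell[of "flat (bary x)"] part_zero_sub
  by (auto simp: push_def attach_set)

text \<open>The sphere is the union of two closed subcomplexes, the attaching region and the
  uncovered faces. A face in both belongs to \<open>DB\<close>, where the height is 0, so the two
  formulas agree on the overlap.\<close>

lemma room_continuous: "continuous_on (real_of Q) room"
proof -
  have cp: "closed (real_of D)" if "D \<subseteq> P'" for D
    using compact_realization_set[OF finite_subset[OF that finite_P']] compact_imp_closed by blast
  have QcP: "Q - covered \<subseteq> P'" using QP' by blast
  have eq: "real_of Q = real_of (face ` DA) \<union> real_of (Q - covered)"
  proof (intro set_eqI iffI)
    fix x assume x: "x \<in> real_of Q"
    show "x \<in> real_of (face ` DA) \<union> real_of (Q - covered)"
    proof (cases "\<exists>p. x p \<noteq> 0 \<and> p \<in> covered")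
      case True then show ?thesis using covered_chain[OF x] by blast
    next
      case False then show ?thesis using x real_of_sub[OF QP'(1)] real_of_sub[OF QcP] by blast
    qed
  next
    fix x assume "x \<in> real_of (face ` DA) \<union> real_of (Q - covered)"
    moreover have "face ` DA \<subseteq> Q" unfolding face_DA using e_in by (auto simp: DA_def)
    ultimately show "x \<in> real_of Q"
      using real_of_sub[OF QP'(1)] real_of_sub[OF QcP] real_of_sub[OF face_sub_P'[OF DA(1)]] by blast
  qed
  show ?thesis unfolding eq room_def
  proof (rule continuous_on_cases)
    show "closed (real_of (face ` DA))" "closed (real_of (Q - covered))"
      using cp face_sub_P'[OF DA(1)] QcP by auto
    show "continuous_on (real_of (face ` DA)) (\<lambda>x. height (bary x))"
      by (rule continuous_on_compose2[OF continuous_on_height[of UNIV] T.barycentric_cont]) auto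
    have "height (bary x) = 0" if x: "x \<in> real_of (Q - covered)" "x \<in> real_of (face ` DA)" for x
    proof -
      have "{v. x v \<noteq> 0} \<subseteq> (Q - covered) \<inter> face ` DA"
        using that real_of_sub[OF QcP] real_of_sub[OF face_sub_P'[OF DA(1)]] by blast
      moreover have "(Q - covered) \<inter> face ` DA \<subseteq> face ` Pow V \<inter> Q'"
        using DA(1) by (auto simp: Q'_def)
      ultimately have "{v. x v \<noteq> 0} \<subseteq> face ` DB" using face_Q' by blast
      then have "x \<in> real_of (face ` DB)"
        using real_of_transfer[OF that(2)] face_sub_P' DA(1) DB(1) by blast
      then show ?thesis by (simp add: free_set)
    qed
    then show "\<forall>x. x \<in> real_of (face ` DA) \<and> x \<notin> real_of (face ` DA) \<or>
         x \<in> real_of (Q - covered) \<and> x \<in> real_of (face ` DA) \<longrightarrow> height (bary x) = 0" by blast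
  qed auto
qed

lemma ball_P': "ball_pair m (real_of P') (real_of Q')"
proof -
  have "ball_pair m (real_of P \<union> cell) ((real_of Q - real_of (face ` DA)) \<union>
      {p \<in> cell. depth (bary p) = room (push p)})"
  proof (rule ball_pair_attach[where a = push and t = "\<lambda>p. depth (bary p)" and \<phi> = room])
    show "ball_pair m (real_of P) (real_of Q)" using ball real_of_P QP by simp
    show "compact cell" using T.compact_cell by (simp add: face_empty)
    show "real_of P \<inter> cell = real_of (face ` DA)" by (rule attach_inter)
    have "face ` DA \<subseteq> Q" unfolding face_DA using e_in by (auto simp: DA_def)
    then show "real_of (face ` DA) \<subseteq> real_of Q"
      using real_of_sub[OF QP'(1)] real_of_sub[OF face_sub_P'[OF DA(1)]] by blast
    have "continuous_on cell (\<lambda>x. flat (bary x))"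
      by (rule continuous_on_compose2[OF continuous_on_flat[of UNIV] T.barycentric_cont]) auto
    then show "continuous_on cell push"
      unfolding push_def
      by (rule continuous_on_compose2[OF T.continuous_on_point]) (use flat_in part_zero_sub in blast)
    show "push p \<in> real_of (face ` DA)" if "p \<in> cell" for p using push_in[OF that] by blast
    show "continuous_on cell (\<lambda>p. depth (bary p))"
      by (rule continuous_on_compose2[OF continuous_on_depth[of UNIV] T.barycentric_cont]) auto
    show "0 \<le> depth (bary p) \<and> depth (bary p) \<le> room (push p)" if "p \<in> cell" for p
      using depth_nonneg height_nonneg bary_simplex[OF that] push_in[OF that]
      by (simp add: room_def height_flat)
    show "push p = p \<and> depth (bary p) = 0" if "p \<in> real_of (face ` DA)" for p
      using that flat_id[of "bary p"] point_bary[of p] by (simp add: attach_set push_def)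
    show "p = q" if "p \<in> cell" "q \<in> cell" "push p = push q" "depth (bary p) = depth (bary q)" for p q
    proof -
      have "flat (bary p) = flat (bary q)" using push_in that(1,2,3) by metis
      then have "bary p = bary q" using flat_inj bary_simplex that by blast
      then show ?thesis using point_bary that(1,2) by metis
    qed
    show "\<exists>p\<in>cell. push p = s \<and> depth (bary p) = r"
      if s: "s \<in> real_of (face ` DA)" and r: "0 \<le> r" "r \<le> room s" for s r
    proof -
      have "bary s \<in> part_zero V X" "s \<in> cell" "r \<le> height (bary s)"
        using s r by (auto simp: attach_set room_def)
      then obtain l where "l \<in> std_simplex V" "flat l = bary s" "depth l = r"
        using flat_surj r by blast
      then show ?thesis using point_cell[of l] point_bary[OF \<open>s \<in> cell\<close>]
        by (intro bexI[of _ "T.point l"]) (auto simp: push_def)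
    qed
    show "continuous_on (real_of Q) room" by (rule room_continuous)
    show "0 \<le> room s" for s
      using height_nonneg bary_simplex by (simp add: room_def attach_set)
    show "room s = 0" if "s \<in> real_of Q - real_of (face ` DA)" for s
      using that by (simp add: room_def)
  qed
  \<comment> \<open>By \<open>height_flat\<close> a fibre is exhausted exactly where
    \<open>height\<close> is 0.\<close>
  moreover have "{p \<in> cell. depth (bary p) = room (push p)} = real_of (face ` DB)"
    using push_in free_set by (auto simp: room_def height_flat)
  ultimately show ?thesis by (simp add: real_of_P' real_of_Q')
qed

text \<open>The roles of \<open>X\<close> and its complement are exchanged: now \<tau> is the new
  face \<open>X\<close>. Old elements never lie above new ones, so its star consists of faces of the
  new simplex.\<close>

lemma spot_new: "spot V P' le' Q' (V - X) face"
  unfolding spot_def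
proof (intro conjI allI impI ballI)
  show "face S \<in> Q'" if "S \<subseteq> V" "\<not> V - X \<subseteq> S" for S using face_in_Q' that by blast
  show "le' (face S) (face S') \<longleftrightarrow> S \<subseteq> S'" if "S \<subseteq> V" "S' \<subseteq> V" for S S' using face_le that by blast
  show "\<exists>S'\<subseteq>S. p = face S'" if "S \<subseteq> V" "le' p (face S)" for S p using face_down that by blast
  fix q assume q: "q \<in> Q'" "le' (face (V - (V - X))) q"
  have "V - (V - X) = X" using X by blast
  then have "le' (new X) q" using q by (simp add: face_def)
  then have "q \<notin> P" using le'_P new_notin by blast
  then obtain S where "S \<subseteq> V" "q = face S" using P'_cases q Q'_sub by blast
  then show "\<exists>S\<subseteq>V. \<not> V - X \<subseteq> S \<and> q = face S" using q face_in_Q' by blast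
qed

end

section \<open>Attainable type vectors\<close>

text \<open>\<open>g j\<close> is the number of simplices of type \<open>j\<close>; each of them contributes an interval of faces that is
  Boolean of rank \<open>d - j\<close> and starts in rank \<open>j\<close>.\<close>
definition shelled :: "nat \<Rightarrow> (nat \<Rightarrow> nat) \<Rightarrow> nat set \<Rightarrow> (nat \<Rightarrow> nat \<Rightarrow> bool) \<Rightarrow> nat set \<Rightarrow> bool" where
  "shelled d g P le Q \<longleftrightarrow> simplicial_poset P le 0 \<and> Q \<subseteq> P \<and>
     ball_pair (d - 1) (realization_set P le 0) (realization_set Q le 0) \<and>
     (\<forall>r. fvec P le 0 r = (\<Sum>j\<le>d. g j * (if j \<le> r then (d - j) choose (r - j) else 0)))"

text \<open>Only the type counts and the size \<open>c\<close> of one available spot are remembered;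
  which colours the spot uses is irrelevant for the counting.\<close>

definition reach :: "nat \<Rightarrow> (nat \<Rightarrow> nat) \<Rightarrow> nat \<Rightarrow> bool" where
  "reach d g c \<longleftrightarrow> (\<exists>P le Q F e. shelled d g P le Q \<and> F \<subseteq> {..<d} \<and> card F = c \<and>
     spot {..<d} P le Q F e)"

lemma (in flip) shelled_P':
  assumes "shelled d g P le Q" "V = {..<d}" "m = d - 1"
  shows "shelled d (g(card X := g (card X) + 1)) P' le' Q'"
proof -
  have j: "card X \<le> d" using card_mono[OF finV X(1)] assms(2) by simp
  let ?b = "\<lambda>r j. if j \<le> r then (d - j) choose (r - j) else 0"
  have "(\<Sum>j\<le>d. (g(card X := g (card X) + 1)) j * ?b r j) = (\<Sum>j\<le>d. g j * ?b r j) + ?b r (card X)" for r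
  proof -
    have "(\<Sum>j\<le>d. (g(card X := g (card X) + 1)) j * ?b r j) =
        (\<Sum>j\<le>d. g j * ?b r j + (if j = card X then ?b r (card X) else 0))"
      by (intro sum.cong) auto
    then show ?thesis using j by (simp add: sum.distrib)
  qed
  then show ?thesis
    using assms simplicial_P' Q'_sub ball_P' fvec_P' by (simp add: shelled_def)
qed

lemma shelled_flip:
  assumes sh: "shelled d g P le Q" and s: "spot {..<d} P le Q F e" and F: "F \<subseteq> {..<d}"
    and X: "X \<subseteq> F" "X \<noteq> {}" "X \<noteq> {..<d}"
  shows "flip (d - 1) {..<d} P le Q X e"
proof -
  have "finite_poset P le" "Q \<subseteq> P" using sh by (auto simp: shelled_def simplicial_poset_def)
  then have "spot {..<d} P le Q X e" using spot_mono[OF s X(1,2) F] by blast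
  then show ?thesis using sh F X by unfold_locales (auto simp: shelled_def)
qed

lemma flip_shelled:
  assumes "shelled d g P le Q" "flip (d - 1) {..<d} P le Q X e" "card X = j"
  shows "shelled d (g(j := g j + 1)) (flip.P' {..<d} P X) (flip.le' {..<d} P le X e) (flip.Q' {..<d} P Q X e)"
    "spot {..<d} (flip.P' {..<d} P X) (flip.le' {..<d} P le X e) (flip.Q' {..<d} P Q X e)
      ({..<d} - X) (flip.face P X e)"
proof -
  interpret flip "d - 1" "{..<d}" P le Q X e by (rule assms(2))
  show "shelled d (g(j := g j + 1)) P' le' Q'" using shelled_P' assms by blast
  show "spot {..<d} P' le' Q' ({..<d} - X) face" by (rule spot_new)
qed

lemma reach_mono:
  assumes "reach d g c" "1 \<le> c'" "c' \<le> c"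
  shows "reach d g c'"
proof -
  obtain P le Q F e where s: "shelled d g P le Q" "F \<subseteq> {..<d}" "card F = c" "spot {..<d} P le Q F e"
    using assms(1) by (auto simp: reach_def)
  obtain X where X: "X \<subseteq> F" "card X = c'"
    using obtain_subset_with_card_n[of c' F] s(3) assms(3) by blast
  have "X \<noteq> {}" using X assms by auto
  moreover have "finite_poset P le" "Q \<subseteq> P" using s(1) by (auto simp: shelled_def simplicial_poset_def)
  ultimately have "spot {..<d} P le Q X e" using spot_mono[OF s(4) X(1) _ s(2)] by blast
  then show ?thesis using s X unfolding reach_def by blast
qed

lemma reach_flip:
  assumes "reach d g c" "1 \<le> j" "j \<le> c" "j < d"
  shows "reach d (g(j := g j + 1)) (d - j)"
proof -
  obtain P le Q F e where s: "shelled d g P le Q" "F \<subseteq> {..<d}" "card F = c" "spot {..<d} P le Q F e"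
    using assms(1) by (auto simp: reach_def)
  obtain X where X: "X \<subseteq> F" "card X = j"
    using obtain_subset_with_card_n[of j F] s(3) assms(3) by blast
  have "X \<noteq> {}" "X \<noteq> {..<d}" using X assms by auto
  then have fl: "flip (d - 1) {..<d} P le Q X e" using shelled_flip s X by blast
  have "card ({..<d} - X) = d - j"
    using X s(2) by (subst card_Diff_subset) (auto intro: finite_subset)
  then show ?thesis using flip_shelled[OF s(1) fl X(2)] unfolding reach_def by blast
qed

text \<open>Two flips inside a spot \<open>F\<close> that replace its star by an isomorphic one: of the faces of
  the old spot the ones containing \<open>X1\<close> stay where they were.\<close>
lemma spot_two_flips:
  fixes V :: "nat set"
  assumes s: "spot V P le Q F e" and F: "F \<subseteq> V"
    and f1: "flip m V P le Q X1 e"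
    and f2: "flip m V (flip.P' V P X1) (flip.le' V P le X1 e) (flip.Q' V P Q X1 e) X2 (flip.face P X1 e)"
    and X1: "X1 \<subset> F" and X2: "F - X1 \<subseteq> X2" "X2 \<subseteq> V - X1"
  shows "\<exists>e'. spot V (flip.P' V (flip.P' V P X1) X2)
     (flip.le' V (flip.P' V P X1) (flip.le' V P le X1 e) X2 (flip.face P X1 e))
     (flip.Q' V (flip.P' V P X1) (flip.Q' V P Q X1 e) X2 (flip.face P X1 e)) F e'"
proof -
  interpret one: flip m V P le Q X1 e by (rule f1)
  interpret two: flip m V one.P' one.le' one.Q' X2 one.face by (rule f2)
  note s' = s[unfolded spot_def]
  have e1: "\<And>S. S \<subseteq> V \<Longrightarrow> \<not> F \<subseteq> S \<Longrightarrow> e S \<in> Q" using s' by simp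
  have e2: "\<And>S S'. S \<subseteq> V \<Longrightarrow> S' \<subseteq> V \<Longrightarrow> \<not> F \<subseteq> S \<Longrightarrow> \<not> F \<subseteq> S' \<Longrightarrow> le (e S) (e S') \<longleftrightarrow> S \<subseteq> S'"
    using s' by simp
  have e3: "\<And>S p. S \<subseteq> V \<Longrightarrow> \<not> F \<subseteq> S \<Longrightarrow> p \<in> P \<Longrightarrow> le p (e S) \<Longrightarrow> \<exists>S'\<subseteq>S. p = e S'"
    using s' by simp
  have e4: "\<And>q. q \<in> Q \<Longrightarrow> le (e (V - F)) q \<Longrightarrow> \<exists>S\<subseteq>V. \<not> F \<subseteq> S \<and> q = e S"
    using s' by simp
  have einj: "S = S'" if "S \<subseteq> V" "S' \<subseteq> V" "\<not> F \<subseteq> S" "\<not> F \<subseteq> S'" "e S = e S'" for S S'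
    using that e2 by (metis subset_antisym subset_refl)
  have eP: "e S \<in> P" if "S \<subseteq> V" "\<not> F \<subseteq> S" for S using e1 that one.QP by blast
  have PP: "P \<subseteq> one.P'" by (rule one.QP'(2))
  have le2: "two.le' p q \<longleftrightarrow> p \<in> P \<and> le p q" if "q \<in> P" for p q
    using that PP two.le'_P one.le'_P by blast
  \<comment> \<open>The sets \<open>X1\<close> and \<open>X2\<close> cover \<open>F\<close>, so a
    face of the spot contains at most one of them.\<close>
  have both: "F \<subseteq> S" if "X1 \<subseteq> S" "X2 \<subseteq> S" for S using that X2 by blast
  have tP: "two.face S \<in> P \<longleftrightarrow> \<not> X1 \<subseteq> S \<and> \<not> X2 \<subseteq> S" if "S \<subseteq> V" for S
    using two.face_in_P[OF that] one.face_in_P[OF that] PP by (auto simp: two.face_def)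
  have te: "two.face S = e S" if "\<not> X1 \<subseteq> S" "\<not> X2 \<subseteq> S" for S
    using that by (simp add: two.face_def one.face_def)
  have X12: "X1 \<subseteq> V - X2" using X2 X1 F by blast
  have VF: "V - F \<subseteq> V" "\<not> F \<subseteq> V - F" "\<not> X1 \<subseteq> V - F" "\<not> X2 \<subseteq> V - F"
    using X1 X2 F one.X by blast+
  \<comment> \<open>This differs from \<open>e\<close> only on sets that contain \<open>X2\<close>
    but not \<open>X1\<close>, where it takes the new faces of the second simplex. Within the star
    of \<tau> = V - F these sets are the ones covered by the first attachment.\<close>
  define e' where "e' = (\<lambda>S. if X1 \<subseteq> S then e S else two.face S)"
  have "spot V two.P' two.le' two.Q' F e'"
    unfolding spot_def
  proof (intro conjI allI impI ballI)
    fix S assume S: "S \<subseteq> V" "\<not> F \<subseteq> S"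
    show "e' S \<in> two.Q'"
    proof (cases "X1 \<subseteq> S")
      case True
      have "e S \<notin> one.covered"
      proof
        assume "e S \<in> one.covered"
        then obtain S0 where S0: "S0 \<subseteq> V" "\<not> X1 \<subseteq> S0" "e S = e S0" by (auto simp: one.covered_def)
        then have "\<not> F \<subseteq> S0" using X1 by blast
        then show False using einj S S0 True by blast
      qed
      then have q: "e S \<in> one.Q'" using e1 S by (simp add: one.Q'_def)
      have "e S \<notin> two.covered"
      proof
        assume "e S \<in> two.covered"
        then obtain S0 where S0: "S0 \<subseteq> V" "V - X2 \<subseteq> S0" "e S = one.face S0"
          by (auto simp: two.covered_def)
        then have "one.face S0 \<notin> P" using X12 one.face_in_P by blast
        then show False using eP[OF S] S0(3) by simp
      qed
      then show ?thesis using True q by (simp add: e'_def two.Q'_def)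
    next
      case False
      then have "\<not> V - X2 \<subseteq> S" using X12 by blast
      then show ?thesis using False two.face_in_Q' S by (simp add: e'_def)
    qed
  next
    fix S S' assume S: "S \<subseteq> V" "S' \<subseteq> V" "\<not> F \<subseteq> S" "\<not> F \<subseteq> S'"
    show "two.le' (e' S) (e' S') \<longleftrightarrow> S \<subseteq> S'"
    proof (cases "X1 \<subseteq> S'")
      case True
      then have *: "two.le' (e' S) (e' S') \<longleftrightarrow> e' S \<in> P \<and> le (e' S) (e S')"
        using le2 eP S by (simp add: e'_def)
      show ?thesis
      proof (cases "X1 \<subseteq> S")
        case True
        then show ?thesis unfolding * using eP e2 S by (simp add: e'_def)
      next
        case nS: False
        show ?thesis
        proof (cases "X2 \<subseteq> S")
          case True
          then have "e' S \<notin> P" using tP S nS by (simp add: e'_def)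
          moreover have "\<not> S \<subseteq> S'" using True \<open>X1 \<subseteq> S'\<close> both S by blast
          ultimately show ?thesis unfolding * by blast
        next
          case False
          then have "e' S = e S" using te nS by (simp add: e'_def)
          then show ?thesis unfolding * using eP e2 S by simp
        qed
      qed
    next
      case nS': False
      then have e'S': "e' S' = two.face S'" by (simp add: e'_def)
      show ?thesis
      proof (cases "X1 \<subseteq> S")
        case False
        then show ?thesis using e'S' two.face_le S by (simp add: e'_def)
      next
        case True
        have "\<not> two.le' (e S) (two.face S')"
        proof
          assume "two.le' (e S) (two.face S')"
          then obtain S1 where S1: "S1 \<subseteq> S'" "e S = two.face S1" using two.face_down S by blast
          then have "two.face S1 \<in> P" using eP S by metis
          moreover have "S1 \<subseteq> V" using S1 S by blast
          ultimately have n: "\<not> X1 \<subseteq> S1" "\<not> X2 \<subseteq> S1" using tP by blast+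
          then have "e S = e S1" using te S1 by simp
          then have "S = S1" using einj S S1 by blast
          then show False using n True by blast
        qed
        then show ?thesis using True e'S' nS' by (auto simp: e'_def)
      qed
    qed
  next
    fix S p assume S: "S \<subseteq> V" "\<not> F \<subseteq> S" and p: "p \<in> two.P'" "two.le' p (e' S)"
    show "\<exists>S'\<subseteq>S. p = e' S'"
    proof (cases "X1 \<subseteq> S")
      case True
      then have "p \<in> P" "le p (e S)" using p le2 eP S by (auto simp: e'_def)
      then obtain S' where S': "S' \<subseteq> S" "p = e S'" using e3 S by blast
      have "X1 \<subseteq> S' \<or> \<not> X2 \<subseteq> S'" using both True S S' by blast
      then have "p = e' S'" using te[of S'] S'(2) by (cases "X1 \<subseteq> S'") (simp_all add: e'_def)
      then show ?thesis using S' by blast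
    next
      case False
      then obtain S' where S': "S' \<subseteq> S" "p = two.face S'"
        using p two.face_down S by (auto simp: e'_def)
      then have "p = e' S'" using False by (auto simp: e'_def)
      then show ?thesis using S' by blast
    qed
  next
    fix q assume q: "q \<in> two.Q'" "two.le' (e' (V - F)) q"
    have e'VF: "e' (V - F) = two.face (V - F)" "two.face (V - F) = e (V - F)"
        "one.face (V - F) = e (V - F)"
      using te VF by (auto simp: e'_def one.face_def)
    \<comment> \<open>The face \<open>q\<close> comes from the old ball, the first simplex or the
      second one. The middle case is contradictory: a new face of the first simplex above \<tau>
      that was on the boundary is covered by the second attachment.\<close>
    consider "q \<in> P" | S where "q \<in> one.P'" "q \<notin> P" "S \<subseteq> V" "X1 \<subseteq> S" "q = one.face S"
      | S where "q \<notin> one.P'" "S \<subseteq> V" "X2 \<subseteq> S" "q = two.face S"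
      using two.P'_cases[of q] one.P'_cases[of q] two.Q'_sub q(1) by blast
    then show "\<exists>S\<subseteq>V. \<not> F \<subseteq> S \<and> q = e' S"
    proof cases
      case 1
      then have lq: "le (e (V - F)) q" using q e'VF le2 by simp
      have q1: "q \<in> one.Q'" using q(1) 1 PP two.new_notin by (auto simp: two.Q'_def)
      then have q2: "q \<in> Q" "q \<notin> one.covered" using 1 one.new_notin by (auto simp: one.Q'_def)
      then obtain S where S: "S \<subseteq> V" "\<not> F \<subseteq> S" "q = e S" using e4 lq by blast
      then have VS: "V - F \<subseteq> S" using e2 VF lq by simp
      show ?thesis
      proof (cases "X1 \<subseteq> S")
        case True then show ?thesis using S by (auto simp: e'_def)
      next
        case False
        have "\<not> X2 \<subseteq> S"
        proof
          assume "X2 \<subseteq> S"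
          then have "V - X1 \<subseteq> S" using VS X2 by blast
          then have "q \<in> one.covered" using False S by (auto simp: one.covered_def)
          then show False using q2 by blast
        qed
        then have "q = e' S" using False S te by (simp add: e'_def)
        then show ?thesis using S by blast
      qed
    next
      case 2
      have "one.le' (one.face (V - F)) (one.face S)" using q(2) 2 e'VF two.le'_P by simp
      then have VS: "V - F \<subseteq> S" using one.face_le VF 2 by blast
      have "q \<in> one.Q'" "q \<notin> two.covered" using q(1) 2(1) two.new_notin by (auto simp: two.Q'_def)
      then have nV: "\<not> V - X1 \<subseteq> S" using one.face_in_Q' 2 by blast
      have "V - X2 \<subseteq> S" using VS X2 2 by blast
      moreover have "\<not> X2 \<subseteq> S" using nV VS X2 by blast
      ultimately have "q \<in> two.covered" using 2 by (auto simp: two.covered_def)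
      then show ?thesis using \<open>q \<notin> two.covered\<close> by blast
    next
      case 3
      have "two.le' (two.face (V - F)) (two.face S)" using q(2) 3(4) e'VF(1) by simp
      then have VS: "V - F \<subseteq> S" using two.face_le VF(1) 3(2) by blast
      have nV: "\<not> V - X2 \<subseteq> S" using q(1) two.face_in_Q' 3 by blast
      then have "\<not> X1 \<subseteq> S" "\<not> F \<subseteq> S" using VS 3 X2 by blast+
      then show ?thesis using 3 by (auto simp: e'_def)
    qed
  qed
  then show ?thesis by blast
qed

text \<open>The second set has to contain the \<open>c - i\<close> elements of \<open>F - X1\<close>
  and to fit into the \<open>d - i\<close> colours outside \<open>X1\<close>; this is the origin of
  \<open>c \<le> i + j\<close> and \<open>i + j \<le> d\<close>.\<close>

lemma reach_two_flips:
  assumes "reach d g c" "1 \<le> i" "i < c" "c \<le> i + j" "i + j \<le> d"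
  shows "reach d (g(i := g i + 1, j := (g(i := g i + 1)) j + 1)) c"
proof -
  obtain P le Q F e where s: "shelled d g P le Q" "F \<subseteq> {..<d}" "card F = c" "spot {..<d} P le Q F e"
    using assms(1) by (auto simp: reach_def)
  have fF: "finite F" using s(2) finite_subset by blast
  obtain X1 where X1: "X1 \<subseteq> F" "card X1 = i"
    using obtain_subset_with_card_n[of i F] s(3) assms(3) by auto
  have fX1: "finite X1" using X1(1) fF finite_subset by blast
  have "card (F - X1) = c - i" "card ({..<d} - X1) = d - i"
    using X1 s(2,3) fX1 by (subst card_Diff_subset; auto)+
  then obtain X2 where X2: "F - X1 \<subseteq> X2" "X2 \<subseteq> {..<d} - X1" "card X2 = j"
  proof -
    assume that: "\<And>X2. F - X1 \<subseteq> X2 \<Longrightarrow> X2 \<subseteq> {..<d} - X1 \<Longrightarrow> card X2 = j \<Longrightarrow> thesis"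
    have "card (F - X1) \<le> j" "j \<le> card ({..<d} - X1)"
      using \<open>card (F - X1) = c - i\<close> \<open>card ({..<d} - X1) = d - i\<close> assms by linarith+
    moreover have "F - X1 \<subseteq> {..<d} - X1" using s(2) by blast
    ultimately show thesis using exists_subset_between[of "F - X1" j "{..<d} - X1"] that by blast
  qed
  have ne: "X1 \<noteq> {}" "X1 \<noteq> {..<d}" "X1 \<subset> F" using X1 assms s by auto
  have "c - i \<le> j" "c - i > 0" using assms by auto
  then have ne2: "X2 \<noteq> {}" "X2 \<noteq> {..<d}" using X2 ne(1) X1 s(2) by auto
  note f1 = shelled_flip[OF s(1,4,2) X1(1) ne(1,2)]
  note sh1 = flip_shelled[OF s(1) f1 X1(2)]
  note f2 = shelled_flip[OF sh1 Diff_subset X2(2) ne2]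
  note sh2 = flip_shelled[OF sh1(1) f2 X2(3)]
  show ?thesis
    using spot_two_flips[OF s(4,2) f1 f2 ne(3) X2(1,2)] sh2(1) s(2,3) unfolding reach_def by blast
qed

section \<open>Starting configurations\<close>

definition enc_le :: "nat \<Rightarrow> nat \<Rightarrow> bool" where
  "enc_le p q \<longleftrightarrow> set_decode p \<subseteq> set_decode q"

lemma simplex_faces_enc: "finite V \<Longrightarrow> simplex_faces V set_encode enc_le"
  by unfold_locales (auto simp: enc_le_def finite_subset set_encode_inverse)

lemma complex_simplicial:
  assumes W: "finite W" and K: "K \<subseteq> Pow W" "{} \<in> K" "\<And>S S'. S \<in> K \<Longrightarrow> S' \<subseteq> S \<Longrightarrow> S' \<in> K"
  shows "simplicial_poset (set_encode ` K) enc_le 0"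
    and "fvec (set_encode ` K) enc_le 0 r = card {S \<in> K. card S = r}"
proof -
  have fin: "finite S" if "S \<in> K" for S using that K(1) W finite_subset by blast
  have fK: "finite K" using K(1) W finite_subset by blast
  have dec: "set_decode (set_encode S) = S" if "S \<in> K" for S
    using fin[OF that] by (simp add: set_encode_inverse)
  have le: "enc_le (set_encode S) (set_encode S') \<longleftrightarrow> S \<subseteq> S'" if "S \<in> K" "S' \<in> K" for S S'
    using that dec by (simp add: enc_le_def)
  have z: "0 = set_encode {}" by simp
  have bool: "boolean_of_rank (set_encode ` K) enc_le 0 (set_encode S) (card S)" if S: "S \<in> K" for S
  proof (rule boolean_of_rank_simplex)
    show "finite S" using fin S by blast
    show "enc_le (set_encode A) (set_encode B) \<longleftrightarrow> A \<subseteq> B" if "A \<subseteq> S" "B \<subseteq> S" for A B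
      using le K(3) S that by blast
    have "q \<in> interval (set_encode ` K) enc_le 0 (set_encode S) \<longleftrightarrow> q \<in> set_encode ` Pow S" for q
    proof
      assume "q \<in> interval (set_encode ` K) enc_le 0 (set_encode S)"
      then obtain A where "A \<in> K" "q = set_encode A" "enc_le q (set_encode S)"
        by (auto simp: interval_def)
      then show "q \<in> set_encode ` Pow S" using le S by blast
    next
      assume "q \<in> set_encode ` Pow S"
      then obtain A where A: "A \<subseteq> S" "q = set_encode A" by blast
      then have "A \<in> K" using K(3) S by blast
      then show "q \<in> interval (set_encode ` K) enc_le 0 (set_encode S)"
        unfolding interval_def z using A le S K(2) by blast
    qed
    then show "interval (set_encode ` K) enc_le 0 (set_encode S) = set_encode ` Pow S" by blast
  qed
  show "simplicial_poset (set_encode ` K) enc_le 0"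
    unfolding simplicial_poset_def
  proof (intro conjI)
    show "finite_poset (set_encode ` K) enc_le"
      unfolding finite_poset_def
    proof (intro conjI)
      show "\<forall>x\<in>set_encode ` K. \<forall>y\<in>set_encode ` K. enc_le x y \<and> enc_le y x \<longrightarrow> x = y"
        using dec by (auto simp: enc_le_def)
    qed (use fK in \<open>auto simp: enc_le_def\<close>)
    show "is_min_elem (set_encode ` K) enc_le 0"
      unfolding is_min_elem_def using K(2) z by (auto simp: enc_le_def image_iff intro!: bexI[of _ "{}"])
  qed (use bool in blast)
  have "boolean_of_rank (set_encode ` K) enc_le 0 (set_encode S) r \<longleftrightarrow> card S = r" if "S \<in> K" for S
    using bool[OF that] boolean_of_rank_unique[OF bool[OF that], of r] by auto
  then have "{p \<in> set_encode ` K. boolean_of_rank (set_encode ` K) enc_le 0 p r} = set_encode ` {S \<in> K. card S = r}"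
    by auto
  moreover have "inj_on set_encode {S \<in> K. card S = r}"
    using dec by (intro inj_onI) (metis (mono_tags, lifting) mem_Collect_eq)
  ultimately show "fvec (set_encode ` K) enc_le 0 r = card {S \<in> K. card S = r}"
    by (simp add: fvec_def card_image)
qed

text \<open>By \<open>subcomplex_iff\<close> it is enough to exhibit the ball in coordinates on the
  standard simplex.\<close>

lemma complex_ball:
  assumes W: "finite W" and K: "K \<subseteq> Pow W" "{} \<in> K" "\<And>S S'. S \<in> K \<Longrightarrow> S' \<subseteq> S \<Longrightarrow> S' \<in> K"
    and L: "L \<subseteq> K" "{} \<in> L" "\<And>S S'. S \<in> L \<Longrightarrow> S' \<subseteq> S \<Longrightarrow> S' \<in> L"
    and b: "ball_pair m {l \<in> std_simplex W. support l \<in> K} {l \<in> std_simplex W. support l \<in> L}"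
  shows "ball_pair m (realization_set (set_encode ` K) enc_le 0) (realization_set (set_encode ` L) enc_le 0)"
proof -
  interpret simplex_faces W set_encode enc_le by (rule simplex_faces_enc[OF W])
  have LW: "L \<subseteq> Pow W" using K L by blast
  let ?R = "\<lambda>K. realization_set (set_encode ` K) enc_le 0"
  have rK: "x \<in> ?R K \<longleftrightarrow> x \<in> cell \<and> support (barycentric W set_encode x) \<in> K" for x
    using subcomplex_iff[OF K, where x = x] by simp
  have rL: "x \<in> ?R L \<longleftrightarrow> x \<in> cell \<and> support (barycentric W set_encode x) \<in> L" for x
    using subcomplex_iff[OF LW L(2,3), where x = x] by simp
  have im: "barycentric W set_encode ` {x \<in> cell. support (barycentric W set_encode x) \<in> M} =
     {l \<in> std_simplex W. support l \<in> M}" for M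
    using barycentric_surj barycentric_in by fastforce
  show ?thesis
  proof (rule ball_pair_transport[OF b _ _ barycentric_cont])
    show "compact (?R K)"
      using K(1) W by (intro compact_realization_set finite_imageI) (auto intro: finite_subset)
    show "?R L \<subseteq> ?R K" using rK rL L(1) by blast
    have "inj_on (barycentric W set_encode) (?R K)"
      using rK by (intro inj_on_subset[OF barycentric_inj]) blast
    moreover have "?R K = {x \<in> cell. support (barycentric W set_encode x) \<in> K}" using rK by blast
    ultimately show "bij_betw (barycentric W set_encode) (?R K) {l \<in> std_simplex W. support l \<in> K}"
      using im by (simp add: bij_betw_def)
    have "?R L = {x \<in> cell. support (barycentric W set_encode x) \<in> L}" using rL by blast
    then show "barycentric W set_encode ` ?R L = {l \<in> std_simplex W. support l \<in> L}"
      using im by simp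
  qed
qed

text \<open>Here \<tau> is empty: the spot is the whole boundary of a simplex.\<close>

lemma boundary_spot:
  assumes W: "finite W" and V: "V \<subseteq> W"
  shows "spot V (set_encode ` K) enc_le (set_encode ` {S. S \<subset> V}) V set_encode"
proof -
  have f: "finite S" if "S \<subseteq> V" for S using that W V by (meson finite_subset)
  have d: "set_decode (set_encode S) = S" if "S \<subseteq> V" for S using f[OF that] by (simp add: set_encode_inverse)
  have "\<exists>S'\<subseteq>S. p = set_encode S'" if "S \<subseteq> V" "enc_le p (set_encode S)" for S p
    using that d by (intro exI[of _ "set_decode p"]) (simp add: enc_le_def set_decode_inverse)
  moreover have "set_encode S \<in> set_encode ` {S. S \<subset> V}" if "S \<subseteq> V" "\<not> V \<subseteq> S" for S
    using that by blast
  moreover have "enc_le (set_encode S) (set_encode S') \<longleftrightarrow> S \<subseteq> S'" if "S \<subseteq> V" "S' \<subseteq> V" for S S'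
    using that d by (simp add: enc_le_def)
  moreover have "\<exists>S\<subseteq>V. \<not> V \<subseteq> S \<and> q = set_encode S" if "q \<in> set_encode ` {S. S \<subset> V}" for q
    using that by blast
  ultimately show ?thesis unfolding spot_def by simp
qed

lemma reach_simplex:
  assumes d: "d \<ge> 1"
  shows "reach d (\<lambda>j. if j = 0 then 1 else 0) d"
proof -
  let ?V = "{..<d}" and ?L = "{S. S \<subset> {..<d}}"
  have "0 \<in> ?V" using d by simp
  then have V0: "{} \<subset> ?V" by blast
  have 1: "{l \<in> std_simplex ?V. support l \<in> Pow ?V} = std_simplex ?V"
    by (auto simp: std_simplex_def)
  have 2: "{l \<in> std_simplex ?V. support l \<in> ?L} = face_bdry ?V"
  proof -
    have "support l \<subset> ?V \<longleftrightarrow> (\<exists>v\<in>?V. l v = 0)" if "l \<in> std_simplex ?V" for l :: "nat \<Rightarrow> real"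
    proof -
      have "support l \<subseteq> ?V" using that by (auto simp: std_simplex_def)
      then show ?thesis by blast
    qed
    then show ?thesis by (auto simp: face_bdry_def)
  qed
  have "ball_pair (d - 1) (realization_set (set_encode ` Pow ?V) enc_le 0)
     (realization_set (set_encode ` ?L) enc_le 0)"
  proof (rule complex_ball[where W = ?V])
    show "ball_pair (d - 1) {l \<in> std_simplex ?V. support l \<in> Pow ?V} {l \<in> std_simplex ?V. support l \<in> ?L}"
      unfolding 1 2 by (rule std_simplex_ball[OF d])
  qed (use V0 in auto)
  moreover have "fvec (set_encode ` Pow ?V) enc_le 0 r =
     (\<Sum>j\<le>d. (if j = 0 then 1 else 0) * (if j \<le> r then (d - j) choose (r - j) else 0))" for r
  proof -
    have "fvec (set_encode ` Pow ?V) enc_le 0 r = card {S \<in> Pow ?V. card S = r}"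
      by (rule complex_simplicial(2)[of ?V]) auto
    also have "\<dots> = d choose r" using n_subsets[of ?V r] by (simp add: Collect_conj_eq Pow_def)
    also have "\<dots> = (\<Sum>j\<le>d. if j = 0 then d choose r else 0)" by simp
    also have "\<dots> = (\<Sum>j\<le>d. (if j = 0 then 1 else 0) * (if j \<le> r then (d - j) choose (r - j) else 0))"
      by (intro sum.cong) auto
    finally show ?thesis .
  qed
  moreover have "simplicial_poset (set_encode ` Pow ?V) enc_le 0"
    by (rule complex_simplicial(1)[of ?V]) auto
  ultimately have "shelled d (\<lambda>j. if j = 0 then 1 else 0) (set_encode ` Pow ?V) enc_le (set_encode ` ?L)"
    unfolding shelled_def by auto
  moreover have "spot ?V (set_encode ` Pow ?V) enc_le (set_encode ` ?L) ?V set_encode"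
    by (rule boundary_spot[of ?V]) auto
  ultimately show ?thesis unfolding reach_def by (meson card_lessThan subset_refl)
qed

text \<open>Among all sets of size \<open>r\<close> only the missing facet \<open>{..<d}\<close> and
  the full vertex set are excluded. The facet accounts for the absent summand \<open>j = d\<close>;
  the rest is the hockey-stick identity.\<close>

lemma choose_hockey:
  assumes "d \<ge> 1"
  shows "card {S. S \<subseteq> {..<Suc d} \<and> \<not> {..<d} \<subseteq> S \<and> card S = r} =
    (\<Sum>j\<le>d. (if j < d then 1 else 0) * (if j \<le> r then (d - j) choose (r - j) else 0))"
proof -
  let ?b = "\<lambda>j. if j \<le> r then (d - j) choose (r - j) else 0"
  let ?A = "{S. S \<subseteq> {..<Suc d} \<and> card S = r}"
  let ?C = "{S. S \<subseteq> {..<Suc d} \<and> {..<d} \<subseteq> S \<and> card S = r}"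
  have cA: "card ?A = Suc d choose r" using n_subsets[of "{..<Suc d}" r] by simp
  have "?A - ?C = {S. S \<subseteq> {..<Suc d} \<and> \<not> {..<d} \<subseteq> S \<and> card S = r}" by blast
  moreover have "card (?A - ?C) = card ?A - card ?C"
    by (rule card_Diff_subset) (auto intro: finite_subset[of _ "Pow {..<Suc d}"])
  ultimately have L: "card {S. S \<subseteq> {..<Suc d} \<and> \<not> {..<d} \<subseteq> S \<and> card S = r} = (Suc d choose r) - card ?C"
    using cA by simp
  have *: "S = {..<d} \<or> S = {..<Suc d}" if "S \<subseteq> {..<Suc d}" "{..<d} \<subseteq> S" for S
    using that unfolding lessThan_Suc by blast
  have "S \<in> ?C \<longleftrightarrow> S = {..<d} \<and> r = d \<or> S = {..<Suc d} \<and> r = Suc d" for S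
  proof
    assume S: "S \<in> ?C"
    then have "S = {..<d} \<or> S = {..<Suc d}" "card S = r" using * by blast+
    then show "S = {..<d} \<and> r = d \<or> S = {..<Suc d} \<and> r = Suc d" by (metis card_lessThan)
  next
    assume "S = {..<d} \<and> r = d \<or> S = {..<Suc d} \<and> r = Suc d"
    then show "S \<in> ?C" by (auto simp: lessThan_subset_iff)
  qed
  then have C: "?C = (if r = d then {{..<d}} else if r = Suc d then {{..<Suc d}} else {})"
    by (intro set_eqI) simp
  have R: "(\<Sum>j\<le>d. (if j < d then 1 else 0) * ?b j) = (\<Sum>j<d. ?b j)"
    unfolding lessThan_Suc_atMost[symmetric] sum.lessThan_Suc by simp
  have sumd: "(\<Sum>j\<le>d. ?b j) = (\<Sum>j<d. ?b j) + ?b d"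
    unfolding lessThan_Suc_atMost[symmetric] by simp
  show ?thesis
  proof (cases "r \<le> d")
    case True
    have "(\<Sum>j\<le>d. ?b j) = (\<Sum>j\<le>r. ?b j)" using True by (intro sum.mono_neutral_right) auto
    also have "\<dots> = (\<Sum>j\<le>r. (d - j) choose (r - j))" by (intro sum.cong) auto
    also have "\<dots> = Suc d choose r" by (rule sum_choose_diagonal[OF True])
    finally have "(\<Sum>j<d. ?b j) + ?b d = Suc d choose r" using sumd by simp
    then show ?thesis unfolding L R C using True by auto
  next
    case False
    then have "(\<Sum>j<d. ?b j) = 0" by (intro sum.neutral) (auto simp: binomial_eq_0)
    then show ?thesis unfolding L R C using False by (auto simp: binomial_eq_0)
  qed
qed

text \<open>The cone over the boundary of a simplex, that is the boundary of a \<open>d\<close>-simplex with one facet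
  removed.\<close>
lemma reach_cone:
  assumes d: "d \<ge> 1"
  shows "reach d (\<lambda>j. if j < d then 1 else 0) d"
proof -
  let ?V = "{..<d}" and ?W = "{..<Suc d}" and ?L = "{S. S \<subset> {..<d}}"
  let ?K = "{S. S \<subseteq> {..<Suc d} \<and> \<not> {..<d} \<subseteq> S}"
  have "0 \<in> ?V" using d by simp
  then have V0: "{} \<subset> ?V" "\<not> ?V \<subseteq> {}" by blast+
  have LK: "?L \<subseteq> ?K" by auto
  have sW: "support l \<subseteq> ?W" if "l \<in> std_simplex ?W" for l :: "nat \<Rightarrow> real"
    using that by (auto simp: std_simplex_def)
  have Min0: "Min (l ` ?V) = 0 \<longleftrightarrow> \<not> ?V \<subseteq> support l" if "l \<in> std_simplex ?W" for l :: "nat \<Rightarrow> real"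
    using Min_image_eq_0_iff[of ?V l] that V0 by (auto simp: std_simplex_def)
  have 1: "{l \<in> std_simplex ?W. support l \<in> ?K} = part_zero ?W ?V"
    using sW Min0 unfolding part_zero_def by blast
  have Ls: "support l \<in> ?L \<longleftrightarrow> \<not> ?V \<subseteq> support l \<and> l d = 0" if "l \<in> std_simplex ?W" for l :: "nat \<Rightarrow> real"
    using sW[OF that] by (auto simp: lessThan_Suc psubset_eq)
  have 2: "{l \<in> std_simplex ?W. support l \<in> ?L} = {l \<in> part_zero ?W ?V. l d = 0}"
  proof (intro set_eqI)
    fix l :: "nat \<Rightarrow> real"
    have "l \<in> {l \<in> std_simplex ?W. support l \<in> ?L} \<longleftrightarrow> l \<in> std_simplex ?W \<and> support l \<in> ?L"
      by (rule mem_Collect_eq)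
    also have "\<dots> \<longleftrightarrow> l \<in> std_simplex ?W \<and> Min (l ` ?V) = 0 \<and> l d = 0"
      using Ls[of l] Min0[of l] by meson
    also have "\<dots> \<longleftrightarrow> l \<in> {l \<in> part_zero ?W ?V. l d = 0}" by (simp add: part_zero_def)
    finally show "l \<in> {l \<in> std_simplex ?W. support l \<in> ?L} \<longleftrightarrow> l \<in> {l \<in> part_zero ?W ?V. l d = 0}" .
  qed
  have "ball_pair (d - 1) (realization_set (set_encode ` ?K) enc_le 0)
     (realization_set (set_encode ` ?L) enc_le 0)"
  proof (rule complex_ball[where W = ?W])
    show "ball_pair (d - 1) {l \<in> std_simplex ?W. support l \<in> ?K} {l \<in> std_simplex ?W. support l \<in> ?L}"
      unfolding 1 2 by (rule cone_ball[OF d])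
    show "?L \<subseteq> ?K" by (rule LK)
  qed (use V0 in auto)
  moreover have "fvec (set_encode ` ?K) enc_le 0 r =
     (\<Sum>j\<le>d. (if j < d then 1 else 0) * (if j \<le> r then (d - j) choose (r - j) else 0))" for r
  proof -
    have "fvec (set_encode ` ?K) enc_le 0 r = card {S \<in> ?K. card S = r}"
      by (rule complex_simplicial(2)[of ?W]) (use V0 in auto)
    also have "{S \<in> ?K. card S = r} = {S. S \<subseteq> ?W \<and> \<not> ?V \<subseteq> S \<and> card S = r}" by blast
    finally show ?thesis using choose_hockey[OF d] by simp
  qed
  moreover have "simplicial_poset (set_encode ` ?K) enc_le 0"
    by (rule complex_simplicial(1)[of ?W]) (use V0 in auto)
  ultimately have "shelled d (\<lambda>j. if j < d then 1 else 0) (set_encode ` ?K) enc_le (set_encode ` ?L)"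
    unfolding shelled_def using image_mono[OF LK, of set_encode] by blast
  moreover have "spot ?V (set_encode ` ?K) enc_le (set_encode ` ?L) ?V set_encode"
    by (rule boundary_spot[of ?W]) auto
  ultimately show ?thesis unfolding reach_def by (meson card_lessThan subset_refl)
qed

section \<open>From type counts to the h-vector\<close>

lemma fvec_hvec:
  assumes f: "\<And>r. fvec P le z r = (\<Sum>j\<le>d. g j * (if j \<le> r then (d - j) choose (r - j) else 0))"
  shows "has_hvec P le z d g"
  unfolding has_hvec_def
proof
  fix x :: real
  \<comment> \<open>One simplex of type \<open>j\<close> contributes \<open>x ^ j\<close>: after
    factoring this out, the binomial theorem is applied to \<open>x + (1 - x)\<close>.\<close>
  have inner: "(\<Sum>i\<le>d. (if j \<le> i then real ((d - j) choose (i - j)) else 0) * x ^ i * (1 - x) ^ (d - i)) = x ^ j"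
    if "j \<le> d" for j
  proof -
    have "(\<Sum>i\<le>d. (if j \<le> i then real ((d - j) choose (i - j)) else 0) * x ^ i * (1 - x) ^ (d - i)) =
        (\<Sum>i\<in>{j..d}. real ((d - j) choose (i - j)) * x ^ i * (1 - x) ^ (d - i))"
      by (intro sum.mono_neutral_cong_right) auto
    also have "\<dots> = (\<Sum>k\<in>{0..d - j}. real ((d - j) choose k) * x ^ (k + j) * (1 - x) ^ (d - (k + j)))"
      using sum.shift_bounds_cl_nat_ivl[of "\<lambda>i. real ((d - j) choose (i - j)) * x ^ i * (1 - x) ^ (d - i)" 0 j "d - j"]
        that by simp
    also have "\<dots> = x ^ j * (\<Sum>k\<le>d - j. real ((d - j) choose k) * x ^ k * (1 - x) ^ (d - j - k))"
      unfolding sum_distrib_left atLeast0AtMost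
      by (intro sum.cong) (auto simp: power_add algebra_simps)
    also have "(\<Sum>k\<le>d - j. real ((d - j) choose k) * x ^ k * (1 - x) ^ (d - j - k)) = (x + (1 - x)) ^ (d - j)"
      by (rule binomial_ring[symmetric])
    finally show ?thesis by simp
  qed
  have "(\<Sum>i\<le>d. real (fvec P le z i) * x ^ i * (1 - x) ^ (d - i)) =
     (\<Sum>i\<le>d. \<Sum>j\<le>d. real (g j) * ((if j \<le> i then real ((d - j) choose (i - j)) else 0) * x ^ i * (1 - x) ^ (d - i)))"
    unfolding f of_nat_sum sum_distrib_right by (intro sum.cong) auto
  also have "\<dots> = (\<Sum>j\<le>d. real (g j) * (\<Sum>i\<le>d. (if j \<le> i then real ((d - j) choose (i - j)) else 0) * x ^ i * (1 - x) ^ (d - i)))"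
    unfolding sum_distrib_left by (rule sum.swap)
  also have "\<dots> = (\<Sum>j\<le>d. real (g j) * x ^ j)" using inner by (intro sum.cong) auto
  finally show "(\<Sum>i\<le>d. real (g i) * x ^ i) = (\<Sum>i\<le>d. real (fvec P le z i) * x ^ i * (1 - x) ^ (d - i))"
    by simp
qed

lemma reach_goal:
  assumes "reach d g c" "g 0 = 1" "\<And>j. j \<le> d \<Longrightarrow> g j = h j"
  shows "\<exists>(P :: nat set) le z. simplicial_poset P le z \<and> has_dim P le z d \<and>
           realization P le z homeomorphic_space nball (d - 1) \<and> has_hvec P le z d h"
proof -
  obtain P le Q where s: "shelled d g P le Q" using assms(1) by (auto simp: reach_def)
  have f: "fvec P le 0 r = (\<Sum>j\<le>d. g j * (if j \<le> r then (d - j) choose (r - j) else 0))" for r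
    using s by (simp add: shelled_def)
  also have "\<dots> r = (\<Sum>j\<le>d. h j * (if j \<le> r then (d - j) choose (r - j) else 0))" for r
    using assms(3) by (intro sum.cong) auto
  finally have "has_hvec P le 0 d h" by (rule fvec_hvec)
  moreover have "has_dim P le 0 d"
    unfolding has_dim_def
  proof (intro conjI allI impI)
    \<comment> \<open>The simplex of type 0 supplies a face of full dimension.\<close>
    have "1 \<le> g 0 * (if 0 \<le> d then (d - 0) choose (d - 0) else 0)" using assms(2) by simp
    also have "\<dots> \<le> fvec P le 0 d" unfolding f by (rule member_le_sum) auto
    finally show "fvec P le 0 d \<noteq> 0" by simp
    show "fvec P le 0 r = 0" if "r > d" for r
      unfolding f using that by (intro sum.neutral) (auto simp: binomial_eq_0)
  qed
  moreover have "realization P le 0 homeomorphic_space nball (d - 1)"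
    using s ball_pair_homeomorphic unfolding shelled_def realization_eq by blast
  ultimately show ?thesis using s unfolding shelled_def by blast
qed

section \<open>Distributing the types\<close>

text \<open>Here \<open>low g l\<close> counts the types up to \<open>l\<close>, and
  \<open>high d g l\<close> the types from \<open>d - l\<close> on. The latter need neighbours among
  the former, so \<open>high \<le> low\<close> is a matching condition.\<close>

definition low :: "(nat \<Rightarrow> nat) \<Rightarrow> nat \<Rightarrow> nat" where "low g l = (\<Sum>i\<le>l. g i)"
definition high :: "nat \<Rightarrow> (nat \<Rightarrow> nat) \<Rightarrow> nat \<Rightarrow> nat" where "high d g l = (\<Sum>i\<in>{d - l..<d}. g i)"

lemma low_high_total: "l < d \<Longrightarrow> low g l + high d g (d - 1 - l) = (\<Sum>i<d. g i)"
proof -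
  assume l: "l < d"
  have "{..<d} = {..l} \<union> {d - (d - 1 - l)..<d}" using l by auto
  then have "(\<Sum>i<d. g i) = (\<Sum>i\<in>{..l} \<union> {d - (d - 1 - l)..<d}. g i)" by simp
  also have "\<dots> = low g l + high d g (d - 1 - l)"
    unfolding low_def high_def using l by (intro sum.union_disjoint) auto
  finally show ?thesis by simp
qed

lemma high_reindex: "(l::nat) < d \<Longrightarrow> (\<Sum>i\<in>{d - l..<d}. f i) = (\<Sum>i\<in>{1..l}. f (d - i))"
  by (rule sum.reindex_bij_witness[of _ "\<lambda>i. d - i" "\<lambda>i. d - i"]) auto

lemma low_mono: "l \<le> l' \<Longrightarrow> low g l \<le> low g l'"
  unfolding low_def by (intro sum_mono2) auto

lemma high_mono: "l \<le> l' \<Longrightarrow> high d g l \<le> high d g l'"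
  unfolding high_def by (intro sum_mono2) auto

lemma low_pos: "0 < low g l \<longleftrightarrow> (\<exists>i\<le>l. g i \<noteq> 0)"
  unfolding low_def by (auto simp: neq0_conv[symmetric] simp del: neq0_conv)

lemma high_pos: "0 < high d g l \<longleftrightarrow> (\<exists>i. d - l \<le> i \<and> i < d \<and> g i \<noteq> 0)"
  unfolding high_def by (auto simp: neq0_conv[symmetric] simp del: neq0_conv)

lemma low_add: "low (\<lambda>i. f i + g i) l = low f l + low g l"
  by (simp add: low_def sum.distrib)

lemma high_add: "high d (\<lambda>i. f i + g i) l = high d f l + high d g l"
  by (simp add: high_def sum.distrib)

lemma low_delta: "low (\<lambda>i. if i = a then 1 else 0) l = (if a \<le> l then 1 else 0)"
  by (simp add: low_def)

lemma high_delta: "high d (\<lambda>i. if i = a then 1 else 0) l = (if d - l \<le> a \<and> a < d then 1 else 0)"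
  by (simp add: high_def)

text \<open>With \<open>g\<close> read as a multiset, one smallest and one largest member are split
  off; this is the induction step of both constructions below.\<close>

lemma extremes:
  fixes g :: "nat \<Rightarrow> nat"
  assumes supp: "\<forall>i. g i \<noteq> 0 \<longrightarrow> 1 \<le> i \<and> i < d" and two: "2 \<le> (\<Sum>i<d. g i)"
  obtains lo hi g' where "1 \<le> lo" "lo \<le> hi" "hi < d" "g lo \<noteq> 0" "g hi \<noteq> 0"
    "\<And>i. g i \<noteq> 0 \<Longrightarrow> lo \<le> i \<and> i \<le> hi"
    "g = (\<lambda>i. g' i + ((if i = lo then 1 else 0) + (if i = hi then 1 else 0)))"
proof -
  have "\<exists>i. g i \<noteq> 0" using two by (metis not_numeral_le_zero sum.neutral)
  then have ne: "{i. g i \<noteq> 0} \<noteq> {}" by blast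
  have fin: "finite {i. g i \<noteq> 0}" using supp by (auto intro: finite_subset[of _ "{..<d}"])
  define lo hi where "lo = Min {i. g i \<noteq> 0}" and "hi = Max {i. g i \<noteq> 0}"
  have mem: "g lo \<noteq> 0" "g hi \<noteq> 0" using Min_in[OF fin ne] Max_in[OF fin ne] by (auto simp: lo_def hi_def)
  have bd: "lo \<le> i \<and> i \<le> hi" if "g i \<noteq> 0" for i using that fin by (simp add: lo_def hi_def)
  \<comment> \<open>If a single type occurs, it occurs at least twice, so two copies can be
    removed.\<close>
  have g2: "2 \<le> g lo" if "lo = hi"
  proof -
    have "(\<Sum>i<d. g i) = (\<Sum>i<d. if i = lo then g lo else 0)"
      using bd that by (intro sum.cong) (auto, force)
    then show ?thesis using two supp[rule_format, OF mem(1)] by simp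
  qed
  define g' where "g' = (\<lambda>i. g i - ((if i = lo then 1 else 0) + (if i = hi then 1 else 0)))"
  have "g = (\<lambda>i. g' i + ((if i = lo then 1 else 0) + (if i = hi then 1 else 0)))"
    using mem g2 by (auto simp: g'_def fun_eq_iff)
  moreover have "1 \<le> lo" "lo \<le> hi" "hi < d" using supp mem bd by blast+
  ultimately show ?thesis using that[of lo hi g'] mem bd by simp
qed

text \<open>The second conjunct carries the induction: after the other types a spot of size at least
  \<open>d - hi\<close> is left, which admits \<open>lo\<close>; then one of size
  \<open>d - lo\<close> is present, which admits \<open>hi\<close>.\<close>

lemma reach_path:
  assumes "reach d b d" "\<And>i. g i \<noteq> 0 \<Longrightarrow> 1 \<le> i \<and> i < d"
    "\<And>l. 2 * l < d \<Longrightarrow> high d g l \<le> low g l"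
  shows "\<exists>c. reach d (\<lambda>j. b j + g j) c \<and> (\<forall>k\<le>d. (\<forall>i. g i \<noteq> 0 \<longrightarrow> i \<le> k) \<longrightarrow> d - k \<le> c)"
  using assms(2-)
proof (induction "\<Sum>i<d. g i" arbitrary: g rule: less_induct)
  case less
  note supp = less.prems(1) and U = less.prems(2)
  consider "(\<Sum>i<d. g i) = 0" | "(\<Sum>i<d. g i) = 1" | "2 \<le> (\<Sum>i<d. g i)" by linarith
  then show ?case
  proof cases
    case 1
    then have "g i = 0" for i using supp[of i] by (cases "i < d") auto
    then have "(\<lambda>j. b j + g j) = b" by simp
    then show ?thesis using assms(1) by (intro exI[of _ d]) simp
  next
    case 2
    then obtain a where a: "a < d" "g a = 1" "\<And>i. i < d \<Longrightarrow> i \<noteq> a \<Longrightarrow> g i = 0"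
      using sum_eq_1_iff[of "{..<d}" g] by auto
    have "g i = (if i = a then 1 else 0)" for i using a supp[of i] by (cases "i < d") auto
    then have "(\<lambda>j. b j + g j) = b(a := b a + 1)" by auto
    moreover have "reach d (b(a := b a + 1)) (d - a)"
      using reach_flip[OF assms(1)] supp[of a] a by simp
    ultimately show ?thesis using a(2) by (intro exI[of _ "d - a"]) (auto intro!: diff_le_mono2)
  next
    case 3
    have supp': "\<forall>i. g i \<noteq> 0 \<longrightarrow> 1 \<le> i \<and> i < d" using supp by blast
    obtain lo hi g' where e: "1 \<le> lo" "lo \<le> hi" "hi < d" "g lo \<noteq> 0" "g hi \<noteq> 0"
        "\<And>i. g i \<noteq> 0 \<Longrightarrow> lo \<le> i \<and> i \<le> hi"
        "g = (\<lambda>i. g' i + ((if i = lo then 1 else 0) + (if i = hi then 1 else 0)))"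
      by (rule extremes[OF supp' 3]) (rule that, (assumption | blast)+)
    have g'g: "g i \<noteq> 0" if "g' i \<noteq> 0" for i using that unfolding e(7) by simp
    have lg: "low g l = low g' l + ((if lo \<le> l then 1 else 0) + (if hi \<le> l then 1 else 0))" for l
      unfolding e(7) low_add low_delta ..
    have hg: "high d g l = high d g' l + ((if d - l \<le> lo then 1 else 0) + (if d - l \<le> hi then 1 else 0))" for l
      using e(2,3) unfolding e(7) high_add high_delta by simp
    \<comment> \<open>For \<open>hi\<close> beyond half of \<open>d\<close>, the inequality at
      \<open>l = d - hi\<close> produces a type not exceeding \<open>d - hi\<close>.\<close>
    have lohi: "lo + hi \<le> d"
    proof (cases "2 * hi \<le> d")
      case True then show ?thesis using e by linarith
    next
      case False
      then have "2 * (d - hi) < d" "d - (d - hi) = hi" using e(3) by auto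
      then have "0 < low g (d - hi)" using U[of "d - hi"] high_pos[of d g "d - hi"] e(3,5) by fastforce
      then obtain i where "i \<le> d - hi" "g i \<noteq> 0" using low_pos by blast
      then show ?thesis using e(6)[of i] e(3) by linarith
    qed
    have lt: "(\<Sum>i<d. g' i) < (\<Sum>i<d. g i)"
      using e(1-3) unfolding e(7) by (simp add: sum.distrib)
    \<comment> \<open>Since \<open>2 * l < d\<close> the two ranges are disjoint. If the high one is
      occupied, it loses exactly \<open>hi\<close> and the low one exactly
      \<open>lo\<close>.\<close>
    have U': "high d g' l \<le> low g' l" if l: "2 * l < d" for l
    proof (cases "high d g l = 0")
      case True then show ?thesis using hg[of l] by simp
    next
      case False
      then obtain i where i: "d - l \<le> i" "g i \<noteq> 0" using high_pos[of d g l] by auto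
      have "0 < low g l" using False U[OF l] by linarith
      then obtain j where "j \<le> l" "g j \<noteq> 0" using low_pos by blast
      then have "lo \<le> l" "d - l \<le> hi" "\<not> d - l \<le> lo" "\<not> hi \<le> l"
        using e(6)[of i] e(6)[of j] i l by linarith+
      then show ?thesis using U[OF l] lg[of l] hg[of l] by simp
    qed
    obtain c where c: "reach d (\<lambda>j. b j + g' j) c"
        "\<And>k. k \<le> d \<Longrightarrow> (\<forall>i. g' i \<noteq> 0 \<longrightarrow> i \<le> k) \<Longrightarrow> d - k \<le> c"
      using less.hyps[OF lt] g'g supp U' by blast
    have "d - hi \<le> c" using c(2)[of hi] e(3,6) g'g by force
    then have "lo \<le> c" using lohi by linarith
    then have r1: "reach d ((\<lambda>j. b j + g' j)(lo := (b lo + g' lo) + 1)) (d - lo)" (is "reach d ?f _")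
      using reach_flip[OF c(1), of lo] e by simp
    have "reach d (?f(hi := ?f hi + 1)) (d - hi)"
      using reach_flip[OF r1, of hi] e lohi by simp
    moreover have "?f(hi := ?f hi + 1) = (\<lambda>j. b j + g j)"
      by (subst e(7)) (auto simp: fun_eq_iff)
    moreover have "\<forall>k\<le>d. (\<forall>i. g i \<noteq> 0 \<longrightarrow> i \<le> k) \<longrightarrow> d - k \<le> d - hi"
      using e(5) diff_le_mono2 by blast
    ultimately show ?thesis by (intro exI[of _ "d - hi"]) simp
  qed
qed

text \<open>Smallest and largest type form a pair. The two families of inequalities yield
  \<open>lo + hi \<le> d\<close> and \<open>d - n \<le> lo + hi\<close>, as
  \<open>reach_two_flips\<close> requires for a spot of size \<open>d - n\<close>, and they survive
  the removal of the pair.\<close>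

lemma reach_pairs:
  assumes "reach d b (d - n)" "2 * n < d" "\<And>i. g i \<noteq> 0 \<Longrightarrow> 1 \<le> i \<and> i < d" "even (\<Sum>i<d. g i)"
    "\<And>l. l < d \<Longrightarrow> high d g l \<le> low g l"
    "\<And>l. n \<le> l \<Longrightarrow> l < d \<Longrightarrow> low g (l - n) \<le> high d g l"
  shows "reach d (\<lambda>j. b j + g j) (d - n)"
  using assms(3-)
proof (induction "\<Sum>i<d. g i" arbitrary: g rule: less_induct)
  case less
  note supp = less.prems(1) and U = less.prems(3) and L = less.prems(4)
  show ?case
  proof (cases "(\<Sum>i<d. g i) = 0")
    case True
    then have "g i = 0" for i using supp[of i] by (cases "i < d") auto
    then have "(\<lambda>j. b j + g j) = b" by simp
    then show ?thesis using assms(1) by simp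
  next
    case False
    moreover obtain s where "(\<Sum>i<d. g i) = 2 * s" using less.prems(2) by (rule evenE)
    ultimately have two: "2 \<le> (\<Sum>i<d. g i)" by (cases s) auto
    have supp': "\<forall>i. g i \<noteq> 0 \<longrightarrow> 1 \<le> i \<and> i < d" using supp by blast
    obtain lo hi g' where e: "1 \<le> lo" "lo \<le> hi" "hi < d" "g lo \<noteq> 0" "g hi \<noteq> 0"
        "\<And>i. g i \<noteq> 0 \<Longrightarrow> lo \<le> i \<and> i \<le> hi"
        "g = (\<lambda>i. g' i + ((if i = lo then 1 else 0) + (if i = hi then 1 else 0)))"
      by (rule extremes[OF supp' two]) (rule that, (assumption | blast)+)
    have g'g: "g i \<noteq> 0" if "g' i \<noteq> 0" for i using that unfolding e(7) by simp
    have lg: "low g l = low g' l + ((if lo \<le> l then 1 else 0) + (if hi \<le> l then 1 else 0))" for l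
      unfolding e(7) low_add low_delta ..
    have hg: "high d g l = high d g' l + ((if d - l \<le> lo then 1 else 0) + (if d - l \<le> hi then 1 else 0))" for l
      using e(2,3) unfolding e(7) high_add high_delta by simp
    have tot: "(\<Sum>i<d. g i) = (\<Sum>i<d. g' i) + 2"
      using e(1-3) by (subst e(7)) (simp add: sum.distrib)
    have low_le: "low g l \<le> (\<Sum>i<d. g i)" "hi > l \<Longrightarrow> low g l < (\<Sum>i<d. g i)" if "l < d" for l
    proof -
      show "low g l \<le> (\<Sum>i<d. g i)" using low_high_total[OF that, of g] by linarith
      assume "hi > l"
      then have "0 < high d g (d - 1 - l)" using high_pos e(3,5) that by fastforce
      then show "low g l < (\<Sum>i<d. g i)" using low_high_total[OF that, of g] by linarith
    qed
    have high_le: "high d g l \<le> (\<Sum>i<d. g i)" "lo < d - l \<Longrightarrow> high d g l < (\<Sum>i<d. g i)" if "l < d" for l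
    proof -
      have *: "low g (d - 1 - l) + high d g l = (\<Sum>i<d. g i)"
        using low_high_total[of "d - 1 - l" d g] that by simp
      then show "high d g l \<le> (\<Sum>i<d. g i)" by linarith
      assume "lo < d - l"
      then have "0 < low g (d - 1 - l)" using low_pos[of g "d - 1 - l"] e(4) by fastforce
      then show "high d g l < (\<Sum>i<d. g i)" using * by linarith
    qed
    have low_eq: "low g l = (\<Sum>i<d. g i)" if "hi \<le> l" "l < d" for l
    proof -
      have "high d g (d - 1 - l) = 0"
        using high_pos[of d g "d - 1 - l"] e(6) that by fastforce
      then show ?thesis using low_high_total[OF that(2), of g] by simp
    qed
    have high_eq: "high d g l = (\<Sum>i<d. g i)" if "d - l \<le> lo" "l < d" for l
    proof -
      have "low g (d - 1 - l) = 0"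
        using low_pos[of g "d - 1 - l"] e(6) that by fastforce
      then show ?thesis using low_high_total[of "d - 1 - l" d g] that by simp
    qed
    have lohi: "lo + hi \<le> d"
    proof -
      have "0 < high d g (d - hi)" using high_pos[of d g "d - hi"] e(3,5) by fastforce
      then have "0 < low g (d - hi)" using U[of "d - hi"] e(1,2,3) by fastforce
      then obtain i where "i \<le> d - hi" "g i \<noteq> 0" using low_pos by blast
      then show ?thesis using e(6)[of i] e(3) by linarith
    qed
    \<comment> \<open>The lower bound at \<open>l = lo + n\<close> produces a type not below
      \<open>d - (lo + n)\<close>.\<close>
    have lohi': "d - n \<le> lo + hi"
    proof (cases "lo + n < d")
      case True
      have "0 < low g (lo + n - n)" using low_pos e(4) by auto
      then have "0 < high d g (lo + n)" using L[of "lo + n"] True by linarith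
      then obtain i where "d - (lo + n) \<le> i" "g i \<noteq> 0" using high_pos by blast
      then show ?thesis using e(6)[of i] by linarith
    qed simp
    have U': "high d g' l \<le> low g' l" if l: "l < d" for l
    proof (cases "high d g l = 0")
      case True then show ?thesis using hg[of l] by simp
    next
      case False
      then obtain i where i: "d - l \<le> i" "g i \<noteq> 0" using high_pos[of d g l] by auto
      have "0 < low g l" using False U[OF l] by linarith
      then obtain j where "j \<le> l" "g j \<noteq> 0" using low_pos by blast
      then have lh: "lo \<le> l" "d - l \<le> hi"
        using e(6)[of i] e(6)[of j] i by linarith+
      \<comment> \<open>The critical case: the low count loses two and the high count only one. Then
        all types are at most \<open>l\<close> but not all are at least \<open>d - l\<close>, so the
        inequality was strict.\<close>
      show ?thesis
      proof (cases "hi \<le> l \<and> \<not> d - l \<le> lo")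
        case True
        then have "high d g l < low g l" using low_eq high_le(2) l by simp
        then show ?thesis using lg[of l] hg[of l] lh True by simp
      next
        case False
        then show ?thesis using lg[of l] hg[of l] lh U[OF l] by (auto split: if_splits)
      qed
    qed
    have L': "low g' (l - n) \<le> high d g' l" if l: "n \<le> l" "l < d" for l
    proof (cases "low g (l - n) = 0")
      case True then show ?thesis using lg[of "l - n"] by simp
    next
      case False
      then obtain j where j: "j \<le> l - n" "g j \<noteq> 0" using low_pos[of g "l - n"] by auto
      have "0 < high d g l" using False L[OF l] by linarith
      then obtain i where i: "d - l \<le> i" "g i \<noteq> 0" using high_pos by blast
      then have lh: "lo \<le> l - n" "d - l \<le> hi"
        using e(6)[of i] e(6)[of j] j by linarith+
      show ?thesis
      proof (cases "d - l \<le> lo \<and> \<not> hi \<le> l - n")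
        case True
        then have "low g (l - n) < high d g l" using high_eq[of l] low_le(2)[of "l - n"] l by simp
        then show ?thesis using lg[of "l - n"] hg[of l] lh True by simp
      next
        case False
        then show ?thesis using lg[of "l - n"] hg[of l] lh L[OF l] by (auto split: if_splits)
      qed
    qed
    have "reach d (\<lambda>j. b j + g' j) (d - n)"
      using less.hyps[of g'] tot g'g supp U' L' less.prems(2) by simp
    \<comment> \<open>The requirement \<open>lo < d - n\<close> holds because
      \<open>2 * lo \<le> lo + hi \<le> d\<close> and \<open>2 * n < d\<close>.\<close>
    then have "reach d ((\<lambda>j. b j + g' j)(lo := (b lo + g' lo) + 1,
        hi := ((\<lambda>j. b j + g' j)(lo := (b lo + g' lo) + 1)) hi + 1)) (d - n)" (is "reach d ?f _")
      using reach_two_flips[of d "\<lambda>j. b j + g' j" "d - n" lo hi] e(1,2) lohi lohi' assms(2) by simp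
    moreover have "?f = (\<lambda>j. b j + g j)"
      by (subst e(7)) (auto simp: fun_eq_iff)
    ultimately show ?thesis by simp
  qed
qed

section \<open>The inequalities for h' as counting conditions\<close>

lemma dhprime_eq:
  assumes "l < d" "k < d"
  shows "dhprime h k d l = 1 + (\<Sum>i\<in>{1..l}. hprime h k i - hprime h k (d - i))"
proof -
  have "dhprime h k d l = (\<Sum>i\<in>insert 0 {1..l}. hprime h k i - hprime h k (d - i))"
    unfolding dhprime_def by (rule sum.cong) auto
  also have "\<dots> = 1 + (\<Sum>i\<in>{1..l}. hprime h k i - hprime h k (d - i))"
    using assms by (simp add: hprime_def)
  finally show ?thesis .
qed

lemma low_minus_high:
  assumes "l < d" "g 0 = 0"
  shows "int (low g l) - int (high d g l) = (\<Sum>i\<in>{1..l}. int (g i) - int (g (d - i)))"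
proof -
  have "low g l = (\<Sum>i\<in>insert 0 {1..l}. g i)" unfolding low_def by (rule sum.cong) auto
  then have "low g l = (\<Sum>i\<in>{1..l}. g i)" using assms(2) by simp
  moreover have "high d g l = (\<Sum>i\<in>{1..l}. g (d - i))"
    unfolding high_def by (rule high_reindex[OF assms(1)])
  ultimately show ?thesis by (simp add: sum_subtractf)
qed

lemma reach_positive:
  fixes h :: "nat \<Rightarrow> nat" and d k :: nat
  assumes h0: "h 0 = 1" and k: "1 \<le> k" "k < d"
    and hzero: "\<And>j. k < j \<Longrightarrow> j \<le> d \<Longrightarrow> h j = 0"
    and hpos: "\<And>j. 1 \<le> j \<Longrightarrow> j \<le> k \<Longrightarrow> h j > 0"
    and c: "\<And>l. 2 * l < d \<Longrightarrow> dhprime h k d l > 0 \<or> dhprime h k d l \<ge> 0 \<and> k + 2 \<le> d"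
  shows "\<exists>g c. reach d g c \<and> (\<forall>j\<le>d. g j = h j)"
proof -
  define g where "g = (\<lambda>j. if 1 \<le> j \<and> j < d then h j else 0)"
  define b :: "nat \<Rightarrow> nat" where "b = (\<lambda>j. if j = 0 then 1 else 0)"
  have rb: "reach d b d" unfolding b_def using k by (intro reach_simplex) simp
  have hp: "hprime h k i = int (g i) - (if i \<le> k then 1 else 0)" if "1 \<le> i" "i < d" for i
    using that hzero[of i] by (simp add: hprime_def g_def)
  have "high d g l \<le> low g l" if l: "2 * l < d" for l
  proof -
    let ?D = "\<lambda>i. hprime h k i - hprime h k (d - i)"
    \<comment> \<open>For \<open>i < d - i\<close> the correction by 1 affects \<open>d - i\<close>
      only if it also affects \<open>i\<close>. When \<open>k + 2 \<le> d\<close> and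
      \<open>i = 1\<close> it affects \<open>i\<close> alone, and this surplus makes up for
      \<open>dhprime\<close> being 0.\<close>
    have ge: "?D i + (if i = 1 \<and> k + 2 \<le> d then 1 else 0) \<le> int (g i) - int (g (d - i))"
      if "i \<in> {1..l}" for i
    proof -
      have i: "1 \<le> i" "i < d" "1 \<le> d - i" "d - i < d" "i < d - i" using that l by auto
      show ?thesis using hp[OF i(1,2)] hp[OF i(3,4)] i k by (auto split: if_splits)
    qed
    have ld: "l < d" and g0: "g 0 = 0" using l by (simp_all add: g_def)
    have "(\<Sum>i\<in>{1..l}. ?D i + (if i = 1 \<and> k + 2 \<le> d then 1 else 0)) \<le> int (low g l) - int (high d g l)"
      unfolding low_minus_high[OF ld, of g, OF g0] by (rule sum_mono) (rule ge)
    moreover have "(\<Sum>i\<in>{1..l}. ?D i + (if i = 1 \<and> k + 2 \<le> d then 1 else 0)) =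
        (\<Sum>i\<in>{1..l}. ?D i) + (if 1 \<le> l \<and> k + 2 \<le> d then 1 else 0)"
      by (cases "k + 2 \<le> d") (auto simp: sum.distrib)
    moreover have "dhprime h k d l = 1 + (\<Sum>i\<in>{1..l}. ?D i)"
      using dhprime_eq[OF ld k(2)] .
    ultimately show ?thesis using c[OF l] by (cases "l = 0") (auto split: if_splits)
  qed
  moreover have "1 \<le> i \<and> i < d" if "g i \<noteq> 0" for i using that by (auto simp: g_def split: if_splits)
  ultimately obtain c where "reach d (\<lambda>j. b j + g j) c"
    using reach_path[OF rb, of g] by blast
  moreover have "b j + g j = h j" if "j \<le> d" for j
    using that h0 hzero[of d] k by (cases "j = d"; cases "j = 0") (auto simp: b_def g_def)
  ultimately show ?thesis by blast
qed

lemma reach_degenerate: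
  fixes h :: "nat \<Rightarrow> nat" and d n :: nat
  assumes h0: "h 0 = 1" and hd: "h d = 0" and d: "2 \<le> d"
    and hpos: "\<And>j. 1 \<le> j \<Longrightarrow> j < d \<Longrightarrow> h j > 0"
    and nn: "\<And>l. 2 * l < d \<Longrightarrow> dhprime h (d - 1) d l \<ge> 0"
    and n: "0 < n" "2 * n < d" "dhprime h (d - 1) d n = 0"
    and min: "\<And>m. 0 < m \<Longrightarrow> m < n \<Longrightarrow> dhprime h (d - 1) d m \<noteq> 0"
    and ev: "even (\<Sum>i\<le>d. hprime h (d - 1) i)"
    and ub: "\<And>l. n + 1 \<le> l \<Longrightarrow> l + n + 1 \<le> d \<Longrightarrow>
       dhprime h (d - 1) d l \<le> (\<Sum>i\<le>n - 1. hprime h (d - 1) (l - i))"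
  shows "\<exists>g c. reach d g c \<and> (\<forall>j\<le>d. g j = h j)"
proof -
  let ?p = "hprime h (d - 1)"
  \<comment> \<open>What \<open>h\<close> leaves after the cone has used one simplex of each type;
    in \<open>g\<close> one simplex of type \<open>d - n\<close> is set aside for the end.\<close>
  define q where "q = (\<lambda>j. if 1 \<le> j \<and> j < d then h j - 1 else 0)"
  define g where "g = (\<lambda>j. q j - (if j = d - n then 1 else 0))"
  have pq: "?p i = int (q i)" if "1 \<le> i" "i < d" for i
  proof -
    have "i \<le> d - 1" using that by simp
    then show ?thesis using that hpos[of i] by (simp add: hprime_def q_def of_nat_diff)
  qed
  have D: "dhprime h (d - 1) d l = 1 + (int (low q l) - int (high d q l))" if "l < d" for l
  proof -
    have q0: "q 0 = 0" by (simp add: q_def)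
    have "(\<Sum>i\<in>{1..l}. ?p i - ?p (d - i)) = (\<Sum>i\<in>{1..l}. int (q i) - int (q (d - i)))"
      using pq that by (intro sum.cong) auto
    then show ?thesis using dhprime_eq[OF that, of "d - 1" h] d low_minus_high[OF that, of q, OF q0] by simp
  qed
  have Dpos: "dhprime h (d - 1) d l > 0" if "l < n" for l
  proof (cases "l = 0")
    case True
    then show ?thesis using dhprime_eq[of 0 d "d - 1" h] d by simp
  next
    case False
    then show ?thesis using nn[of l] min[of l] that n by fastforce
  qed
  \<comment> \<open>From \<open>n - 1\<close> to \<open>n\<close> the value of
    \<open>dhprime\<close> falls from positive to 0, so something must be subtracted at
    \<open>d - n\<close>.\<close>
  have qn: "q (d - n) \<ge> 1"
  proof -
    have hi: "high d q n = high d q (n - 1) + q (d - n)"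
    proof -
      have "{d - n..<d} = insert (d - n) {d - (n - 1)..<d}" using n by auto
      moreover have "d - n \<notin> {d - (n - 1)..<d}" using n by auto
      ultimately show ?thesis by (simp add: high_def)
    qed
    have "low q (n - 1) \<le> low q n" by (rule low_mono) simp
    moreover have "n < d" "n - 1 < d" using n by auto
    ultimately show ?thesis using hi D[of n] D[of "n - 1"] Dpos[of "n - 1"] n by simp
  qed
  have qg: "q = (\<lambda>j. g j + (if j = d - n then 1 else 0))" using qn by (auto simp: g_def fun_eq_iff)
  have lq: "low q l = low g l + (if d - n \<le> l then 1 else 0)" for l
    by (subst qg) (simp add: low_add low_delta)
  have hq: "high d q l = high d g l + (if n \<le> l then 1 else 0)" if "l < d" for l
    using n that by (subst qg) (auto simp: high_add high_delta)
  have totq: "(\<Sum>i<d. q i) = (\<Sum>i<d. g i) + 1" using n by (subst qg) (simp add: sum.distrib)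
  have supp: "1 \<le> i \<and> i < d" if "g i \<noteq> 0" for i using that by (auto simp: g_def q_def split: if_splits)
  \<comment> \<open>Setting aside one type \<open>d - n\<close> cancels the summand 1 in
    \<open>D\<close>, so the counts at \<open>n\<close> balance exactly.\<close>
  have Dn: "low g n = high d g n" using D[of n] n lq[of n] hq[of n] by (cases "d - n \<le> n") auto
  have evg: "even (\<Sum>i<d. g i)"
  proof -
    have "(\<Sum>i\<le>d. ?p i) = (\<Sum>i<d. ?p i) + ?p d" unfolding lessThan_Suc_atMost[symmetric] by simp
    also have "?p d = 0" using d by (cases "d \<le> d - 1") (auto simp: hprime_def)
    also have "(\<Sum>i<d. ?p i) = (\<Sum>i<d. int (q i) + (if i = 0 then 1 else 0))"
      using pq by (intro sum.cong) (auto simp: q_def hprime_def)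
    also have "\<dots> = int (\<Sum>i<d. q i) + 1" using d by (simp add: sum.distrib)
    finally have "(\<Sum>i\<le>d. ?p i) = int ((\<Sum>i<d. g i) + 2)" using totq by simp
    then show ?thesis using ev by (simp only: even_of_nat) simp
  qed
  have sym: "low g (d - 1 - l) + high d g l = (\<Sum>i<d. g i)" if "l < d" for l
    using low_high_total[of "d - 1 - l" d g] that by simp
  have U1: "high d g l \<le> low g l" if "2 * l < d" for l
  proof -
    have "low q l = low g l" using lq[of l] that n by simp
    then show ?thesis using nn[OF that] Dpos[of l] D[of l] hq[of l] that by (cases "n \<le> l") auto
  qed
  \<comment> \<open>Complementary counts add up to the total, so the inequality at
    \<open>d - 1 - l\<close> is equivalent to the one at \<open>l\<close>.\<close>
  have U: "high d g l \<le> low g l" if "l < d" for l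
  proof (cases "2 * l < d")
    case False
    then have "2 * (d - 1 - l) < d" using that by linarith
    from U1[OF this] show ?thesis using sym[OF that] low_high_total[OF that, of g] by linarith
  qed (rule U1)
  have L1: "low g (l - n) \<le> high d g l" if "n \<le> l" "l \<le> 2 * n" for l
    using low_mono[of "l - n" n g] high_mono[of n l d g] Dn that by linarith
  have L: "low g (l - n) \<le> high d g l" if l: "n \<le> l" "l < d" for l
  proof -
    \<comment> \<open>Up to \<open>2 * n\<close> the balance at \<open>n\<close> and monotonicity
      give the bound, from \<open>d - n\<close> on complementary counts reduce to that range, and in
      between \<open>ub\<close> is used.\<close>
    consider "l \<le> 2 * n" | "2 * n < l" "l + n + 1 \<le> d" | "2 * n < l" "d \<le> l + n" by linarith
    then show ?thesis
    proof cases
      case 1 then show ?thesis using L1 l by blast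
    next
      case 2
      have "(\<Sum>i\<le>n - 1. ?p (l - i)) = (\<Sum>i\<in>{l - n + 1..l}. ?p i)"
        using 2 n by (intro sum.reindex_bij_witness[of _ "\<lambda>i. l - i" "\<lambda>i. l - i"]) auto
      also have "\<dots> = (\<Sum>i\<in>{l - n + 1..l}. int (q i))" using pq 2 by (intro sum.cong) auto
      finally have s: "(\<Sum>i\<le>n - 1. ?p (l - i)) = int (\<Sum>i\<in>{l - n + 1..l}. q i)" by simp
      have "{..l} = {..l - n} \<union> {l - n + 1..l}" by auto
      then have "low q l = low q (l - n) + (\<Sum>i\<in>{l - n + 1..l}. q i)"
        unfolding low_def by (simp only:) (rule sum.union_disjoint, auto)
      \<comment> \<open>The sum in \<open>ub\<close> reduces \<open>low q l\<close> to
        \<open>low q (l - n)\<close>; the summand 1 in \<open>D\<close> pays for the type set aside,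
        which is counted in \<open>high d q l\<close>.\<close>
      then have "1 + int (low q (l - n)) \<le> int (high d q l)"
        using ub[of l] 2 n s D[OF l(2)] by simp
      then show ?thesis using lq[of "l - n"] hq[OF l(2)] 2 l by simp
    next
      case 3
      have *: "low g (d - 1 - l + n - n) \<le> high d g (d - 1 - l + n)" by (rule L1) (use 3 l in linarith)+
      have "l - n < d" "d - 1 - (l - n) = d - 1 - l + n" using l 3 by auto
      then show ?thesis using * sym[OF l(2)] low_high_total[of "l - n" d g] by simp
    qed
  qed
  define b :: "nat \<Rightarrow> nat" where "b = (\<lambda>j. if j < d then 1 else 0)"
  have "reach d b d" unfolding b_def using d by (intro reach_cone) simp
  then have "reach d b (d - n)" by (rule reach_mono) (use n in auto)
  then have "reach d (\<lambda>j. b j + g j) (d - n)" using reach_pairs[OF _ n(2) supp evg U L] by blast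
  then have "reach d ((\<lambda>j. b j + g j)(d - n := b (d - n) + g (d - n) + 1)) (d - (d - n))"
    using n by (intro reach_flip) auto
  moreover have "((\<lambda>j. b j + g j)(d - n := b (d - n) + g (d - n) + 1)) j = h j" if "j \<le> d" for j
  proof -
    have "b j + q j = h j" using that h0 hd hpos[of j] d
      by (cases "j = d"; cases "j = 0") (auto simp: b_def q_def)
    then show ?thesis using fun_cong[OF qg, of j] by auto
  qed
  ultimately show ?thesis by blast
qed

theorem theorem6p3:
  fixes h :: "nat \<Rightarrow> nat" and d k :: nat
  assumes h0: "h 0 = 1"
    and k: "1 \<le> k" "k \<le> d - 1"
    and hzero: "\<forall>j. k < j \<and> j \<le> d \<longrightarrow> h j = 0"
    and hpos: "\<forall>j. 1 \<le> j \<and> j \<le> k \<longrightarrow> h j > 0"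
    and cond: "(\<forall>j\<le>(d - 1) div 2. dhprime h k d j > 0) \<or>
       ((\<forall>j\<le>(d - 1) div 2. dhprime h k d j \<ge> 0) \<and>
        (\<exists>n. 0 < n \<and> n \<le> (d - 1) div 2 \<and> dhprime h k d n = 0 \<and>
             (\<forall>m. 0 < m \<and> m < n \<longrightarrow> dhprime h k d m \<noteq> 0) \<and>
             even (\<Sum>i\<le>d. hprime h k i) \<and>
             (\<forall>l. n + 1 \<le> l \<and> l \<le> d - (n + 1) \<longrightarrow>
                  dhprime h k d l \<le> (\<Sum>i\<le>n - 1. hprime h k (l - i)))))"
  shows "\<exists>(P :: nat set) le z. simplicial_poset P le z \<and> has_dim P le z d \<and>
           realization P le z homeomorphic_space nball (d - 1) \<and>
           has_hvec P le z d h"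
proof -
  have kd: "k < d" "2 \<le> d" using k by auto
  have half: "l \<le> (d - 1) div 2 \<longleftrightarrow> 2 * l < d" for l using kd by auto
  have nn: "dhprime h k d l \<ge> 0" if "2 * l < d" for l
    using cond that half by fastforce
  have "\<exists>g c. reach d g c \<and> (\<forall>j\<le>d. g j = h j)"
  proof (cases "(\<forall>j\<le>(d - 1) div 2. dhprime h k d j > 0) \<or> k + 2 \<le> d")
    case True
    then have "dhprime h k d l > 0 \<or> dhprime h k d l \<ge> 0 \<and> k + 2 \<le> d" if "2 * l < d" for l
      using that nn[of l] half[of l] True by blast
    then show ?thesis
      by (intro reach_positive[of h k d]) (use h0 k(1) kd(1) hzero hpos in auto)
  next
    case False
    then have kd1: "k = d - 1" using k by auto
    obtain n where n: "0 < n" "n \<le> (d - 1) div 2" "dhprime h k d n = 0"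
        "\<forall>m. 0 < m \<and> m < n \<longrightarrow> dhprime h k d m \<noteq> 0" "even (\<Sum>i\<le>d. hprime h k i)"
        "\<forall>l. n + 1 \<le> l \<and> l \<le> d - (n + 1) \<longrightarrow>
           dhprime h k d l \<le> (\<Sum>i\<le>n - 1. hprime h k (l - i))"
      using cond False by blast
    show ?thesis
    proof (rule reach_degenerate[of h d n])
      show "h d = 0" using hzero kd(1) by simp
      show "h j > 0" if "1 \<le> j" "j < d" for j using hpos that kd1 by simp
      show "dhprime h (d - 1) d l \<le> (\<Sum>i\<le>n - 1. hprime h (d - 1) (l - i))"
        if "n + 1 \<le> l" "l + n + 1 \<le> d" for l
        using n(6) that kd1 by simp
    qed (use h0 kd n nn half kd1 in auto)
  qed
  then obtain g c where "reach d g c" "\<And>j. j \<le> d \<Longrightarrow> g j = h j" by blast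
  then show ?thesis using reach_goal[of d g c h] h0 by simp
qed

end
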